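(* Let $\mathbb{F}=\mathbb{R}$ or $\mathbb{F}=\mathbb{C}$, let $m,n,d$ be positive integers, let $M(\lambda)\in\mathbb{F}[\lambda]^{m\times(m+n)}_d$ be a polynomial matrix with full-Sylvester-rank, let $k'=\left\lceil\frac{md}{n}\right\rceil$ and $t=nk'-md$ (so $0\le t<n$), and let $N(\lambda)\in\mathbb{F}[\lambda]^{n\times(m+n)}_{k'}$ be a minimal basis dual to $M(\lambda)$ with highest-row-degree coefficient matrix $N_{hr}\in\mathbb{F}^{n\times(m+n)}$. Define $\theta_1(M)$ and $\theta_2(M)$ as follows. (a) If $k'>1$ and $t>0$, $$\theta_1(M):=\min\left\{\frac{\sigma_{(k'-1)(m+n)}(S_{k'-1}(M))}{\sqrt{k'-1}},\ \frac{\sigma_{(k'+d)m}(S_{k'}(M))}{\sqrt{k'}},\ \frac{\sigma_{(k'+1+d)m}(S_{k'+1}(M))}{\sqrt{k'+1}}\right\},$$ $$\theta_2(M):=\min\left\{\frac{\sigma_{(k'+d)m}(S_{k'}(M))}{\sqrt{k'}},\ \frac{\sigma_{(k'+1+d)m}(S_{k'+1}(M))}{\sqrt{k'+1}}\right\}.$$ (b) If $k'=1$ and $t>0$, $$\theta_1(M)=\theta_2(M):=\min\left\{\sigma_{(d+1)m}(S_1(M)),\ \frac{\sigma_{(d+2)m}(S_2(M))}{\sqrt2}\right\}.$$ (c) If $t=0$, $$\theta_1(M):=\min\left\{\frac{\sigma_{(k'+d)m}(S_{k'}(M))}{\sqrt{k'}},\ \frac{\sigma_{(k'+1+d)m}(S_{k'+1}(M))}{\sqrt{k'+1}}\right\},\qquad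 \theta_2(M):=\frac{\sigma_{(k'+1+d)m}(S_{k'+1}(M))}{\sqrt{k'+1}}.$$ Then every $\widetilde M(\lambda)\in\mathbb{F}[\lambda]^{m\times(m+n)}_d$ such that $$\|S_1(M)-S_1(\widetilde M)\|_2<\frac12\cdot\theta_1(M)\cdot\frac{\sigma_n(N_{hr})}{\|S_1(N)\|_F}$$ has full-Sylvester-rank and has a dual minimal basis $\widetilde N(\lambda)\in\mathbb{F}[\lambda]^{n\times(m+n)}_{k'}$ that satisfies $$\frac{\|S_1(N)-S_1(\widetilde N)\|_F}{\|S_1(N)\|_F}\le\frac{2}{\theta_2(M)}\cdot\|S_1(M)-S_1(\widetilde M)\|_2 .$$ In addition, if $t=0$, then all the row degrees of $\widetilde N(\lambda)$ and $N(\lambda)$ are equal to $k'$.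
   Context: $\mathbb{F}[\lambda]^{p\times q}_g$ is the $\mathbb{F}$-vector space of $p\times q$ polynomial matrices of degree at most $g$. Sylvester matrices: for $P(\lambda)=P_0+P_1\lambda+\cdots+P_g\lambda^g\in\mathbb{F}[\lambda]^{p\times q}_g$ and $k\ge1$, $S_k(P)\in\mathbb{F}^{(k+g)p\times kq}$ is the block matrix with $k+g$ block rows and $k$ block columns whose $(i,j)$ block is $P_{i-j}$ if $0\le i-j\le g$ and $0$ otherwise. Here $g=d$ for $M,\widetilde M$ and $g=k'$ for $N,\widetilde N$; so $S_1(P)$ is the block column with blocks $P_0,\dots,P_g$. $P(\lambda)\in\mathbb{F}[\lambda]^{m\times(m+n)}_d$ has full-Sylvester-rank if $\operatorname{rank}S_k(P)=\min\{(k+d)m,\;k(m+n)\}$ for all $k=1,2,\dots$. $\sigma_1(A)\ge\sigma_2(A)\ge\cdots\ge\sigma_{\min\{p,q\}}(A)$ are the singular values of $A\in\mathbb{F}^{p\times q}$, $\|A\|_2=\sigma_1(A)$, and $\|A\|_F$ is the Frobenius norm. Minimal bases: a minimal basis of a subspace $\mathcal V\subseteq\mathbb{F}(\lambda)^{q}$ (over $\mathbb{F}(\lambda)$) is a basis of $\mathcal V$ consisting of polynomial vectors whose sum of degrees (degree of a vector = highest degree of its entries) is minimal among all polynomial bases of $\mathcal V$. A polynomial matrix with fewer rows than columns is called a minimal basis if its rows form a minimal basis of the subspace they span. Polynomial matrices $M(\lambda)\in\mathbb{F}[\lambda]^{m\times(m+n)}$ and $N(\lambda)\in\mathbb{F}[\lambda]^{n\times(m+n)}$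 of full row rank are dual minimal bases (each is dual to the other) if both are minimal bases and $M(\lambda)N(\lambda)^T=0$. (Full-Sylvester-rank matrices are minimal bases, and all minimal bases dual to them have degree $k'$.) The row degrees of a polynomial matrix are the degrees of its rows. The highest-row-degree coefficient matrix $N_{hr}$ is the constant matrix whose $i$th row is the vector coefficient of $\lambda^{\varepsilon_i}$ in the $i$th row of $N(\lambda)$, where $\varepsilon_i$ is the degree of that row. *)

theory Defs
  imports
    "Jordan_Normal_Form.Schur_Decomposition"
    "Jordan_Normal_Form.DL_Rank"
    "HOL-Computational_Algebra.Polynomial_Factorial"
begin

(* The scalar field is either \<real> or \<complex>: a type of this class is a copy of one of the two,
   with the norm and conjugation (trivial on \<real>) inherited from \<complex>. *)
class real_or_complex = real_normed_field + conjugatable_field +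
  fixes to_complex :: "'a \<Rightarrow> complex"
  assumes to_complex_add: "to_complex (x + y) = to_complex x + to_complex y"
    and to_complex_mult: "to_complex (x * y) = to_complex x * to_complex y"
    and to_complex_scaleR: "to_complex (r *\<^sub>R x) = r *\<^sub>R to_complex x"
    and to_complex_conjugate: "to_complex (conjugate x) = cnj (to_complex x)"
    and cmod_to_complex: "cmod (to_complex x) = norm x"
    and range_to_complex: "range to_complex = \<real> \<or> range to_complex = UNIV"

instantiation real :: real_or_complex
begin
definition to_complex_real :: "real \<Rightarrow> complex" where "to_complex_real = complex_of_real"
instance
  by standard (simp_all add: to_complex_real_def Reals_def scaleR_conv_of_real)
end

instantiation complex :: real_or_complex
begin
definition to_complex_complex :: "complex \<Rightarrow> complex" where "to_complex_complex = id"
instance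
  by standard (simp_all add: to_complex_complex_def)
end

(* The eigenvalues of A\<^sup>*A are real and nonnegative, so norm returns them as reals. A\<^sup>*A has
   dim_col A eigenvalues; if dim_row A < dim_col A, the surplus ones are 0 and are cut off. *)
definition singular_values :: "'a::real_or_complex mat \<Rightarrow> real list" where
  "singular_values A = take (min (dim_row A) (dim_col A))
     (rev (sorted_list_of_multiset
        (image_mset (\<lambda>z. sqrt (norm z)) (proots (char_poly (mat_adjoint A * A))))))"

(* Indices start at 1, and \<sigma> 1 A is the largest singular value. *)
definition \<sigma> :: "nat \<Rightarrow> 'a::real_or_complex mat \<Rightarrow> real" where
  "\<sigma> i A = singular_values A ! (i - 1)"

definition spectral_norm :: "'a::real_or_complex mat \<Rightarrow> real" where
  "spectral_norm A = \<sigma> 1 A"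

definition frobenius_norm :: "'a::real_normed_vector mat \<Rightarrow> real" where
  "frobenius_norm A = sqrt (\<Sum>i<dim_row A. \<Sum>j<dim_col A. (norm (A $$ (i, j)))\<^sup>2)"

definition poly_mats :: "nat \<Rightarrow> nat \<Rightarrow> nat \<Rightarrow> 'a::zero poly mat set" where
  "poly_mats p q g = {P \<in> carrier_mat p q. \<forall>i<p. \<forall>j<q. degree (P $$ (i, j)) \<le> g}"

(* sylvester g k P is S\<^sub>k(P), where g is the degree bound on P. Row r lies in block row
   r div p, at position r mod p within the block; likewise for columns. *)
definition sylvester :: "nat \<Rightarrow> nat \<Rightarrow> 'a::zero poly mat \<Rightarrow> 'a mat" where
  "sylvester g k P = (let p = dim_row P; q = dim_col P in
     mat ((k + g) * p) (k * q) (\<lambda>(r, c).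
       let i = r div p; j = c div q in
       if j \<le> i \<and> i - j \<le> g then coeff (P $$ (r mod p, c mod q)) (i - j) else 0))"

definition full_sylvester_rank :: "nat \<Rightarrow> 'a::field poly mat \<Rightarrow> bool" where
  "full_sylvester_rank d P \<longleftrightarrow>
     (\<forall>k\<ge>1. vec_space.rank ((k + d) * dim_row P) (sylvester d k P) =
              min ((k + d) * dim_row P) (k * dim_col P))"

definition vec_degree :: "'a::zero poly vec \<Rightarrow> nat" where
  "vec_degree v = Max ((\<lambda>j. degree (v $ j)) ` {..<dim_vec v})"

abbreviation rat_span :: "nat \<Rightarrow> 'a::field poly vec list \<Rightarrow> 'a poly fract vec set" where
  "rat_span q bs \<equiv> LinearCombinations.module.span class_ring (module_vec TYPE('a poly fract) q)
     (map_vec to_fract ` set bs)"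

abbreviation rat_indpt :: "nat \<Rightarrow> 'a::field poly vec list \<Rightarrow> bool" where
  "rat_indpt q bs \<equiv> LinearCombinations.module.lin_indpt class_ring (module_vec TYPE('a poly fract) q)
     (map_vec to_fract ` set bs)"

(* lin_indpt speaks about sets; linear independence of the family bs therefore also needs
   distinct bs. *)
definition polynomial_basis ::
  "nat \<Rightarrow> 'a::field poly fract vec set \<Rightarrow> 'a poly vec list \<Rightarrow> bool" where
  "polynomial_basis q V bs \<longleftrightarrow>
     set bs \<subseteq> carrier_vec q \<and> distinct bs \<and> rat_indpt q bs \<and> rat_span q bs = V"

definition minimal_basis_of ::
  "nat \<Rightarrow> 'a::field poly fract vec set \<Rightarrow> 'a poly vec list \<Rightarrow> bool" where
  "minimal_basis_of q V bs \<longleftrightarrow> polynomial_basis q V bs \<and>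
     (\<forall>cs. polynomial_basis q V cs \<longrightarrow> (\<Sum>b\<leftarrow>bs. vec_degree b) \<le> (\<Sum>c\<leftarrow>cs. vec_degree c))"

definition minimal_basis :: "'a::field poly mat \<Rightarrow> bool" where
  "minimal_basis P \<longleftrightarrow> dim_row P < dim_col P \<and>
     minimal_basis_of (dim_col P) (rat_span (dim_col P) (rows P)) (rows P)"

(* Full row rank over the rational functions is part of minimal_basis. *)
definition dual_minimal_bases :: "'a::field poly mat \<Rightarrow> 'a poly mat \<Rightarrow> bool" where
  "dual_minimal_bases M N \<longleftrightarrow>
     dim_col M = dim_row M + dim_row N \<and> dim_col N = dim_row M + dim_row N \<and>
     minimal_basis M \<and> minimal_basis N \<and>
     M * transpose_mat N = 0\<^sub>m (dim_row M) (dim_row N)"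

definition row_degree :: "'a::zero poly mat \<Rightarrow> nat \<Rightarrow> nat" where
  "row_degree P i = vec_degree (row P i)"

definition highest_row_degree_coeff :: "'a::zero poly mat \<Rightarrow> 'a mat" where
  "highest_row_degree_coeff P =
     mat (dim_row P) (dim_col P) (\<lambda>(i, j). coeff (P $$ (i, j)) (row_degree P i))"

definition theta1 ::
  "nat \<Rightarrow> nat \<Rightarrow> nat \<Rightarrow> nat \<Rightarrow> nat \<Rightarrow> 'a::real_or_complex poly mat \<Rightarrow> real" where
  "theta1 m n d k t M =
    (if t > 0 then
       if k > 1 then
         Min {\<sigma> ((k - 1) * (m + n)) (sylvester d (k - 1) M) / sqrt (real (k - 1)),
              \<sigma> ((k + d) * m) (sylvester d k M) / sqrt (real k),
              \<sigma> ((k + 1 + d) * m) (sylvester d (k + 1) M) / sqrt (real (k + 1))}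
       else
         min (\<sigma> ((d + 1) * m) (sylvester d 1 M))
             (\<sigma> ((d + 2) * m) (sylvester d 2 M) / sqrt 2)
     else
       min (\<sigma> ((k + d) * m) (sylvester d k M) / sqrt (real k))
           (\<sigma> ((k + 1 + d) * m) (sylvester d (k + 1) M) / sqrt (real (k + 1))))"

definition theta2 ::
  "nat \<Rightarrow> nat \<Rightarrow> nat \<Rightarrow> nat \<Rightarrow> nat \<Rightarrow> 'a::real_or_complex poly mat \<Rightarrow> real" where
  "theta2 m n d k t M =
    (if t > 0 then
       if k > 1 then
         min (\<sigma> ((k + d) * m) (sylvester d k M) / sqrt (real k))
             (\<sigma> ((k + 1 + d) * m) (sylvester d (k + 1) M) / sqrt (real (k + 1)))
       else
         min (\<sigma> ((d + 1) * m) (sylvester d 1 M))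
             (\<sigma> ((d + 2) * m) (sylvester d 2 M) / sqrt 2)
     else
       \<sigma> ((k + 1 + d) * m) (sylvester d (k + 1) M) / sqrt (real (k + 1)))"

end

theory Submission
  imports Defs "Jordan_Normal_Form.Spectral_Radius" "HOL-Analysis.L2_Norm"
begin

text \<open>A vector in the kernel of \<open>S\<^sub>k(M)\<close> is a polynomial vector of degree less than \<open>k\<close> annihilated by
  \<open>M\<close>. Since \<open>S\<^sub>k(M)\<close> is injective for \<open>k < k'\<close> and surjective for \<open>k \<ge> k'\<close>, a minimal basis of the
  null space of \<open>M\<close> has \<open>t\<close> members of degree \<open>k' - 1\<close> and \<open>n - t\<close> of degree \<open>k'\<close>, hence degree sum
  \<open>m d\<close>. For a perturbation \<open>M'\<close> one has \<open>\<parallel>S\<^sub>k(M) - S\<^sub>k(M')\<parallel> \<le> sqrt k \<parallel>S\<^sub>1(M) - S\<^sub>1(M')\<parallel>\<close>, so the bound by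
  \<open>\<theta>\<^sub>1\<close> keeps the Sylvester matrices of \<open>M'\<close> injective respectively surjective. A row of \<open>N\<close> of degree
  \<open>\<epsilon>\<close> lies in the kernel of \<open>S\<^bsub>\<epsilon>+1\<^esub>(M)\<close>; it is moved into the kernel of \<open>S\<^bsub>\<epsilon>+1\<^esub>(M')\<close> by subtracting a
  solution \<open>z\<close>, of small norm, of \<open>S\<^bsub>\<epsilon>+1\<^esub>(M') z = S\<^bsub>\<epsilon>+1\<^esub>(M') x\<close>. The bound by \<open>\<sigma>\<^sub>n(N\<^sub>h\<^sub>r)\<close> keeps the leading
  coefficient vectors independent, so the new rows are independent over the rational functions and have
  degree sum at most \<open>m d\<close>, which is the least possible.\<close>

section \<open>Finite families over a field\<close>

text \<open>Only two inequalities about singular values are used: the first one bounds |A x| from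
  above, and the last one bounds |A x| from below for tall A and |A^* y| for wide A. As singular
  values are sorted roots of a characteristic polynomial, both must come from eigenvalues; instead
  of diagonalising, the proof compares the growth of powers of a Hermitian matrix with a bound on
  them. The factor 1/2 in the hypothesis leaves at least half of each singular value that enters
  \<open>theta1\<close> after the perturbation; this is the origin of 2 / \<open>theta2\<close>. The
  quotient of \<sigma>_n(N_hr) and the norm of S_1(N) is at most 1, so one hypothesis serves twice:
  it gives \<delta> < \<open>theta1\<close> / 2 for the ranks and, since \<open>theta1\<close> \<le>
  \<open>theta2\<close>, it makes N move by less than \<sigma>_n(N_hr). Independence is stated for
  indexed families of functions, so that repeated members count as dependent and one dimension count
  serves both the scalars and the rational functions.\<close>

definition indep :: "'i set \<Rightarrow> 'j set \<Rightarrow> ('i \<Rightarrow> 'j \<Rightarrow> 'k::field) \<Rightarrow> bool" where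
  "indep I J p \<longleftrightarrow> (\<forall>c. (\<forall>j\<in>J. (\<Sum>i\<in>I. c i * p i j) = 0) \<longrightarrow> (\<forall>i\<in>I. c i = 0))"

lemma indepI:
  "(\<And>c. (\<And>j. j \<in> J \<Longrightarrow> (\<Sum>i\<in>I. c i * p i j) = 0) \<Longrightarrow> (\<And>i. i \<in> I \<Longrightarrow> c i = 0)) \<Longrightarrow> indep I J p"
  unfolding indep_def by blast

lemma indepD:
  "indep I J p \<Longrightarrow> (\<And>j. j \<in> J \<Longrightarrow> (\<Sum>i\<in>I. c i * p i j) = 0) \<Longrightarrow> i \<in> I \<Longrightarrow> c i = 0"
  unfolding indep_def by blast

lemma indep_cong:
  assumes "\<And>i j. i \<in> I \<Longrightarrow> j \<in> J \<Longrightarrow> p i j = q i j"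
  shows "indep I J p \<longleftrightarrow> indep I J q"
proof -
  have "(\<Sum>i\<in>I. c i * p i j) = (\<Sum>i\<in>I. c i * q i j)" if "j \<in> J" for c j
    using assms that by (intro sum.cong) auto
  then show ?thesis unfolding indep_def by simp
qed

lemma indep_subset:
  assumes "finite I" "I' \<subseteq> I" "indep I J p"
  shows "indep I' J p"
proof (rule indepI)
  fix c i assume c: "\<And>j. j \<in> J \<Longrightarrow> (\<Sum>i\<in>I'. c i * p i j) = 0" and i: "i \<in> I'"
  let ?c = "\<lambda>i. if i \<in> I' then c i else 0"
  have "(\<Sum>i\<in>I. ?c i * p i j) = 0" if "j \<in> J" for j
    using c[OF that] assms(1,2) by (subst sum.mono_neutral_cong_right[of I I' _ "\<lambda>i. c i * p i j"]) auto
  from indepD[OF assms(3) this, of i] i assms(2) show "c i = 0" by auto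
qed

text \<open>Gaussian elimination, one coordinate at a time: a coordinate where all members vanish is
  dropped; otherwise a pivot member is removed together with it.\<close>

lemma indep_card:
  fixes p :: "'i \<Rightarrow> 'j \<Rightarrow> 'k::field"
  assumes "finite J" "finite I" "indep I J p"
  shows "card I \<le> card J"
  using assms
proof (induction J arbitrary: I p rule: finite_induct)
  case empty
  show ?case
  proof (cases "I = {}")
    case False
    then obtain i where "i \<in> I" by blast
    from indepD[OF empty(2) _ this, of "\<lambda>_. 1"] show ?thesis by simp
  qed simp
next
  case (insert j J)
  show ?case
  proof (cases "\<forall>i\<in>I. p i j = 0")
    case True
    have "indep I J p"
    proof (rule indepI)
      fix c i assume c: "\<And>l. l \<in> J \<Longrightarrow> (\<Sum>i\<in>I. c i * p i l) = 0" and i: "i \<in> I"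
      have "(\<Sum>i\<in>I. c i * p i l) = 0" if "l \<in> insert j J" for l
        using c that True by (cases "l = j") auto
      from indepD[OF insert(5) this i] show "c i = 0" .
    qed
    from insert(3)[OF insert(4) this] insert(1,2) show ?thesis by simp
  next
    case False
    then obtain i0 where i0: "i0 \<in> I" "p i0 j \<noteq> 0" by blast
    \<comment> \<open>Subtracting multiples of the pivot \<open>p i0\<close> makes coordinate
      \<open>j\<close> vanish.\<close>
    define q where "q i l = p i l - p i j / p i0 j * p i0 l" for i l
    have "indep (I - {i0}) J q"
    proof (rule indepI)
      fix c i assume c: "\<And>l. l \<in> J \<Longrightarrow> (\<Sum>i\<in>I - {i0}. c i * q i l) = 0" and i: "i \<in> I - {i0}"
      \<comment> \<open>\<open>c'\<close> rewrites a combination of \<open>q\<close> as one of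
        \<open>p\<close>; the pivot collects the subtracted multiples.\<close>
      define c' where "c' = c(i0 := - (\<Sum>i\<in>I - {i0}. c i * p i j / p i0 j))"
      have "(\<Sum>i\<in>I. c' i * p i l) = (\<Sum>i\<in>I - {i0}. c i * q i l)" for l
      proof -
        have "(\<Sum>i\<in>I. c' i * p i l) = c' i0 * p i0 l + (\<Sum>i\<in>I - {i0}. c' i * p i l)"
          using insert(4) i0(1) by (simp add: sum.remove)
        also have "(\<Sum>i\<in>I - {i0}. c' i * p i l) = (\<Sum>i\<in>I - {i0}. c i * p i l)"
          by (intro sum.cong) (auto simp: c'_def)
        finally show ?thesis
          by (simp add: c'_def q_def algebra_simps sum_subtractf sum_distrib_left)
      qed
      moreover have "(\<Sum>i\<in>I - {i0}. c i * q i j) = 0"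
        using i0(2) by (simp add: q_def)
      ultimately have "c' i = 0" using indepD[OF insert(5), of c' i] c i by auto
      then show "c i = 0" using i by (simp add: c'_def)
    qed
    from insert(3)[OF _ this] insert(1,2,4) i0(1) show ?thesis by simp
  qed
qed

text \<open>\<open>a i j\<close> is the coefficient of the unknown \<open>i\<close> in equation
  \<open>j\<close>. If there are more unknowns than equations, a linear relation among the rows of
  \<open>a\<close> is a solution. Removing an unknown where it does not vanish leaves a smaller
  system, whose solutions vanish there and are thus independent of the first.\<close>

lemma solutions_exist:
  fixes a :: "'i \<Rightarrow> 'j \<Rightarrow> 'k::field"
  assumes "finite I" "finite J"
  shows "\<exists>B. indep {..<card I - card J} I B \<and>
    (\<forall>b<card I - card J. (\<forall>i. i \<notin> I \<longrightarrow> B b i = 0) \<and> (\<forall>j\<in>J. (\<Sum>i\<in>I. B b i * a i j) = 0))"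
  using assms(1)
proof (induction "card I - card J" arbitrary: I)
  case 0
  then show ?case by (simp add: indep_def)
next
  case (Suc s)
  then have "\<not> indep I J a" using indep_card[OF assms(2) Suc(3), of a] by auto
  then obtain c i0 where c: "\<And>j. j \<in> J \<Longrightarrow> (\<Sum>i\<in>I. c i * a i j) = 0" and i0: "i0 \<in> I" "c i0 \<noteq> 0"
    unfolding indep_def by blast
  have s: "s = card (I - {i0}) - card J" using Suc(2,3) i0 by simp
  obtain B where B: "indep {..<s} (I - {i0}) B"
    "\<And>b i. b < s \<Longrightarrow> i \<notin> I - {i0} \<Longrightarrow> B b i = 0"
    "\<And>b j. b < s \<Longrightarrow> j \<in> J \<Longrightarrow> (\<Sum>i\<in>I - {i0}. B b i * a i j) = 0"
    using Suc(1)[OF s] Suc(3) unfolding s[symmetric] by auto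
  define B' where "B' = B(s := (\<lambda>i. if i \<in> I then c i else 0))"
  have "indep {..<Suc s} I B'"
  proof (rule indepI)
    fix e b assume e: "\<And>i. i \<in> I \<Longrightarrow> (\<Sum>b<Suc s. e b * B' b i) = 0" and b: "b \<in> {..<Suc s}"
    have "(\<Sum>b<s. e b * B' b i0) = 0" using B(2) by (intro sum.neutral) (auto simp: B'_def)
    then have es: "e s = 0" using e[OF i0(1)] i0 by (simp add: B'_def)
    have "(\<Sum>b<s. e b * B b i) = 0" if "i \<in> I - {i0}" for i
    proof -
      have "(\<Sum>b<s. e b * B b i) = (\<Sum>b<s. e b * B' b i)" by (intro sum.cong) (auto simp: B'_def)
      then show ?thesis using e[of i] that es by simp
    qed
    from indepD[OF B(1) this] have "e b = 0" if "b < s" for b using that by simp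
    then show "e b = 0" using b es by (cases "b = s") auto
  qed
  moreover have "(\<forall>i. i \<notin> I \<longrightarrow> B' b i = 0) \<and> (\<forall>j\<in>J. (\<Sum>i\<in>I. B' b i * a i j) = 0)" if "b < Suc s" for b
  proof (cases "b = s")
    case True
    then show ?thesis using c by (auto simp: B'_def)
  next
    case False
    then have b: "b < s" using that by simp
    have "(\<Sum>i\<in>I. B b i * a i j) = (\<Sum>i\<in>I - {i0}. B b i * a i j)" for j
      using Suc(3) i0(1) B(2)[OF b] by (simp add: sum.remove)
    then show ?thesis using B(2,3)[OF b] b by (auto simp: B'_def)
  qed
  ultimately show ?case using Suc(2) by metis
qed

text \<open>One half of rank-nullity: kernel vectors and preimages of unit vectors form one
  independent family, because applying \<open>a\<close> to a relation isolates the coefficients of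
  the preimages.\<close>

lemma kernel_card:
  fixes a :: "'i \<Rightarrow> 'j \<Rightarrow> 'k::field"
  assumes fin: "finite I" "finite J" "finite K"
    and B: "indep K I B"
    and ker: "\<And>k j. k \<in> K \<Longrightarrow> j \<in> J \<Longrightarrow> (\<Sum>i\<in>I. B k i * a i j) = 0"
    and surj: "\<And>j. j \<in> J \<Longrightarrow> \<exists>x. \<forall>l\<in>J. (\<Sum>i\<in>I. x i * a i l) = (if l = j then 1 else 0)"
  shows "card K + card J \<le> card I"
proof -
  from surj obtain x where
    x: "\<And>j l. j \<in> J \<Longrightarrow> l \<in> J \<Longrightarrow> (\<Sum>i\<in>I. x j i * a i l) = (if l = j then 1 else 0)" by metis
  have "indep (K <+> J) I (case_sum B x)"
  proof (rule indepI)
    fix c s assume "\<And>i. i \<in> I \<Longrightarrow> (\<Sum>s\<in>K <+> J. c s * case_sum B x s i) = 0" and s: "s \<in> K <+> J"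
    then have c: "(\<Sum>k\<in>K. c (Inl k) * B k i) + (\<Sum>j\<in>J. c (Inr j) * x j i) = 0" if "i \<in> I" for i
      using that fin by (simp add: sum.Plus)
    have r: "c (Inr l) = 0" if l: "l \<in> J" for l
    proof -
      have "0 = (\<Sum>i\<in>I. ((\<Sum>k\<in>K. c (Inl k) * B k i) + (\<Sum>j\<in>J. c (Inr j) * x j i)) * a i l)"
        using c by simp
      also have "\<dots> = (\<Sum>i\<in>I. \<Sum>k\<in>K. c (Inl k) * (B k i * a i l)) + (\<Sum>i\<in>I. \<Sum>j\<in>J. c (Inr j) * (x j i * a i l))"
        by (simp add: distrib_right sum_distrib_right sum.distrib mult.assoc)
      also have "\<dots> = (\<Sum>k\<in>K. c (Inl k) * (\<Sum>i\<in>I. B k i * a i l)) + (\<Sum>j\<in>J. c (Inr j) * (\<Sum>i\<in>I. x j i * a i l))"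
        by (subst (1 2) sum.swap) (simp add: sum_distrib_left)
      also have "\<dots> = (\<Sum>j\<in>J. c (Inr j) * (if l = j then 1 else 0))"
        using ker x l by simp
      also have "\<dots> = c (Inr l)" using l fin by (simp add: if_distrib cong: if_cong)
      finally show ?thesis by simp
    qed
    have "(\<Sum>k\<in>K. c (Inl k) * B k i) = 0" if "i \<in> I" for i using c[OF that] r by simp
    from indepD[OF B this] have "c (Inl k) = 0" if "k \<in> K" for k using that by blast
    with r s show "c s = 0" by auto
  qed
  from indep_card[OF fin(1) _ this] fin show ?thesis by (simp add: card_Plus)
qed

text \<open>A relation among the coordinate vectors \<open>C a\<close> carries over to the members
  \<open>p a\<close>, so the coordinate vectors are independent in dimension
  \<open>card B\<close>.\<close>

lemma span_card:
  fixes p :: "'i \<Rightarrow> 'j \<Rightarrow> 'k::field"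
  assumes "finite A" "finite B" "indep A J p"
    and sp: "\<And>a. a \<in> A \<Longrightarrow> \<exists>c. \<forall>j\<in>J. p a j = (\<Sum>b\<in>B. c b * q b j)"
  shows "card A \<le> card B"
proof -
  from sp obtain C where C: "\<And>a j. a \<in> A \<Longrightarrow> j \<in> J \<Longrightarrow> p a j = (\<Sum>b\<in>B. C a b * q b j)" by metis
  have "indep A B C"
  proof (rule indepI)
    fix e a assume e: "\<And>b. b \<in> B \<Longrightarrow> (\<Sum>a\<in>A. e a * C a b) = 0" and a: "a \<in> A"
    have "(\<Sum>a\<in>A. e a * p a j) = 0" if j: "j \<in> J" for j
    proof -
      have "(\<Sum>a\<in>A. e a * p a j) = (\<Sum>a\<in>A. \<Sum>b\<in>B. e a * C a b * q b j)"
        using C j by (simp add: sum_distrib_left mult.assoc)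
      also have "\<dots> = (\<Sum>b\<in>B. (\<Sum>a\<in>A. e a * C a b) * q b j)"
        by (subst sum.swap) (simp add: sum_distrib_right)
      finally show ?thesis using e by simp
    qed
    from indepD[OF assms(3) this a] show "e a = 0" .
  qed
  from indep_card[OF assms(2,1) this] show ?thesis .
qed

text \<open>The fresh index \<open>None\<close> carries the adjoined vector, so \<open>v\<close> may
  coincide with a member. \<open>dep\<close> speaks of an abstract family with these values, to
  which a dimension count applies directly.\<close>

lemma indep_insert_or_span:
  fixes p :: "'i \<Rightarrow> 'j \<Rightarrow> 'k::field"
  assumes fin: "finite K" and p: "indep K J p"
    and dep: "\<And>q :: 'i option \<Rightarrow> 'j \<Rightarrow> 'k. indep (insert None (Some ` K)) J q \<Longrightarrow> q None = v \<Longrightarrow>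
        (\<And>k. k \<in> K \<Longrightarrow> q (Some k) = p k) \<Longrightarrow> False"
  shows "\<exists>c. \<forall>j\<in>J. v j = (\<Sum>k\<in>K. c k * p k j)"
proof -
  let ?q = "case_option v p"
  have "\<not> indep (insert None (Some ` K)) J ?q" using dep[of ?q] by auto
  then obtain c s where c: "\<And>j. j \<in> J \<Longrightarrow> (\<Sum>s\<in>insert None (Some ` K). c s * ?q s j) = 0"
    and s: "s \<in> insert None (Some ` K)" "c s \<noteq> 0" unfolding indep_def by blast
  have c': "c None * v j + (\<Sum>k\<in>K. c (Some k) * p k j) = 0" if "j \<in> J" for j
    using c[OF that] fin by (simp add: sum.reindex)
  have "c None \<noteq> 0"
  proof
    assume "c None = 0"
    with c' have "(\<Sum>k\<in>K. c (Some k) * p k j) = 0" if "j \<in> J" for j using that by simp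
    from indepD[OF p this] have "c (Some k) = 0" if "k \<in> K" for k using that by blast
    with \<open>c None = 0\<close> s show False by auto
  qed
  have "v j = (\<Sum>k\<in>K. (- c (Some k) / c None) * p k j)" if "j \<in> J" for j
  proof -
    have "(\<Sum>k\<in>K. (- c (Some k) / c None) * p k j) = - (\<Sum>k\<in>K. c (Some k) * p k j) / c None"
      by (simp add: sum_negf sum_divide_distrib)
    also have "(\<Sum>k\<in>K. c (Some k) * p k j) = - (c None * v j)"
      using c'[OF that] by (simp add: eq_neg_iff_add_eq_0 add.commute)
    also have "- (- (c None * v j)) / c None = v j" using \<open>c None \<noteq> 0\<close> by simp
    finally show ?thesis by simp
  qed
  then show ?thesis by (intro exI[of _ "\<lambda>k. - c (Some k) / c None"]) auto
qed

lemma indep_exchange: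
  fixes p :: "'i \<Rightarrow> 'j \<Rightarrow> 'k::field"
  assumes fin: "finite K" and p: "indep K J p" and i0: "i0 \<in> K" "c i0 \<noteq> 0"
    and v: "\<And>j. j \<in> J \<Longrightarrow> v j = (\<Sum>k\<in>K. c k * p k j)"
  shows "indep K J (p(i0 := v))"
proof (rule indepI)
  fix e k assume e: "\<And>j. j \<in> J \<Longrightarrow> (\<Sum>k\<in>K. e k * (p(i0 := v)) k j) = 0" and k: "k \<in> K"
  \<comment> \<open>\<open>f k\<close> is the coefficient of \<open>p k\<close> once
    \<open>v\<close> is replaced by its expansion; at \<open>i0\<close> it forces
    \<open>e i0 = 0\<close>, as \<open>c i0\<close> is nonzero.\<close>
  define f where "f k = (if k = i0 then e i0 * c i0 else e k + e i0 * c k)" for k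
  have "(\<Sum>k\<in>K. f k * p k j) = 0" if j: "j \<in> J" for j
  proof -
    have "0 = e i0 * v j + (\<Sum>k\<in>K - {i0}. e k * p k j)"
      using e[OF j] fin i0(1) by (simp add: sum.remove[of K i0])
    also have "v j = c i0 * p i0 j + (\<Sum>k\<in>K - {i0}. c k * p k j)"
      using v[OF j] fin i0(1) by (simp add: sum.remove[of K i0])
    also have "e i0 * \<dots> + (\<Sum>k\<in>K - {i0}. e k * p k j) = f i0 * p i0 j + (\<Sum>k\<in>K - {i0}. f k * p k j)"
      by (simp add: f_def algebra_simps sum_distrib_left sum.distrib)
    also have "\<dots> = (\<Sum>k\<in>K. f k * p k j)" using fin i0(1) by (simp add: sum.remove[of K i0])
    finally show ?thesis by simp
  qed
  from indepD[OF p this] have f: "f k = 0" if "k \<in> K" for k using that by blast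
  from f[OF i0(1)] i0(2) have "e i0 = 0" by (simp add: f_def)
  with f[OF k] show "e k = 0" by (simp add: f_def split: if_splits)
qed

section \<open>Singular values\<close>

definition vnorm :: "'a::real_normed_vector vec \<Rightarrow> real" where
  "vnorm v = L2_set (\<lambda>i. norm (v $ i)) {..<dim_vec v}"

lemma vnorm_nonneg [simp]: "0 \<le> vnorm v"
  by (simp add: vnorm_def)

lemma vnorm_eq_0: "vnorm v = 0 \<longleftrightarrow> v = 0\<^sub>v (dim_vec v)"
proof
  assume "vnorm v = 0"
  then show "v = 0\<^sub>v (dim_vec v)" by (intro eq_vecI) (simp_all add: vnorm_def L2_set_eq_0_iff)
next
  assume "v = 0\<^sub>v (dim_vec v)"
  then have "v $ i = 0" if "i < dim_vec v" for i using that by (metis index_zero_vec(1))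
  then show "vnorm v = 0" by (simp add: vnorm_def L2_set_eq_0_iff)
qed

lemma vnorm_zero [simp]: "vnorm (0\<^sub>v n) = 0"
  by (simp add: vnorm_def L2_set_eq_0_iff)

lemma vnorm_sq: "(vnorm v)\<^sup>2 = (\<Sum>i<dim_vec v. (norm (v $ i))\<^sup>2)"
  by (simp add: vnorm_def L2_set_def sum_nonneg)

lemma vnorm_smult: "vnorm (a \<cdot>\<^sub>v v) = norm a * vnorm (v :: 'a::real_normed_field vec)"
  unfolding vnorm_def by (subst L2_set_right_distrib) (auto simp: norm_mult intro!: L2_set_cong)

lemma vnorm_add:
  assumes "dim_vec v = dim_vec w"
  shows "vnorm (v + w) \<le> vnorm v + vnorm w"
proof -
  have "vnorm (v + w) \<le> L2_set (\<lambda>i. norm (v $ i) + norm (w $ i)) {..<dim_vec v}"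
    using assms by (auto simp: vnorm_def intro!: L2_set_mono norm_triangle_ineq)
  also have "\<dots> \<le> vnorm v + vnorm w"
    using L2_set_triangle_ineq assms by (auto simp: vnorm_def)
  finally show ?thesis .
qed

lemma norm_scalar_prod_le:
  fixes x y :: "'a::real_normed_field vec"
  assumes "dim_vec x = dim_vec y"
  shows "norm (x \<bullet> y) \<le> vnorm x * vnorm y"
proof -
  have "norm (x \<bullet> y) \<le> (\<Sum>i<dim_vec y. norm (x $ i) * norm (y $ i))"
    unfolding scalar_prod_def atLeast0LessThan by (rule order_trans[OF norm_sum]) (simp add: norm_mult)
  also have "\<dots> \<le> vnorm x * vnorm y"
    using L2_set_mult_ineq[of "\<lambda>i. norm (x $ i)" "\<lambda>i. norm (y $ i)" "{..<dim_vec y}"] assms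
    by (simp add: vnorm_def)
  finally show ?thesis .
qed

section \<open>Embedding of the scalar field into the complex numbers\<close>

lemma to_complex_0 [simp]: "to_complex 0 = 0"
  using to_complex_add[of 0 0] by simp

lemma to_complex_1 [simp]: "to_complex (1 :: 'a::real_or_complex) = 1"
proof -
  have "to_complex (1 :: 'a) \<noteq> 0" using cmod_to_complex[of "1 :: 'a"] by (metis norm_one norm_zero zero_neq_one)
  then show ?thesis using to_complex_mult[of "1 :: 'a" 1] by simp
qed

lemma to_complex_of_real [simp]: "to_complex (of_real r) = of_real r"
  using to_complex_scaleR[of r 1] by (simp add: of_real_def)

lemma to_complex_uminus: "to_complex (- x) = - to_complex x"
  using to_complex_add[of x "- x"] by (simp add: eq_neg_iff_add_eq_0 add.commute)

lemma to_complex_inj: "to_complex x = to_complex y \<longleftrightarrow> x = y"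
proof
  assume "to_complex x = to_complex y"
  then have "to_complex (x + - y) = 0" by (simp only: to_complex_add to_complex_uminus) simp
  then show "x = y" using cmod_to_complex[of "x + - y"] by simp
qed simp

lemma norm_conjugate [simp]: "norm (conjugate (x :: 'a::real_or_complex)) = norm x"
  using cmod_to_complex[of "conjugate x"] cmod_to_complex[of x] by (simp add: to_complex_conjugate)

lemma mult_conjugate: "x * conjugate x = of_real ((norm (x :: 'a::real_or_complex))\<^sup>2)"
proof -
  have "to_complex (x * conjugate x) = to_complex x * cnj (to_complex x)"
    by (simp add: to_complex_mult to_complex_conjugate)
  also have "\<dots> = of_real ((cmod (to_complex x))\<^sup>2)"
    by (simp only: complex_norm_square)
  also have "\<dots> = to_complex (of_real ((norm x)\<^sup>2) :: 'a)"
    by (simp only: cmod_to_complex to_complex_of_real)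
  finally have "to_complex (x * conjugate x) = to_complex (of_real ((norm x)\<^sup>2) :: 'a)" .
  then show ?thesis by (simp only: to_complex_inj)
qed

lemma of_real_in_range: "of_real r \<in> range to_complex"
  by (metis rangeI to_complex_of_real)

interpretation to_complex_hom: field_hom "to_complex :: 'a::real_or_complex \<Rightarrow> complex"
  by unfold_locales (simp_all add: to_complex_add to_complex_mult to_complex_inj)

lemma vnorm_conjugate [simp]: "vnorm (conjugate x) = vnorm (x :: 'a::real_or_complex vec)"
  unfolding vnorm_def by (intro L2_set_cong) auto

lemma scalar_prod_conjugate_self:
  "x \<bullet> conjugate x = of_real ((vnorm (x :: 'a::real_or_complex vec))\<^sup>2)"
proof -
  have "x \<bullet> conjugate x = (\<Sum>i<dim_vec x. x $ i * conjugate (x $ i))"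
    by (simp add: scalar_prod_def atLeast0LessThan)
  also have "\<dots> = of_real ((vnorm x)\<^sup>2)"
    by (simp add: vnorm_sq mult_conjugate)
  finally show ?thesis .
qed

section \<open>Adjoint matrices\<close>

lemma dim_mat_adjoint [simp]: "dim_row (mat_adjoint A) = dim_col A" "dim_col (mat_adjoint A) = dim_row A"
  by (simp_all add: mat_adjoint_def mat_of_rows_def)

lemma mat_adjoint_carrier [simp]: "A \<in> carrier_mat r c \<Longrightarrow> mat_adjoint A \<in> carrier_mat c r"
  by auto

lemma index_mat_adjoint:
  "i < dim_col A \<Longrightarrow> j < dim_row A \<Longrightarrow> mat_adjoint A $$ (i, j) = conjugate (A $$ (j, i))"
  by (simp add: mat_adjoint_def mat_of_rows_def)

lemma mat_adjoint_adjoint [simp]: "mat_adjoint (mat_adjoint A) = A"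
  by (rule eq_matI) (simp_all add: index_mat_adjoint)

lemma mat_adjoint_minus:
  fixes A :: "'a::conjugatable_field mat"
  assumes "A \<in> carrier_mat r c" "B \<in> carrier_mat r c"
  shows "mat_adjoint (A - B) = mat_adjoint A - mat_adjoint B"
proof (rule eq_matI)
  have "conjugate (x - y) = conjugate x - conjugate (y :: 'a)" for x y
    using conjugate_dist_add[of x "- y"] by (simp add: conjugate_neg)
  then show "mat_adjoint (A - B) $$ (i, j) = (mat_adjoint A - mat_adjoint B) $$ (i, j)"
    if "i < dim_row (mat_adjoint A - mat_adjoint B)" "j < dim_col (mat_adjoint A - mat_adjoint B)" for i j
    using assms that by (simp add: index_mat_adjoint)
qed (use assms in auto)

lemma adjoint_swap:
  fixes A :: "'a::conjugatable_field mat"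
  assumes A: "A \<in> carrier_mat r c" and x: "x \<in> carrier_vec c" and y: "y \<in> carrier_vec r"
  shows "(A *\<^sub>v x) \<bullet> conjugate y = x \<bullet> conjugate (mat_adjoint A *\<^sub>v y)"
proof -
  have "(A *\<^sub>v x) \<bullet> conjugate y = (\<Sum>i<r. \<Sum>j<c. A $$ (i, j) * x $ j * conjugate (y $ i))"
    using A x y by (simp add: scalar_prod_def atLeast0LessThan sum_distrib_right)
  also have "\<dots> = (\<Sum>j<c. \<Sum>i<r. A $$ (i, j) * x $ j * conjugate (y $ i))"
    by (rule sum.swap)
  also have "\<dots> = (\<Sum>j<c. x $ j * conjugate (\<Sum>i<r. conjugate (A $$ (i, j)) * y $ i))"
    by (simp add: sum_conjugate sum_distrib_left conjugate_dist_mul mult_ac)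
  also have "\<dots> = x \<bullet> conjugate (mat_adjoint A *\<^sub>v y)"
    using A x y by (simp add: scalar_prod_def atLeast0LessThan index_mat_adjoint)
  finally show ?thesis .
qed

text \<open>For z = A^* y the square |z|^2 is the inner product of A z with y, at most \<delta> |z|
  |y|; then |z| cancels.\<close>

lemma vnorm_adjoint_le:
  fixes A :: "'a::real_or_complex mat"
  assumes A: "A \<in> carrier_mat r c" and y: "y \<in> carrier_vec r" and \<delta>: "0 \<le> \<delta>"
    and bound: "\<And>x. x \<in> carrier_vec c \<Longrightarrow> vnorm (A *\<^sub>v x) \<le> \<delta> * vnorm x"
  shows "vnorm (mat_adjoint A *\<^sub>v y) \<le> \<delta> * vnorm y"
proof (cases "vnorm (mat_adjoint A *\<^sub>v y) = 0")
  case True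
  then show ?thesis using \<delta> by simp
next
  case False
  let ?z = "mat_adjoint A *\<^sub>v y"
  have z: "?z \<in> carrier_vec c" using mult_mat_vec_carrier[OF mat_adjoint_carrier[OF A] y] .
  have "(vnorm ?z)\<^sup>2 = norm (?z \<bullet> conjugate ?z)"
    unfolding scalar_prod_conjugate_self norm_of_real by simp
  also have "\<dots> = norm ((A *\<^sub>v ?z) \<bullet> conjugate y)" using adjoint_swap[OF A z y] by simp
  also have "\<dots> \<le> vnorm (A *\<^sub>v ?z) * vnorm y"
    using norm_scalar_prod_le[of "A *\<^sub>v ?z" "conjugate y"] A y by simp
  also have "\<dots> \<le> \<delta> * vnorm ?z * vnorm y" using bound[OF z] by (simp add: mult_right_mono)
  finally have "vnorm ?z * vnorm ?z \<le> vnorm ?z * (\<delta> * vnorm y)" by (simp add: power2_eq_square mult_ac)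
  then show ?thesis using False by (metis mult_le_cancel_left_pos order_le_less vnorm_nonneg)
qed

text \<open>A crude bound is enough: it depends on the matrix only through \<open>n\<close> and
  \<open>c\<close>, hence is the same for all powers of a power-bounded matrix.\<close>

lemma vnorm_le_of_norm_bound:
  fixes A :: "complex mat"
  assumes A: "A \<in> carrier_mat n n" and x: "x \<in> carrier_vec n" and b: "norm_bound A c"
  shows "vnorm (A *\<^sub>v x) \<le> real n * (c * (\<Sum>j<n. cmod (x $ j)))"
proof -
  have "vnorm (A *\<^sub>v x) \<le> (\<Sum>i<n. cmod ((A *\<^sub>v x) $ i))"
    using A by (auto simp: vnorm_def intro: order_trans[OF L2_set_le_sum_abs])
  also have "\<dots> \<le> (\<Sum>i<n. c * (\<Sum>j<n. cmod (x $ j)))"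
  proof (rule sum_mono)
    fix i assume i: "i \<in> {..<n}"
    have "cmod ((A *\<^sub>v x) $ i) \<le> (\<Sum>j<n. cmod (A $$ (i, j)) * cmod (x $ j))"
      using A x i by (auto simp: scalar_prod_def atLeast0LessThan intro!: order_trans[OF norm_sum] sum_mono simp: norm_mult)
    also have "\<dots> \<le> (\<Sum>j<n. c * cmod (x $ j))"
      using b A i by (intro sum_mono mult_right_mono) (auto simp: norm_bound_def)
    finally show "cmod ((A *\<^sub>v x) $ i) \<le> c * (\<Sum>j<n. cmod (x $ j))" by (simp add: sum_distrib_left)
  qed
  finally show ?thesis by simp
qed

section \<open>Norm bounds for Hermitian matrices from their eigenvalues\<close>

definition symmetric_op :: "'a::conjugatable_field mat \<Rightarrow> bool" where
  "symmetric_op H \<longleftrightarrow> (\<forall>x\<in>carrier_vec (dim_col H). \<forall>y\<in>carrier_vec (dim_col H).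
     (H *\<^sub>v x) \<bullet> conjugate y = x \<bullet> conjugate (H *\<^sub>v y))"

lemma symmetric_opD:
  "symmetric_op H \<Longrightarrow> H \<in> carrier_mat n n \<Longrightarrow> x \<in> carrier_vec n \<Longrightarrow> y \<in> carrier_vec n \<Longrightarrow>
     (H *\<^sub>v x) \<bullet> conjugate y = x \<bullet> conjugate (H *\<^sub>v y)"
  by (auto simp: symmetric_op_def)

lemma symmetric_op_square:
  assumes "symmetric_op H" "H \<in> carrier_mat n n"
  shows "symmetric_op (H * H)"
  using assms unfolding symmetric_op_def
  by (auto simp: assoc_mult_mat_vec[OF assms(2) assms(2)] mult_mat_vec_carrier[OF assms(2)])

text \<open>|H x|^2 is the inner product of H^2 x with x. Hence passing from H to H^2 at least
  squares the growth ratio |H x| / |x|.\<close>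

lemma symmetric_op_norm_square:
  fixes H :: "complex mat"
  assumes "symmetric_op H" and H: "H \<in> carrier_mat n n" and x: "x \<in> carrier_vec n"
  shows "(vnorm (H *\<^sub>v x))\<^sup>2 \<le> vnorm ((H * H) *\<^sub>v x) * vnorm x"
proof -
  have Hx: "H *\<^sub>v x \<in> carrier_vec n" using H x by simp
  have "(vnorm (H *\<^sub>v x))\<^sup>2 = norm ((H *\<^sub>v x) \<bullet> conjugate (H *\<^sub>v x))"
    unfolding scalar_prod_conjugate_self norm_of_real by simp
  also have "\<dots> = norm ((H *\<^sub>v (H *\<^sub>v x)) \<bullet> conjugate x)"
    by (subst symmetric_opD[OF assms(1) H Hx x]) simp
  also have "\<dots> \<le> vnorm ((H * H) *\<^sub>v x) * vnorm x"
    using norm_scalar_prod_le[of "H *\<^sub>v (H *\<^sub>v x)" "conjugate x"] H x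
    unfolding vnorm_conjugate by simp
  finally show ?thesis .
qed

text \<open>If |G x| = q |x| with q > 1, repeated squaring gives |G^(2^k) x| \<ge> q^(2^k) |x|,
  which contradicts the bounded powers.\<close>

lemma symmetric_op_contraction:
  fixes G :: "complex mat"
  assumes sym: "symmetric_op G" and G: "G \<in> carrier_mat n n" and x: "x \<in> carrier_vec n"
    and b: "\<And>k. norm_bound (G ^\<^sub>m k) c"
  shows "vnorm (G *\<^sub>v x) \<le> vnorm x"
proof (rule ccontr)
  assume gt: "\<not> vnorm (G *\<^sub>v x) \<le> vnorm x"
  define B where "B = rec_nat G (\<lambda>_ B. B * B)"
  have B0: "B 0 = G" and BS: "B (Suc k) = B k * B k" for k by (simp_all add: B_def)
  have B: "B k \<in> carrier_mat n n" for k by (induction k) (auto simp: B0 BS G)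
  have Bpow: "B k = G ^\<^sub>m (2 ^ k)" for k
  proof (induction k)
    case (Suc k)
    have add: "G ^\<^sub>m (a + b) = G ^\<^sub>m a * G ^\<^sub>m b" for a b
    proof (induction b)
      case (Suc b)
      then show ?case using G by (simp add: assoc_mult_mat[of _ n n _ n _ n] pow_carrier_mat)
    qed (use G in simp)
    show ?case unfolding BS Suc by (simp add: add[symmetric] mult_2)
  qed (simp add: B0 G)
  have Bsym: "symmetric_op (B k)" for k
    by (induction k) (auto simp: B0 BS sym intro: symmetric_op_square[OF _ B])
  have x0: "vnorm x > 0"
  proof (rule ccontr)
    assume "\<not> vnorm x > 0"
    then have "vnorm x = 0" using vnorm_nonneg[of x] by linarith
    then have "x = 0\<^sub>v n" using x by (simp add: vnorm_eq_0)
    then have "G *\<^sub>v x = 0\<^sub>v n" using G by (auto simp: scalar_prod_def)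
    with gt show False by simp
  qed
  define q where "q = vnorm (G *\<^sub>v x) / vnorm x"
  have q: "q > 1" using gt x0 by (simp add: q_def)
  have grow: "q ^ (2 ^ k) * vnorm x \<le> vnorm (B k *\<^sub>v x)" for k
  proof (induction k)
    case 0
    then show ?case using x0 by (simp add: B0 q_def)
  next
    case (Suc k)
    have "(q ^ (2 ^ k) * vnorm x)\<^sup>2 \<le> (vnorm (B k *\<^sub>v x))\<^sup>2"
      using Suc q by (intro power_mono) auto
    also have "\<dots> \<le> vnorm (B (Suc k) *\<^sub>v x) * vnorm x"
      unfolding BS by (rule symmetric_op_norm_square[OF Bsym B x])
    finally have "(q ^ (2 ^ Suc k) * vnorm x) * vnorm x \<le> vnorm (B (Suc k) *\<^sub>v x) * vnorm x"
      by (simp add: power2_eq_square power_add mult_2 mult_ac)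
    then show ?case using x0 by simp
  qed
  define K where "K = real n * (c * (\<Sum>j<n. cmod (x $ j)))"
  have "vnorm (B k *\<^sub>v x) \<le> K" for k
    unfolding K_def by (rule vnorm_le_of_norm_bound[OF B x]) (simp add: Bpow b)
  with grow have le: "q ^ (2 ^ k) * vnorm x \<le> K" for k using order_trans by blast
  obtain l where l: "K / vnorm x < q ^ l" using real_arch_pow[OF q] by blast
  have "q ^ l \<le> q ^ (2 ^ l)" using q by (intro power_increasing) (simp_all add: less_imp_le[OF less_exp])
  then have "q ^ l * vnorm x \<le> q ^ (2 ^ l) * vnorm x" using x0 by (simp add: mult_right_mono)
  also have "\<dots> \<le> K" by (rule le)
  also have "K < q ^ l * vnorm x" using l x0 by (simp add: pos_divide_less_eq)
  finally show False by simp
qed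

lemma eigenvalue_smult:
  fixes A :: "complex mat"
  assumes A: "A \<in> carrier_mat n n" and a: "a \<noteq> 0" and e: "eigenvalue (a \<cdot>\<^sub>m A) e"
  shows "eigenvalue A (e / a)"
proof -
  from e A obtain v where v: "v \<in> carrier_vec n" "v \<noteq> 0\<^sub>v n" "(a \<cdot>\<^sub>m A) *\<^sub>v v = e \<cdot>\<^sub>v v"
    unfolding eigenvalue_def eigenvector_def by auto
  have "(a \<cdot>\<^sub>m A) *\<^sub>v v = a \<cdot>\<^sub>v (A *\<^sub>v v)" using A v(1) by (auto simp: scalar_prod_def sum_distrib_left mult_ac)
  with v(3) have "(1 / a) \<cdot>\<^sub>v (a \<cdot>\<^sub>v (A *\<^sub>v v)) = (1 / a) \<cdot>\<^sub>v (e \<cdot>\<^sub>v v)" by simp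
  then have "A *\<^sub>v v = (e / a) \<cdot>\<^sub>v v" using a by (simp add: smult_smult_assoc)
  with v(1,2) A show ?thesis unfolding eigenvalue_def eigenvector_def by auto
qed

text \<open>A substitute for the spectral theorem: for r > \<rho> the matrix H / r has spectral
  radius below 1, so its powers are bounded by the Jordan normal form and it is a contraction. Then
  r tends to \<rho>.\<close>

lemma symmetric_op_norm_le:
  fixes H :: "complex mat"
  assumes sym: "symmetric_op H" and H: "H \<in> carrier_mat n n" and x: "x \<in> carrier_vec n"
    and ev: "\<And>e. eigenvalue H e \<Longrightarrow> cmod e \<le> \<rho>"
  shows "vnorm (H *\<^sub>v x) \<le> \<rho> * vnorm x"
proof (cases "n = 0")
  case True
  then show ?thesis using H x by (simp add: vnorm_def)
next
  case False
  have \<rho>: "\<rho> \<ge> 0"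
    using spectrum_non_empty[OF H] False ev by (force simp: spectrum_def intro: order_trans[OF norm_ge_zero])
  have *: "vnorm (H *\<^sub>v x) \<le> r * vnorm x" if r: "r > \<rho>" for r
  proof -
    let ?a = "of_real (1 / r) :: complex"
    let ?G = "?a \<cdot>\<^sub>m H"
    have r0: "r > 0" using r \<rho> by simp
    have G: "?G \<in> carrier_mat n n" using H by simp
    have Gv: "?G *\<^sub>v v = ?a \<cdot>\<^sub>v (H *\<^sub>v v)" if "v \<in> carrier_vec n" for v :: "complex vec"
      using H that by (auto simp: scalar_prod_def sum_distrib_left mult_ac)
    have Gsym: "symmetric_op ?G"
      unfolding symmetric_op_def
    proof (intro ballI)
      fix u v :: "complex vec" assume "u \<in> carrier_vec (dim_col ?G)" "v \<in> carrier_vec (dim_col ?G)"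
      then have uv: "u \<in> carrier_vec n" "v \<in> carrier_vec n" using H by auto
      have "conjugate (?a \<cdot>\<^sub>v (H *\<^sub>v v)) = ?a \<cdot>\<^sub>v conjugate (H *\<^sub>v v)" by auto
      then show "(?G *\<^sub>v u) \<bullet> conjugate v = u \<bullet> conjugate (?G *\<^sub>v v)"
        using symmetric_opD[OF sym H uv] uv H by (simp only: Gv) simp
    qed
    have "spectral_radius ?G \<in> norm ` spectrum ?G" using spectral_radius_mem_max(1)[OF G] False by simp
    then obtain e where e: "eigenvalue ?G e" "spectral_radius ?G = cmod e" by (auto simp: spectrum_def)
    have "cmod (e / ?a) \<le> \<rho>" using ev eigenvalue_smult[OF H _ e(1)] r0 by simp
    then have "r * cmod e \<le> \<rho>" using r0 by (simp add: norm_divide norm_mult field_simps)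
    then have "r * cmod e < r * 1" using r by simp
    then have "cmod e < 1" using r0 by (simp only: mult_less_cancel_left_pos)
    then have "\<exists>c. \<forall>k. norm_bound (?G ^\<^sub>m k) c"
      using e(2) spectral_radius_jnf_norm_bound_less_1[OF G _ jordan_nf_exists[OF G]] char_poly_factorized[OF G]
      by metis
    then obtain c where "\<And>k. norm_bound (?G ^\<^sub>m k) c" by blast
    from symmetric_op_contraction[OF Gsym G x this]
    have "cmod ?a * vnorm (H *\<^sub>v x) \<le> vnorm x" by (simp only: Gv[OF x] vnorm_smult)
    then show ?thesis using r0 by (simp add: norm_divide field_simps)
  qed
  show ?thesis
  proof (cases "vnorm x = 0")
    case True
    then show ?thesis using *[of "\<rho> + 1"] by simp
  next
    case False
    then have x0: "vnorm x > 0" using vnorm_nonneg[of x] by linarith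
    have "vnorm (H *\<^sub>v x) / vnorm x \<le> \<rho>"
      by (rule dense_ge) (use * x0 in \<open>simp add: field_simps\<close>)
    then show ?thesis using x0 by (simp add: field_simps)
  qed
qed

lemma gram_symmetric:
  fixes A :: "'a::real_or_complex mat"
  assumes A: "A \<in> carrier_mat r c"
  shows "symmetric_op (mat_adjoint A * A)"
    and "x \<in> carrier_vec c \<Longrightarrow>
      ((mat_adjoint A * A) *\<^sub>v x) \<bullet> conjugate x = of_real ((vnorm (A *\<^sub>v x))\<^sup>2)"
proof -
  have As: "mat_adjoint A \<in> carrier_mat c r" using A by simp
  have 1: "((mat_adjoint A * A) *\<^sub>v x) \<bullet> conjugate y = (A *\<^sub>v x) \<bullet> conjugate (A *\<^sub>v y)"
    if "x \<in> carrier_vec c" "y \<in> carrier_vec c" for x y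
    using adjoint_swap[OF As, of "A *\<^sub>v x" y] A that by (simp add: assoc_mult_mat_vec[OF As A])
  have 2: "x \<bullet> conjugate ((mat_adjoint A * A) *\<^sub>v y) = (A *\<^sub>v x) \<bullet> conjugate (A *\<^sub>v y)"
    if "x \<in> carrier_vec c" "y \<in> carrier_vec c" for x y
    using adjoint_swap[OF A, of x "A *\<^sub>v y"] A that by (simp add: assoc_mult_mat_vec[OF As A])
  show "symmetric_op (mat_adjoint A * A)"
    unfolding symmetric_op_def using 1 2 A by simp
  show "((mat_adjoint A * A) *\<^sub>v x) \<bullet> conjugate x = of_real ((vnorm (A *\<^sub>v x))\<^sup>2)" if "x \<in> carrier_vec c"
    using 1[OF that that] by (simp only: scalar_prod_conjugate_self)
qed

text \<open>An eigenvector v satisfies e |v|^2 = |A v|^2.\<close>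

lemma gram_eigenvalue:
  fixes A :: "complex mat"
  assumes A: "A \<in> carrier_mat r c" and e: "eigenvalue (mat_adjoint A * A) e"
  shows "e = of_real (cmod e)"
proof -
  let ?G = "mat_adjoint A * A"
  have G: "?G \<in> carrier_mat c c" using A by auto
  from e A obtain v where v: "v \<in> carrier_vec c" "v \<noteq> 0\<^sub>v c" "?G *\<^sub>v v = e \<cdot>\<^sub>v v"
    unfolding eigenvalue_def eigenvector_def by auto
  have v0: "vnorm v \<noteq> 0" using v by (auto simp: vnorm_eq_0)
  have "e * of_real ((vnorm v)\<^sup>2) = (e \<cdot>\<^sub>v v) \<bullet> conjugate v"
    using v(1) scalar_prod_conjugate_self[of v] by simp
  also have "\<dots> = of_real ((vnorm (A *\<^sub>v v))\<^sup>2)"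
    using gram_symmetric(2)[OF A v(1)] v(3) by simp
  finally have e: "e = of_real ((vnorm (A *\<^sub>v v))\<^sup>2 / (vnorm v)\<^sup>2)" using v0 by (simp add: field_simps)
  show ?thesis unfolding e norm_of_real by (simp del: of_real_divide of_real_power)
qed

lemma gram_eigenvalue_upper:
  fixes A :: "complex mat"
  assumes A: "A \<in> carrier_mat r c" and x: "x \<in> carrier_vec c" and s: "s \<ge> 0"
    and ev: "\<And>e. eigenvalue (mat_adjoint A * A) e \<Longrightarrow> sqrt (cmod e) \<le> s"
  shows "vnorm (A *\<^sub>v x) \<le> s * vnorm x"
proof -
  let ?G = "mat_adjoint A * A"
  have G: "?G \<in> carrier_mat c c" using A by auto
  have "cmod e \<le> s\<^sup>2" if "eigenvalue ?G e" for e
    using ev[OF that] by (simp add: sqrt_le_D)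
  from symmetric_op_norm_le[OF gram_symmetric(1)[OF A] G x this]
  have *: "vnorm (?G *\<^sub>v x) \<le> s\<^sup>2 * vnorm x" .
  have "(vnorm (A *\<^sub>v x))\<^sup>2 = norm ((?G *\<^sub>v x) \<bullet> conjugate x)"
    unfolding gram_symmetric(2)[OF A x] norm_of_real by simp
  also have "\<dots> \<le> vnorm (?G *\<^sub>v x) * vnorm x"
    using norm_scalar_prod_le[of "?G *\<^sub>v x" "conjugate x"] A x unfolding vnorm_conjugate by simp
  also have "\<dots> \<le> s\<^sup>2 * vnorm x * vnorm x" using * by (simp add: mult_right_mono)
  finally have "(vnorm (A *\<^sub>v x))\<^sup>2 \<le> (s * vnorm x)\<^sup>2" by (simp add: power2_eq_square mult_ac)
  then show ?thesis using s by (meson power2_le_imp_le mult_nonneg_nonneg vnorm_nonneg)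
qed

text \<open>Let G = A^* A and let m be its spectral radius. The eigenvalues of m I - G have modulus
  at most m - s^2, so m |x|^2 - |A x|^2 \<le> (m - s^2) |x|^2: an upper bound for m I - G is a lower
  bound for A.\<close>

lemma gram_eigenvalue_lower:
  fixes A :: "complex mat"
  assumes A: "A \<in> carrier_mat r c" and x: "x \<in> carrier_vec c" and s: "s \<ge> 0"
    and ev: "\<And>e. eigenvalue (mat_adjoint A * A) e \<Longrightarrow> s \<le> sqrt (cmod e)"
  shows "s * vnorm x \<le> vnorm (A *\<^sub>v x)"
proof (cases "c = 0")
  case True
  then show ?thesis using x by (simp add: vnorm_def)
next
  case False
  let ?G = "mat_adjoint A * A"
  have G: "?G \<in> carrier_mat c c" using A by auto
  define m where "m = spectral_radius ?G"
  have m: "cmod e \<le> m" if "eigenvalue ?G e" for e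
    using spectral_radius_mem_max(2)[OF G] False that by (auto simp: m_def spectrum_def)
  have ev2: "s\<^sup>2 \<le> cmod e" if "eigenvalue ?G e" for e
    using ev[OF that] s by (simp add: real_le_rsqrt sqrt_ge_absD)
  let ?D = "of_real m \<cdot>\<^sub>m 1\<^sub>m c - ?G"
  have D: "?D \<in> carrier_mat c c" using G by (rule minus_carrier_mat)
  have Dv: "?D *\<^sub>v v = of_real m \<cdot>\<^sub>v v - ?G *\<^sub>v v" if v: "v \<in> carrier_vec c" for v
  proof -
    have "(of_real m \<cdot>\<^sub>m 1\<^sub>m c) *\<^sub>v v = of_real m \<cdot>\<^sub>v (1\<^sub>m c *\<^sub>v v)"
      using v by (intro eq_vecI) (auto simp: row_smult)
    then show ?thesis
      using v G by (simp add: minus_mult_distrib_mat_vec[of _ c c])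
  qed
  have Gv: "?G *\<^sub>v v \<in> carrier_vec c" if "v \<in> carrier_vec c" for v
    using G that by (rule mult_mat_vec_carrier)
  have dist1: "(of_real m \<cdot>\<^sub>v u - w) \<bullet> conjugate v = of_real m * (u \<bullet> conjugate v) - w \<bullet> conjugate v"
    and dist2: "u \<bullet> conjugate (of_real m \<cdot>\<^sub>v v - w) = of_real m * (u \<bullet> conjugate v) - u \<bullet> conjugate w"
    if "u \<in> carrier_vec c" "v \<in> carrier_vec c" "w \<in> carrier_vec c" for u v w :: "complex vec"
    using that by (simp_all add: scalar_prod_def algebra_simps sum_subtractf sum_distrib_left)
  have Dsym: "symmetric_op ?D"
    unfolding symmetric_op_def
  proof (intro ballI)
    fix u v :: "complex vec" assume "u \<in> carrier_vec (dim_col ?D)" "v \<in> carrier_vec (dim_col ?D)"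
    then have uv: "u \<in> carrier_vec c" "v \<in> carrier_vec c" using D by auto
    then show "(?D *\<^sub>v u) \<bullet> conjugate v = u \<bullet> conjugate (?D *\<^sub>v v)"
      using dist1[OF uv Gv[OF uv(1)]] dist2[OF uv Gv[OF uv(2)]]
        symmetric_opD[OF gram_symmetric(1)[OF A] G uv] by (simp only: Dv)
  qed
  have Dev: "cmod f \<le> m - s\<^sup>2" if f: "eigenvalue ?D f" for f
  proof -
    from f D obtain v where v: "v \<in> carrier_vec c" "v \<noteq> 0\<^sub>v c" "?D *\<^sub>v v = f \<cdot>\<^sub>v v"
      unfolding eigenvalue_def eigenvector_def by auto
    have "?G *\<^sub>v v = (of_real m - f) \<cdot>\<^sub>v v"
    proof (rule eq_vecI)
      fix i assume "i < dim_vec ((of_real m - f) \<cdot>\<^sub>v v)"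
      then have i: "i < c" using v(1) by simp
      have "(of_real m \<cdot>\<^sub>v v - ?G *\<^sub>v v) $ i = (f \<cdot>\<^sub>v v) $ i" using Dv[OF v(1)] v(3) by simp
      then have "of_real m * v $ i - (?G *\<^sub>v v) $ i = f * v $ i"
        using i v(1) Gv[OF v(1)] by (simp only: index_minus_vec index_smult_vec carrier_vecD) 
      then show "(?G *\<^sub>v v) $ i = ((of_real m - f) \<cdot>\<^sub>v v) $ i"
        using i v(1) by (simp add: algebra_simps del: index_mult_mat_vec)
    qed (use A v(1) in auto)
    then have e: "eigenvalue ?G (of_real m - f)"
      using v(1,2) A unfolding eigenvalue_def eigenvector_def by auto
    have "f = of_real (m - cmod (of_real m - f))" using gram_eigenvalue[OF A e] by simp
    then have "cmod f = \<bar>m - cmod (of_real m - f)\<bar>" by (metis norm_of_real)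
    then show ?thesis using m[OF e] ev2[OF e] by simp
  qed
  from symmetric_op_norm_le[OF Dsym D x Dev]
  have *: "vnorm (?D *\<^sub>v x) \<le> (m - s\<^sup>2) * vnorm x" .
  have "of_real (m * (vnorm x)\<^sup>2 - (vnorm (A *\<^sub>v x))\<^sup>2) = (?D *\<^sub>v x) \<bullet> conjugate x"
    using dist1[OF x x Gv[OF x]] gram_symmetric(2)[OF A x] scalar_prod_conjugate_self[of x]
    by (simp only: Dv[OF x] of_real_diff of_real_mult)
  then have "m * (vnorm x)\<^sup>2 - (vnorm (A *\<^sub>v x))\<^sup>2 \<le> cmod ((?D *\<^sub>v x) \<bullet> conjugate x)"
    by (metis norm_of_real abs_ge_self)
  also have "\<dots> \<le> vnorm (?D *\<^sub>v x) * vnorm x"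
    using norm_scalar_prod_le[of "?D *\<^sub>v x" "conjugate x"] A D x unfolding vnorm_conjugate by simp
  also have "\<dots> \<le> (m - s\<^sup>2) * vnorm x * vnorm x" using * by (simp add: mult_right_mono)
  finally have "(s * vnorm x)\<^sup>2 \<le> (vnorm (A *\<^sub>v x))\<^sup>2" by (simp add: power2_eq_square algebra_simps)
  then show ?thesis by (rule power2_le_imp_le) simp
qed

section \<open>Singular values as roots of characteristic polynomials\<close>

lemma proots_linear_factors: "proots (\<Prod>a\<leftarrow>as. [:- a, 1:]) = mset (as :: 'a::field list)"
proof (induction as)
  case (Cons a as)
  have "(\<Prod>a\<leftarrow>as. [:- a, 1:]) \<noteq> 0" by (auto simp: prod_list_zero_iff)
  then have "proots ([:- a, 1:] * (\<Prod>a\<leftarrow>as. [:- a, 1:])) = proots [:- a, 1:] + proots (\<Prod>a\<leftarrow>as. [:- a, 1:])"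
    by (intro proots_mult) auto
  then show ?case using Cons by simp
qed simp

text \<open>Conjugating by a unipotent block matrix turns the block matrix with rows \<open>(AB, 0)\<close>, \<open>(B, 0)\<close>
  into the one with rows \<open>(0, 0)\<close>, \<open>(B, BA)\<close>.\<close>
lemma char_poly_mult_swap:
  fixes A B :: "complex mat"
  assumes A: "A \<in> carrier_mat r c" and B: "B \<in> carrier_mat c r"
  shows "char_poly (A * B) * [:0, 1:] ^ c = [:0, 1:] ^ r * char_poly (B * A)"
proof -
  let ?L = "four_block_mat (A * B) (0\<^sub>m r c) B (0\<^sub>m c c)"
  let ?R = "four_block_mat (0\<^sub>m r r) (0\<^sub>m r c) B (B * A)"
  let ?P = "four_block_mat (1\<^sub>m r) A (0\<^sub>m c r) (1\<^sub>m c)"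
  let ?Q = "four_block_mat (1\<^sub>m r) (- A) (0\<^sub>m c r) (1\<^sub>m c)"
  have sq: "?L \<in> carrier_mat (r + c) (r + c)" "?R \<in> carrier_mat (r + c) (r + c)"
      "?P \<in> carrier_mat (r + c) (r + c)" "?Q \<in> carrier_mat (r + c) (r + c)"
    using A B by auto
  have uz: "- 0\<^sub>m a b = (0\<^sub>m a b :: complex mat)" for a b by auto
  have AA: "A + - A = 0\<^sub>m r c" "- A + A = 0\<^sub>m r c" using A by auto
  have PQ: "?P * ?Q = 1\<^sub>m (r + c)" "?Q * ?P = 1\<^sub>m (r + c)"
    using A by (subst mult_four_block_mat[of _ r r _ c _ c _ _ r _ c]; auto simp: uz AA)+
  have LP: "?L * ?P = four_block_mat (A * B) (A * B * A) B (B * A)"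
    using A B by (subst mult_four_block_mat[of _ r r _ c _ c _ _ r _ c]) auto
  have PR: "?P * ?R = four_block_mat (A * B) (A * (B * A)) B (B * A)"
    using A B by (subst mult_four_block_mat[of _ r r _ c _ c _ _ r _ c]) auto
  have "?L * ?P = ?P * ?R" unfolding LP PR using A B by (simp add: assoc_mult_mat[OF A B A])
  moreover have "?L * ?P * ?Q = ?L"
    unfolding assoc_mult_mat[OF sq(1,3,4)] PQ(1) by (rule right_mult_one_mat[OF sq(1)])
  ultimately have LR: "?L = ?P * ?R * ?Q" by simp
  have "similar_mat ?L ?R"
    by (rule similar_matI[OF _ PQ LR]) (use sq in blast)
  then have "char_poly ?L = char_poly ?R" by (rule char_poly_similar)
  moreover have ex: "\<exists>es. char_poly X = (\<Prod>a\<leftarrow>es. [:- a, 1:])" if "X \<in> carrier_mat l l" for X :: "complex mat" and l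
    using char_poly_factorized[OF that] by blast
  have "char_poly ?L = char_poly (A * B) * char_poly (0\<^sub>m c c)"
    using A B by (intro char_poly_0_block'[of _ _ r c B] ex[of _ r] ex[of _ c]) auto
  moreover have "char_poly ?R = char_poly (0\<^sub>m r r) * char_poly (B * A)"
    using A B by (intro char_poly_0_block'[of _ _ r c B] ex[of _ r] ex[of _ c]) auto
  moreover have "char_poly (0\<^sub>m l l :: complex mat) = [:0, 1:] ^ l" for l
  proof -
    have "diag_mat (0\<^sub>m l l :: complex mat) = replicate l 0"
      by (intro nth_equalityI) (auto simp: diag_mat_def)
    then show ?thesis
      by (subst char_poly_upper_triangular[of _ l]) (auto simp: prod_list_replicate)
  qed
  ultimately show ?thesis by metis
qed

text \<open>For \<open>mat_adjoint A * A\<close> this is the decreasing list of singular values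
  before it is cut to the smaller dimension.\<close>

definition sqnorms :: "'a::real_or_complex mat \<Rightarrow> real list" where
  "sqnorms G = rev (sorted_list_of_multiset (image_mset (\<lambda>z. sqrt (norm z)) (proots (char_poly G))))"

lemma singular_values_eq:
  "singular_values A = take (min (dim_row A) (dim_col A)) (sqnorms (mat_adjoint A * A))"
  by (simp add: singular_values_def sqnorms_def)

lemma proots_char_poly:
  fixes G :: "complex mat"
  assumes G: "G \<in> carrier_mat n n"
  shows "size (proots (char_poly G)) = n" and "z \<in># proots (char_poly G) \<longleftrightarrow> eigenvalue G z"
proof -
  obtain as where as: "char_poly G = (\<Prod>a\<leftarrow>as. [:- a, 1:])" "length as = n"
    using char_poly_factorized[OF G] by blast
  show "size (proots (char_poly G)) = n" using as by (simp add: proots_linear_factors)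
  show "z \<in># proots (char_poly G) \<longleftrightarrow> eigenvalue G z"
    unfolding eigenvalue_root_char_poly[OF G] as(1)
    by (auto simp: proots_linear_factors poly_prod_list prod_list_zero_iff)
qed

lemma sqnorms_complex:
  fixes G :: "complex mat"
  assumes G: "G \<in> carrier_mat n n"
  shows "length (sqnorms G) = n"
    and "set (sqnorms G) = (\<lambda>z. sqrt (cmod z)) ` {z. eigenvalue G z}"
    and "sorted (rev (sqnorms G))"
proof -
  show "length (sqnorms G) = n"
    unfolding sqnorms_def length_rev
    by (metis mset_sorted_list_of_multiset size_mset size_image_mset proots_char_poly(1)[OF G])
qed (use proots_char_poly(2)[OF G] in \<open>auto simp: sqnorms_def\<close>)

lemma sqnorms_nonneg: "x \<in> set (sqnorms G) \<Longrightarrow> 0 \<le> x"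
  by (auto simp: sqnorms_def)

text \<open>The Gram matrix A^* A has the eigenvalues of A A^* and \<open>c - r\<close> further
  zeros. These sort to the end of the list, where \<open>take\<close> removes exactly them.\<close>

lemma singular_values_adjoint:
  fixes A :: "complex mat"
  assumes A: "A \<in> carrier_mat r c" and le: "r \<le> c"
  shows "singular_values A = sqnorms (A * mat_adjoint A)"
proof -
  let ?B = "mat_adjoint A"
  have B: "?B \<in> carrier_mat c r" using A by simp
  have G: "?B * A \<in> carrier_mat c c" "A * ?B \<in> carrier_mat r r" using A B by auto
  have monic: "char_poly X \<noteq> 0" if "X \<in> carrier_mat n n" for X :: "complex mat" and n
    using degree_monic_char_poly[OF that] by auto
  have "[:0, 1:] ^ r * (char_poly (A * ?B) * [:0, 1:] ^ (c - r)) = [:0, 1:] ^ r * char_poly (?B * A)"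
    using char_poly_mult_swap[OF A B] power_add[of "[:0, 1 :: complex:]" r "c - r"] le
    by (simp add: mult_ac)
  then have cp: "char_poly (?B * A) = char_poly (A * ?B) * [:0, 1:] ^ (c - r)" by simp
  have "proots (char_poly (?B * A)) = proots (char_poly (A * ?B)) + replicate_mset (c - r) 0"
    unfolding cp using monic[OF G(2)] by (subst proots_mult) (auto simp: proots_power)
  then have "image_mset (\<lambda>z. sqrt (cmod z)) (proots (char_poly (?B * A))) =
      image_mset (\<lambda>z. sqrt (cmod z)) (proots (char_poly (A * ?B))) + replicate_mset (c - r) 0"
    by simp
  moreover have "mset (replicate (c - r) 0 @ rev (sqnorms (A * ?B))) =
      image_mset (\<lambda>z. sqrt (cmod z)) (proots (char_poly (A * ?B))) + replicate_mset (c - r) 0"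
    by (simp add: sqnorms_def)
  moreover have "sorted (replicate (c - r) 0 @ rev (sqnorms (A * ?B)))"
    using sqnorms_complex(3)[OF G(2)] by (auto simp: sorted_append sqnorms_nonneg)
  ultimately have "sorted_list_of_multiset (image_mset (\<lambda>z. sqrt (cmod z)) (proots (char_poly (?B * A)))) =
      replicate (c - r) 0 @ rev (sqnorms (A * ?B))"
    by (metis sorted_list_of_multiset_mset sorted_sort_id)
  then have "sqnorms (?B * A) = sqnorms (A * ?B) @ replicate (c - r) 0"
    unfolding sqnorms_def[of "?B * A"] by simp
  then show ?thesis
    using A le sqnorms_complex(1)[OF G(2)] by (simp add: singular_values_eq)
qed

section \<open>Transfer of the bounds from complex matrices to the scalar field\<close>

abbreviation (input) to_complex_mat :: "'a::real_or_complex mat \<Rightarrow> complex mat" where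
  "to_complex_mat \<equiv> map_mat to_complex"

lemma to_complex_mat_adjoint: "to_complex_mat (mat_adjoint A) = mat_adjoint (to_complex_mat A)"
  by (rule eq_matI) (auto simp: index_mat_adjoint to_complex_conjugate)

lemma vnorm_to_complex [simp]: "vnorm (map_vec to_complex v) = vnorm v"
  unfolding vnorm_def by (intro L2_set_cong) (auto simp: cmod_to_complex)

text \<open>Over the reals \<open>proots\<close> might miss roots. Here it does not: the eigenvalues
  of a Gram matrix are real, hence in the range of \<open>to_complex\<close>, so the complex
  factorisation comes from one over the scalar field.\<close>

lemma sqnorms_to_complex:
  fixes A :: "'a::real_or_complex mat"
  assumes A: "A \<in> carrier_mat r c"
  shows "sqnorms (mat_adjoint A * A) = sqnorms (mat_adjoint (to_complex_mat A) * to_complex_mat A)"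
proof -
  let ?G = "mat_adjoint A * A" and ?H = "mat_adjoint (to_complex_mat A) * to_complex_mat A"
  have A': "to_complex_mat A \<in> carrier_mat r c" using A by simp
  have G: "?G \<in> carrier_mat c c" using A by auto
  have H: "?H \<in> carrier_mat c c" using A by auto
  have "to_complex_mat ?G = ?H"
    using A by (subst to_complex_hom.mat_hom_mult[of _ c r _ c]) (auto simp: to_complex_mat_adjoint)
  then have cp: "char_poly ?H = map_poly to_complex (char_poly ?G)"
    using to_complex_hom.char_poly_hom[OF G] by simp
  obtain as where as: "char_poly ?H = (\<Prod>a\<leftarrow>as. [:- a, 1:])"
    using char_poly_factorized[OF H] by blast
  have "a \<in> range (to_complex :: 'a \<Rightarrow> complex)" if "a \<in> set as" for a
  proof -
    have "poly (char_poly ?H) a = 0" using that by (auto simp: as poly_prod_list prod_list_zero_iff)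
    then have "eigenvalue ?H a" using eigenvalue_root_char_poly[OF H] by simp
    then have "a = of_real (cmod a)" by (rule gram_eigenvalue[OF A'])
    then show ?thesis using of_real_in_range by metis
  qed
  then have "\<exists>bs :: 'a list. as = map to_complex bs"
    by (auto simp: ex_map_conv)
  then obtain bs :: "'a list" where bs: "as = map to_complex bs" by blast
  have "map_poly to_complex (\<Prod>b\<leftarrow>bs. [:- b, 1:]) = (\<Prod>a\<leftarrow>as. [:- a, 1:])"
    unfolding bs
  proof (induction bs)
    case (Cons b bs)
    interpret map_poly_comm_ring_hom "to_complex :: 'a \<Rightarrow> complex" ..
    show ?case using Cons by (simp only: list.map prod_list.Cons hom_mult) (simp add: to_complex_uminus)
  qed simp
  then have cpG: "char_poly ?G = (\<Prod>b\<leftarrow>bs. [:- b, 1:])"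
  proof (intro poly_eqI)
    fix k
    have "coeff (map_poly to_complex p) k = to_complex (coeff p k)" for p :: "'a poly"
      by (simp add: coeff_map_poly)
    moreover have "map_poly to_complex (char_poly ?G) = map_poly to_complex (\<Prod>b\<leftarrow>bs. [:- b, 1:])"
      using as cp \<open>map_poly to_complex (\<Prod>b\<leftarrow>bs. [:- b, 1:]) = (\<Prod>a\<leftarrow>as. [:- a, 1:])\<close> by simp
    ultimately have "to_complex (coeff (char_poly ?G) k) = to_complex (coeff (\<Prod>b\<leftarrow>bs. [:- b, 1:]) k)"
      by metis
    then show "coeff (char_poly ?G) k = coeff (\<Prod>b\<leftarrow>bs. [:- b, 1:]) k" by (simp only: to_complex_inj)
  qed
  show ?thesis
    unfolding sqnorms_def as cpG proots_linear_factors bs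
    by (simp add: image_mset.compositionality o_def cmod_to_complex flip: mset_map)
qed

lemma singular_values_to_complex:
  fixes A :: "'a::real_or_complex mat"
  shows "singular_values A = singular_values (to_complex_mat A)"
  using sqnorms_to_complex[of A "dim_row A" "dim_col A"] by (simp add: singular_values_eq)

lemma \<sigma>_to_complex:
  fixes A :: "'a::real_or_complex mat"
  shows "\<sigma> i A = \<sigma> i (to_complex_mat A)"
  by (simp add: \<sigma>_def flip: singular_values_to_complex)

lemma spectral_norm_complex:
  fixes A :: "complex mat"
  assumes A: "A \<in> carrier_mat r c" and pos: "r > 0" "c > 0"
  shows "0 \<le> spectral_norm A" and "x \<in> carrier_vec c \<Longrightarrow> vnorm (A *\<^sub>v x) \<le> spectral_norm A * vnorm x"
proof -
  let ?G = "mat_adjoint A * A"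
  have G: "?G \<in> carrier_mat c c" using A by auto
  note s = sqnorms_complex[OF G]
  have sn: "spectral_norm A = sqnorms ?G ! 0"
    using A pos by (simp add: spectral_norm_def \<sigma>_def singular_values_eq)
  show nn: "0 \<le> spectral_norm A"
    unfolding sn using s(1) pos by (intro sqnorms_nonneg[of _ ?G] nth_mem) auto
  have "sqrt (cmod e) \<le> spectral_norm A" if e: "eigenvalue ?G e" for e
  proof -
    have "sqrt (cmod e) \<in> set (sqnorms ?G)" using e s(2) by auto
    then obtain i where i: "i < c" "sqrt (cmod e) = sqnorms ?G ! i" using s(1) by (auto simp: in_set_conv_nth)
    then show ?thesis
      unfolding sn using s(1,3) sorted_rev_nth_mono[of "sqnorms ?G" 0 i] by simp
  qed
  from gram_eigenvalue_upper[OF A _ nn this]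
  show "x \<in> carrier_vec c \<Longrightarrow> vnorm (A *\<^sub>v x) \<le> spectral_norm A * vnorm x" .
qed

lemma \<sigma>_last_complex:
  fixes A :: "complex mat"
  assumes A: "A \<in> carrier_mat r c" and le: "c \<le> r" and pos: "c > 0" and x: "x \<in> carrier_vec c"
  shows "\<sigma> c A * vnorm x \<le> vnorm (A *\<^sub>v x)"
proof -
  let ?G = "mat_adjoint A * A"
  have G: "?G \<in> carrier_mat c c" using A by auto
  note s = sqnorms_complex[OF G]
  have sn: "\<sigma> c A = sqnorms ?G ! (c - 1)"
    using A pos le by (simp add: \<sigma>_def singular_values_eq)
  have nn: "0 \<le> \<sigma> c A"
    unfolding sn using s(1) pos by (intro sqnorms_nonneg[of _ ?G] nth_mem) auto
  have "\<sigma> c A \<le> sqrt (cmod e)" if e: "eigenvalue ?G e" for e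
  proof -
    have "sqrt (cmod e) \<in> set (sqnorms ?G)" using e s(2) by auto
    then obtain i where i: "i < c" "sqrt (cmod e) = sqnorms ?G ! i" using s(1) by (auto simp: in_set_conv_nth)
    then show ?thesis
      unfolding sn using s(1,3) sorted_rev_nth_mono[of "sqnorms ?G" i "c - 1"] by simp
  qed
  from gram_eigenvalue_lower[OF A x nn this] show ?thesis .
qed

lemma spectral_norm_bound:
  fixes A :: "'a::real_or_complex mat"
  assumes A: "A \<in> carrier_mat r c" and pos: "r > 0" "c > 0"
  shows "0 \<le> spectral_norm A" and "x \<in> carrier_vec c \<Longrightarrow> vnorm (A *\<^sub>v x) \<le> spectral_norm A * vnorm x"
proof -
  have A': "to_complex_mat A \<in> carrier_mat r c" using A by simp
  have sn: "spectral_norm A = spectral_norm (to_complex_mat A)"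
    unfolding spectral_norm_def by (rule \<sigma>_to_complex)
  show "0 \<le> spectral_norm A" unfolding sn by (rule spectral_norm_complex(1)[OF A' pos])
  show "vnorm (A *\<^sub>v x) \<le> spectral_norm A * vnorm x" if x: "x \<in> carrier_vec c"
    using spectral_norm_complex(2)[OF A' pos, of "map_vec to_complex x"] x A
    by (simp add: sn flip: to_complex_hom.mult_mat_vec_hom[OF A x])
qed

lemma \<sigma>_last_tall:
  fixes A :: "'a::real_or_complex mat"
  assumes A: "A \<in> carrier_mat r c" and le: "c \<le> r" and pos: "c > 0" and x: "x \<in> carrier_vec c"
  shows "\<sigma> c A * vnorm x \<le> vnorm (A *\<^sub>v x)"
proof -
  have A': "to_complex_mat A \<in> carrier_mat r c" using A by simp
  show ?thesis
    using \<sigma>_last_complex[OF A' le pos, of "map_vec to_complex x"] x A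
    by (simp add: \<sigma>_to_complex[of _ A] flip: to_complex_hom.mult_mat_vec_hom[OF A x])
qed

text \<open>A wide matrix may annihilate nonzero vectors, so the lower bound is for its adjoint, a
  tall matrix with the same singular values.\<close>

lemma \<sigma>_last_wide:
  fixes A :: "'a::real_or_complex mat"
  assumes A: "A \<in> carrier_mat r c" and le: "r \<le> c" and pos: "r > 0" and y: "y \<in> carrier_vec r"
  shows "\<sigma> r A * vnorm y \<le> vnorm (mat_adjoint A *\<^sub>v y)"
proof -
  let ?C = "to_complex_mat A"
  have C: "?C \<in> carrier_mat r c" using A by simp
  have B: "mat_adjoint ?C \<in> carrier_mat c r" using C by simp
  have "singular_values (mat_adjoint ?C) = singular_values ?C"
    unfolding singular_values_adjoint[OF C le] singular_values_eq[of "mat_adjoint ?C"]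
    using C le sqnorms_complex(1)[of "?C * mat_adjoint ?C" r] by simp
  then have "\<sigma> r A = \<sigma> r (mat_adjoint A)"
    by (simp add: \<sigma>_def singular_values_to_complex[of A]
        singular_values_to_complex[of "mat_adjoint A"] to_complex_mat_adjoint)
  then show ?thesis using \<sigma>_last_tall[of "mat_adjoint A" c r y] A le pos y by simp
qed

section \<open>Perturbation and rank of wide and tall matrices\<close>

text \<open>The witness is the least-norm solution z = B^* w with B B^* w = b: |z|^2 is the inner
  product of w with b, at most |w| |b|, while s |w| \<le> |z|.\<close>

lemma right_inverse_bound:
  fixes B :: "'a::real_or_complex mat"
  assumes B: "B \<in> carrier_mat r c" and s: "s > 0" and b: "b \<in> carrier_vec r"
    and low: "\<And>y. y \<in> carrier_vec r \<Longrightarrow> s * vnorm y \<le> vnorm (mat_adjoint B *\<^sub>v y)"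
  shows "\<exists>z\<in>carrier_vec c. B *\<^sub>v z = b \<and> s * vnorm z \<le> vnorm b"
proof -
  let ?C = "mat_adjoint B"
  let ?G = "B * ?C"
  have C: "?C \<in> carrier_mat c r" using B by simp
  have G: "?G \<in> carrier_mat r r" using B by auto
  have Gv: "?G *\<^sub>v y = B *\<^sub>v (?C *\<^sub>v y)" if "y \<in> carrier_vec r" for y
    using assoc_mult_mat_vec[OF B C that] .
  have self: "(vnorm (?C *\<^sub>v y))\<^sup>2 = norm (y \<bullet> conjugate (?G *\<^sub>v y))" if y: "y \<in> carrier_vec r" for y
  proof -
    have "(vnorm (?C *\<^sub>v y))\<^sup>2 = norm ((?C *\<^sub>v y) \<bullet> conjugate (?C *\<^sub>v y))"
      unfolding scalar_prod_conjugate_self norm_of_real by simp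
    also have "(?C *\<^sub>v y) \<bullet> conjugate (?C *\<^sub>v y) = y \<bullet> conjugate (?G *\<^sub>v y)"
      using adjoint_swap[OF C y mult_mat_vec_carrier[OF C y]] Gv[OF y] by simp
    finally show ?thesis .
  qed
  \<comment> \<open>B B^* y = 0 forces B^* y = 0, and then \<open>low\<close> gives y = 0.\<close>
  have "det ?G \<noteq> 0"
  proof
    assume "det ?G = 0"
    then obtain y where y: "y \<in> carrier_vec r" "y \<noteq> 0\<^sub>v r" "?G *\<^sub>v y = 0\<^sub>v r"
      using det_0_iff_vec_prod_zero_field[OF G] by blast
    have "vnorm (?C *\<^sub>v y) = 0" using self[OF y(1)] y by simp
    with low[OF y(1)] s have "vnorm y \<le> 0" by (simp add: mult_le_0_iff)
    then have "vnorm y = 0" using vnorm_nonneg[of y] by linarith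
    with y show False by (simp add: vnorm_eq_0)
  qed
  then obtain G' where G': "G' \<in> carrier_mat r r" "?G * G' = 1\<^sub>m r"
    using det_non_zero_imp_unit[OF G] by (auto simp: Units_def ring_mat_simps)
  define w where "w = G' *\<^sub>v b"
  have w: "w \<in> carrier_vec r" using G'(1) b by (simp add: w_def)
  have Gw: "?G *\<^sub>v w = b"
    unfolding w_def assoc_mult_mat_vec[OF G G'(1) b, symmetric] G'(2) using b by simp
  let ?z = "?C *\<^sub>v w"
  have z: "?z \<in> carrier_vec c" using mult_mat_vec_carrier[OF C w] .
  have "(vnorm ?z)\<^sup>2 \<le> vnorm w * vnorm b"
    using self[OF w] norm_scalar_prod_le[of w "conjugate b"] w b Gw by simp
  then have "s * (vnorm ?z)\<^sup>2 \<le> s * vnorm w * vnorm b" using s by (simp add: mult.assoc)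
  also have "\<dots> \<le> vnorm ?z * vnorm b" using low[OF w] by (intro mult_right_mono) auto
  finally have "vnorm ?z * (s * vnorm ?z) \<le> vnorm ?z * vnorm b" by (simp add: power2_eq_square mult_ac)
  then have "s * vnorm ?z \<le> vnorm b"
    by (cases "vnorm ?z = 0") (simp_all add: less_le)
  moreover have "B *\<^sub>v ?z = b" using Gv[OF w] Gw by simp
  ultimately show ?thesis using z by blast
qed

lemma mult_diff_mat_vec:
  fixes A :: "'a::ring mat"
  assumes "A \<in> carrier_mat r c" "B \<in> carrier_mat r c" "x \<in> carrier_vec c"
  shows "B *\<^sub>v x + (A - B) *\<^sub>v x = A *\<^sub>v x"
  using assms by (intro eq_vecI) (auto simp: scalar_prod_def left_diff_distrib sum_subtractf)

lemma \<sigma>_perturb_wide: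
  fixes A B :: "'a::real_or_complex mat"
  assumes A: "A \<in> carrier_mat r c" and B: "B \<in> carrier_mat r c" and le: "r \<le> c" and pos: "r > 0"
    and \<delta>: "0 \<le> \<delta>" "\<And>x. x \<in> carrier_vec c \<Longrightarrow> vnorm ((A - B) *\<^sub>v x) \<le> \<delta> * vnorm x"
    and y: "y \<in> carrier_vec r"
  shows "(\<sigma> r A - \<delta>) * vnorm y \<le> vnorm (mat_adjoint B *\<^sub>v y)"
proof -
  have D: "A - B \<in> carrier_mat r c" using B by (rule minus_carrier_mat)
  have "\<sigma> r A * vnorm y \<le> vnorm (mat_adjoint A *\<^sub>v y)" by (rule \<sigma>_last_wide[OF A le pos y])
  also have "mat_adjoint A *\<^sub>v y = mat_adjoint B *\<^sub>v y + mat_adjoint (A - B) *\<^sub>v y"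
    unfolding mat_adjoint_minus[OF A B] using mult_diff_mat_vec[of "mat_adjoint A" c r "mat_adjoint B" y] A B y by simp
  also have "vnorm \<dots> \<le> vnorm (mat_adjoint B *\<^sub>v y) + vnorm (mat_adjoint (A - B) *\<^sub>v y)"
    using B by (intro vnorm_add) auto
  also have "vnorm (mat_adjoint (A - B) *\<^sub>v y) \<le> \<delta> * vnorm y"
    by (rule vnorm_adjoint_le[OF D y \<delta>])
  finally show ?thesis by (simp add: algebra_simps)
qed

lemma \<sigma>_perturb_tall:
  fixes A B :: "'a::real_or_complex mat"
  assumes A: "A \<in> carrier_mat r c" and B: "B \<in> carrier_mat r c" and le: "c \<le> r" and pos: "c > 0"
    and \<delta>: "\<And>x. x \<in> carrier_vec c \<Longrightarrow> vnorm ((A - B) *\<^sub>v x) \<le> \<delta> * vnorm x"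
    and x: "x \<in> carrier_vec c"
  shows "(\<sigma> c A - \<delta>) * vnorm x \<le> vnorm (B *\<^sub>v x)"
proof -
  have "\<sigma> c A * vnorm x \<le> vnorm (A *\<^sub>v x)" by (rule \<sigma>_last_tall[OF A le pos x])
  also have "A *\<^sub>v x = B *\<^sub>v x + (A - B) *\<^sub>v x" by (rule mult_diff_mat_vec[OF A B x, symmetric])
  also have "vnorm \<dots> \<le> vnorm (B *\<^sub>v x) + vnorm ((A - B) *\<^sub>v x)" using B by (intro vnorm_add) auto
  also have "vnorm ((A - B) *\<^sub>v x) \<le> \<delta> * vnorm x" by (rule \<delta>[OF x])
  finally show ?thesis by (simp add: algebra_simps)
qed

section \<open>Full column rank as injectivity, full row rank as surjectivity\<close>

context vec_space
begin

lemma rank_eq_card_maximal: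
  assumes A: "A \<in> carrier_mat n nc"
  obtains S where "S \<subseteq> set (cols A)" "lin_indpt S" "rank A = card S"
proof -
  obtain S where S: "maximal S (\<lambda>T. T \<subseteq> set (cols A) \<and> lin_indpt T)"
    using maximal_exists[of "(\<lambda>T. T \<subseteq> set (cols A) \<and> lin_indpt T)" "card (set (cols A))" "{}"]
    by (meson List.finite_set card_mono empty_iff empty_subsetI finite_lin_indpt2 rev_finite_subset)
  then show ?thesis using that rank_card_indpt[OF A S] by (auto simp: maximal_def)
qed

text \<open>The set of columns does not see repetitions. They are excluded separately: for equal
  columns a difference of two unit vectors would lie in the kernel.\<close>

lemma distinct_lin_indpt_colsI:
  assumes A: "A \<in> carrier_mat n nc" and inj: "\<forall>v\<in>carrier_vec nc. A *\<^sub>v v = 0\<^sub>v n \<longrightarrow> v = 0\<^sub>v nc"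
  shows "distinct (cols A) \<and> lin_indpt (set (cols A))"
proof -
  have d: "distinct (cols A)"
    unfolding distinct_conv_nth
  proof (intro allI impI)
    fix i j assume ij: "i < length (cols A)" "j < length (cols A)" "i \<noteq> j"
    show "cols A ! i \<noteq> cols A ! j"
    proof
      assume eq: "cols A ! i = cols A ! j"
      have *: "A *\<^sub>v (unit_vec nc i - unit_vec nc j) = 0\<^sub>v n"
      proof (rule eq_vecI)
        fix k assume "k < dim_vec (0\<^sub>v n :: 'a vec)"
        then have k: "k < n" by simp
        have "A $$ (k, i) = A $$ (k, j)"
          using arg_cong[OF eq, of "\<lambda>v. v $ k"] ij A k by simp
        then show "(A *\<^sub>v (unit_vec nc i - unit_vec nc j)) $ k = 0\<^sub>v n $ k"
          using A k ij by (simp add: scalar_prod_minus_distrib[of _ nc])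
      qed (use A in simp)
      have "unit_vec nc i - unit_vec nc j = (0\<^sub>v nc :: 'a vec)" using inj * by simp
      then have "(unit_vec nc i - unit_vec nc j) $ i = (0\<^sub>v nc :: 'a vec) $ i" by simp
      then show False using ij A by simp
    qed
  qed
  have "lin_indpt (set (cols A))"
    using lin_depE[OF A _ d] inj by metis
  with d show ?thesis by blast
qed

lemma rank_eq_dim_col_iff:
  assumes A: "A \<in> carrier_mat n nc"
  shows "rank A = nc \<longleftrightarrow> (\<forall>v\<in>carrier_vec nc. A *\<^sub>v v = 0\<^sub>v n \<longrightarrow> v = 0\<^sub>v nc)"
proof
  assume r: "rank A = nc"
  obtain S where S: "S \<subseteq> set (cols A)" "rank A = card S" using rank_eq_card_maximal[OF A] by blast
  \<comment> \<open>With a repeated column the set of columns would have fewer than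
    \<open>nc\<close> elements, too few for rank \<open>nc\<close>.\<close>
  have "length (cols A) \<le> card (set (cols A))" using S r A card_mono[OF _ S(1)] by simp
  then have d: "distinct (cols A)" by (intro card_distinct le_antisym[OF card_length]) simp
  have "lin_indpt (set (cols A))" using full_rank_lin_indpt[OF A r d] .
  then show "\<forall>v\<in>carrier_vec nc. A *\<^sub>v v = 0\<^sub>v n \<longrightarrow> v = 0\<^sub>v nc"
    using lin_depI[OF A _ _ _ d] by blast
next
  assume inj: "\<forall>v\<in>carrier_vec nc. A *\<^sub>v v = 0\<^sub>v n \<longrightarrow> v = 0\<^sub>v nc"
  then show "rank A = nc" using distinct_lin_indpt_colsI[OF A] lin_indpt_full_rank[OF A] by blast
qed

lemma distinct_lin_indpt_cols_iff:
  assumes A: "A \<in> carrier_mat n nc"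
  shows "distinct (cols A) \<and> lin_indpt (set (cols A)) \<longleftrightarrow>
    (\<forall>v\<in>carrier_vec nc. A *\<^sub>v v = 0\<^sub>v n \<longrightarrow> v = 0\<^sub>v nc)"
  using distinct_lin_indpt_colsI[OF A] lin_indpt_full_rank[OF A] rank_eq_dim_col_iff[OF A] by blast

lemma span_cols_eq:
  assumes A: "A \<in> carrier_mat n nc"
  shows "span (set (cols A)) = {y \<in> carrier_vec n. \<exists>x\<in>carrier_vec nc. A *\<^sub>v x = y}"
  using col_space_eq[OF A] A by (auto simp: col_space_def)

lemma rank_eq_dim_row_iff:
  assumes A: "A \<in> carrier_mat n nc"
  shows "rank A = n \<longleftrightarrow> (\<forall>b\<in>carrier_vec n. \<exists>v\<in>carrier_vec nc. A *\<^sub>v v = b)"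
proof -
  have c: "set (cols A) \<subseteq> carrier_vec n" using A cols_dim by blast
  note cs = span_cols_eq[OF A]
  have "rank A = n \<longleftrightarrow> span (set (cols A)) = carrier_vec n"
  proof
    assume r: "rank A = n"
    obtain S where S: "S \<subseteq> set (cols A)" "lin_indpt S" "rank A = card S"
      using rank_eq_card_maximal[OF A] by blast
    have "basis S" using dim_li_is_basis[of S] S r c finite_subset[OF S(1)] dim_is_n by auto
    then have "span S = carrier_vec n" by (simp add: basis_def)
    then show "span (set (cols A)) = carrier_vec n"
      using span_is_monotone[OF S(1)] span_closed[OF c] by auto
  next
    assume s: "span (set (cols A)) = carrier_vec n"
    have "vs (span (set (cols A))) = V" unfolding s by (simp add: module_vec_def)
    then show "rank A = n" using dim_is_n by (simp add: rank_def)
  qed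
  then show ?thesis unfolding cs by auto
qed

end

section \<open>Sylvester matrices as polynomial multiplication\<close>

text \<open>Entries of degree below \<open>k\<close>, stated through coefficients so that
  \<open>k = 0\<close> leaves only zero entries. Entries from index \<open>q\<close> on are
  unconstrained.\<close>

definition poly_vecs :: "nat \<Rightarrow> nat \<Rightarrow> (nat \<Rightarrow> 'a::zero poly) set" where
  "poly_vecs q k = {v. \<forall>j<q. \<forall>l\<ge>k. coeff (v j) l = 0}"

lemma poly_vecsD: "v \<in> poly_vecs q k \<Longrightarrow> j < q \<Longrightarrow> k \<le> l \<Longrightarrow> coeff (v j) l = 0"
  by (simp add: poly_vecs_def)

definition pmul :: "'a::comm_semiring_0 poly mat \<Rightarrow> (nat \<Rightarrow> 'a poly) \<Rightarrow> nat \<Rightarrow> 'a poly" where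
  "pmul M v i = (\<Sum>j<dim_col M. M $$ (i, j) * v j)"

text \<open>Blocks are ordered by degree, lowest first, as the block rows and columns of
  \<open>sylvester\<close> are.\<close>

definition stack :: "nat \<Rightarrow> nat \<Rightarrow> (nat \<Rightarrow> 'a::zero poly) \<Rightarrow> 'a vec" where
  "stack q k v = vec (k * q) (\<lambda>c. coeff (v (c mod q)) (c div q))"

definition unstack :: "nat \<Rightarrow> nat \<Rightarrow> 'a::comm_monoid_add vec \<Rightarrow> nat \<Rightarrow> 'a poly" where
  "unstack q k x j = (\<Sum>l<k. monom (x $ (l * q + j)) l)"

definition pnorm :: "nat \<Rightarrow> nat \<Rightarrow> (nat \<Rightarrow> 'a::real_normed_field poly) \<Rightarrow> real" where
  "pnorm q k v = L2_set (\<lambda>(l, j). norm (coeff (v j) l)) ({..<k} \<times> {..<q})"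

lemma pnorm_nonneg [simp]: "0 \<le> pnorm q k v"
  by (simp add: pnorm_def)

lemma pnorm_sq: "(pnorm q k v)\<^sup>2 = (\<Sum>l<k. \<Sum>j<q. (norm (coeff (v j) l))\<^sup>2)"
  by (simp add: pnorm_def L2_set_def sum_nonneg sum.cartesian_product case_prod_unfold)

lemma stack_carrier [simp]: "stack q k v \<in> carrier_vec (k * q)"
  by (simp add: stack_def)

lemma block_index: "l < k \<Longrightarrow> j < q \<Longrightarrow> l * q + j < k * (q :: nat)"
proof -
  assume "l < k" "j < q"
  then have "l * q + j < Suc l * q" by simp
  also have "\<dots> \<le> k * q" using \<open>l < k\<close> by (intro mult_le_mono1) simp
  finally show ?thesis .
qed

lemma sum_div_mod:
  fixes q :: nat
  assumes "q > 0"
  shows "(\<Sum>c<k * q. f (c div q) (c mod q)) = (\<Sum>l<k. \<Sum>j<q. f l j)"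
proof -
  have "(\<Sum>c<k * q. f (c div q) (c mod q)) = (\<Sum>l<k. \<Sum>c = l * q..<l * q + q. f (c div q) (c mod q))"
    by (rule sum.nat_group[symmetric])
  also have "\<dots> = (\<Sum>l<k. \<Sum>j<q. f l j)"
  proof (rule sum.cong)
    fix l
    have "(\<Sum>c = l * q..<l * q + q. f (c div q) (c mod q)) = (\<Sum>j = 0..<q. f ((j + l * q) div q) ((j + l * q) mod q))"
      using sum.shift_bounds_nat_ivl[of "\<lambda>c. f (c div q) (c mod q)" 0 "l * q" q] by (simp add: add.commute)
    also have "\<dots> = (\<Sum>j<q. f l j)"
      using assms by (intro sum.cong) auto
    finally show "(\<Sum>c = l * q..<l * q + q. f (c div q) (c mod q)) = (\<Sum>j<q. f l j)" .
  qed simp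
  finally show ?thesis .
qed

lemma vnorm_stack: "vnorm (stack q k v) = pnorm q k (v :: nat \<Rightarrow> 'a::real_normed_field poly)"
proof (cases "q = 0")
  case True
  then show ?thesis by (simp add: vnorm_def stack_def pnorm_def)
next
  case False
  have "(vnorm (stack q k v))\<^sup>2 = (\<Sum>c<k * q. (norm (coeff (v (c mod q)) (c div q)))\<^sup>2)"
    by (simp add: vnorm_sq stack_def)
  also have "\<dots> = (pnorm q k v)\<^sup>2"
    using False sum_div_mod[of q "\<lambda>l j. (norm (coeff (v j) l))\<^sup>2" k] by (simp add: pnorm_sq)
  finally show ?thesis by (rule power2_eq_imp_eq) simp_all
qed

lemma coeff_unstack: "coeff (unstack q k x j) l = (if l < k then x $ (l * q + j) else 0)"
  by (simp add: unstack_def coeff_sum)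

lemma unstack_poly_vecs [simp]: "unstack q k x \<in> poly_vecs q k"
  by (simp add: poly_vecs_def coeff_unstack)

lemma stack_unstack: "x \<in> carrier_vec (k * q) \<Longrightarrow> stack q k (unstack q k x) = x"
  by (intro eq_vecI) (auto simp: stack_def coeff_unstack less_mult_imp_div_less)

lemma stack_inject:
  assumes "v \<in> poly_vecs q k" "w \<in> poly_vecs q k" "stack q k v = stack q k w" "j < q"
  shows "v j = w j"
proof (rule poly_eqI)
  fix l
  show "coeff (v j) l = coeff (w j) l"
  proof (cases "l < k")
    case True
    then have "stack q k v $ (l * q + j) = stack q k w $ (l * q + j)" using assms(3) by simp
    then show ?thesis using block_index[OF True assms(4)] assms(4) by (simp add: stack_def)
  next
    case False
    then show ?thesis using assms by (simp add: poly_vecsD)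
  qed
qed

lemma poly_mats_carrier: "M \<in> poly_mats p q d \<Longrightarrow> M \<in> carrier_mat p q"
  by (simp add: poly_mats_def)

lemma poly_mats_coeff: "M \<in> poly_mats p q d \<Longrightarrow> i < p \<Longrightarrow> j < q \<Longrightarrow> d < l \<Longrightarrow> coeff (M $$ (i, j)) l = 0"
proof -
  assume "M \<in> poly_mats p q d" "i < p" "j < q" "d < l"
  then have "degree (M $$ (i, j)) < l" by (auto simp: poly_mats_def intro: le_less_trans)
  then show ?thesis by (rule coeff_eq_0)
qed

lemma sylvester_carrier: "M \<in> carrier_mat p q \<Longrightarrow> sylvester d k M \<in> carrier_mat ((k + d) * p) (k * q)"
  by (auto simp: sylvester_def Let_def)

lemma pmul_poly_vecs:
  assumes M: "M \<in> poly_mats p q d" and v: "v \<in> poly_vecs q k"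
  shows "pmul M v \<in> poly_vecs p (k + d)"
  unfolding poly_vecs_def
proof (intro CollectI allI impI)
  fix i l assume i: "i < p" and l: "k + d \<le> l"
  have dc: "dim_col M = q" using poly_mats_carrier[OF M] by simp
  have "coeff (M $$ (i, j) * v j) l = 0" if j: "j < q" for j
    unfolding coeff_mult
  proof (intro sum.neutral ballI)
    fix s assume "s \<in> {..l}"
    then have "d < s \<or> k \<le> l - s" using l by auto
    then show "coeff (M $$ (i, j)) s * coeff (v j) (l - s) = 0"
      using poly_mats_coeff[OF M i j] poly_vecsD[OF v j] by auto
  qed
  then show "coeff (pmul M v i) l = 0" by (simp add: pmul_def coeff_sum dc)
qed

text \<open>Block row i of the Sylvester matrix forms the convolution sum of M_(i-l) v_l over l,
  which is the coefficient of degree i in M v.\<close>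

lemma sylvester_mult_stack:
  assumes M: "M \<in> poly_mats p q d" and v: "v \<in> poly_vecs q k" and q: "q > 0"
  shows "sylvester d k M *\<^sub>v stack q k v = stack p (k + d) (pmul M v)"
proof (rule eq_vecI)
  note Mc = poly_mats_carrier[OF M]
  have S: "sylvester d k M \<in> carrier_mat ((k + d) * p) (k * q)" using sylvester_carrier[OF Mc] .
  show "dim_vec (sylvester d k M *\<^sub>v stack q k v) = dim_vec (stack p (k + d) (pmul M v))"
    using S by (simp add: stack_def)
  fix r assume "r < dim_vec (stack p (k + d) (pmul M v))"
  then have r: "r < (k + d) * p" by (simp add: stack_def)
  then have p: "p > 0" by (cases p) auto
  define i where "i = r div p"
  have rp: "r mod p < p" using p by simp
  define h where "h l j = (if l \<le> i \<and> i - l \<le> d then coeff (M $$ (r mod p, j)) (i - l) else 0) * coeff (v j) l" for l j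
  have "(sylvester d k M *\<^sub>v stack q k v) $ r = (\<Sum>c<k * q. h (c div q) (c mod q))"
    using S r Mc by (auto simp: scalar_prod_def sylvester_def Let_def stack_def h_def i_def atLeast0LessThan intro!: sum.cong)
  also have "\<dots> = (\<Sum>l<k. \<Sum>j<q. h l j)" by (rule sum_div_mod[OF q])
  also have "\<dots> = (\<Sum>j<q. \<Sum>l<k. h l j)" by (rule sum.swap)
  also have "\<dots> = (\<Sum>j<q. coeff (M $$ (r mod p, j) * v j) i)"
  proof (rule sum.cong)
    fix j assume "j \<in> {..<q}"
    then have j: "j < q" by simp
    \<comment> \<open>The ranges \<open>l \<le> i\<close> and \<open>l < k\<close> give the same
      sum: \<open>h\<close> vanishes for \<open>l > i\<close>, and \<open>v\<close> has no
      coefficients from degree \<open>k\<close> on.\<close>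
    have "coeff (M $$ (r mod p, j) * v j) i = (\<Sum>l\<le>i. coeff (v j) l * coeff (M $$ (r mod p, j)) (i - l))"
      by (subst mult.commute) (rule coeff_mult)
    also have "\<dots> = (\<Sum>l\<le>i. h l j)"
      using poly_mats_coeff[OF M rp j] by (intro sum.cong) (auto simp: h_def mult.commute)
    also have "\<dots> = (\<Sum>l\<in>{..i} \<inter> {..<k}. h l j)"
      using poly_vecsD[OF v j] by (intro sum.mono_neutral_right) (auto simp: h_def not_less)
    also have "\<dots> = (\<Sum>l<k. h l j)"
      by (intro sum.mono_neutral_left) (auto simp: h_def)
    finally show "(\<Sum>l<k. h l j) = coeff (M $$ (r mod p, j) * v j) i" by simp
  qed simp
  also have "\<dots> = stack p (k + d) (pmul M v) $ r"
    using r Mc by (simp add: stack_def pmul_def coeff_sum i_def)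
  finally show "(sylvester d k M *\<^sub>v stack q k v) $ r = stack p (k + d) (pmul M v) $ r" .
qed

text \<open>Full row rank of the Sylvester matrix, phrased as solvability of a polynomial equation
  so that one can multiply by the variable.\<close>

definition syl_surj :: "nat \<Rightarrow> 'a::field poly mat \<Rightarrow> nat \<Rightarrow> bool" where
  "syl_surj d M k \<longleftrightarrow> (\<forall>w\<in>poly_vecs (dim_row M) (k + d). \<exists>v\<in>poly_vecs (dim_col M) k.
     \<forall>i<dim_row M. pmul M v i = w i)"

definition syl_inj :: "'a::field poly mat \<Rightarrow> nat \<Rightarrow> bool" where
  "syl_inj M k \<longleftrightarrow> (\<forall>v\<in>poly_vecs (dim_col M) k. (\<forall>i<dim_row M. pmul M v i = 0) \<longrightarrow> (\<forall>j<dim_col M. v j = 0))"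

lemma stack_eq_0_iff:
  assumes "v \<in> poly_vecs q k"
  shows "stack q k v = 0\<^sub>v (k * q) \<longleftrightarrow> (\<forall>j<q. v j = 0)"
proof
  assume "stack q k v = 0\<^sub>v (k * q)"
  also have "\<dots> = stack q k (\<lambda>_. 0)" by (intro eq_vecI) (auto simp: stack_def)
  finally show "\<forall>j<q. v j = 0"
    using stack_inject[OF assms, of "\<lambda>_. 0"] by (simp add: poly_vecs_def)
next
  assume v: "\<forall>j<q. v j = 0"
  have "c mod q < q" if "c < k * q" for c using that by (cases q) auto
  with v show "stack q k v = 0\<^sub>v (k * q)" by (intro eq_vecI) (auto simp: stack_def)
qed

lemma rank_sylvester_inj:
  fixes M :: "'a::field poly mat"
  assumes M: "M \<in> poly_mats p q d" and q: "q > 0"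
  shows "vec_space.rank ((k + d) * p) (sylvester d k M) = k * q \<longleftrightarrow> syl_inj M k"
proof -
  interpret vec_space "TYPE('a)" "(k + d) * p" .
  note Mc = poly_mats_carrier[OF M]
  have *: "pmul M v \<in> poly_vecs p (k + d)" if "v \<in> poly_vecs q k" for v by (rule pmul_poly_vecs[OF M that])
  show ?thesis
    unfolding rank_eq_dim_col_iff[OF sylvester_carrier[OF Mc]] syl_inj_def
  proof safe
    fix v :: "nat \<Rightarrow> 'a poly" and j assume r: "\<forall>v\<in>carrier_vec (k * q). sylvester d k M *\<^sub>v v = 0\<^sub>v ((k + d) * p) \<longrightarrow> v = 0\<^sub>v (k * q)"
      and v: "v \<in> poly_vecs (dim_col M) k" "\<forall>i<dim_row M. pmul M v i = 0" and j: "j < dim_col M"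
    have v': "v \<in> poly_vecs q k" using v(1) Mc by simp
    have "sylvester d k M *\<^sub>v stack q k v = 0\<^sub>v ((k + d) * p)"
      unfolding sylvester_mult_stack[OF M v' q] stack_eq_0_iff[OF *[OF v']] using v(2) Mc by simp
    then have "stack q k v = 0\<^sub>v (k * q)" using r by simp
    then show "v j = 0" using stack_eq_0_iff[OF v'] j Mc by simp
  next
    fix x :: "'a vec"
    assume r: "\<forall>v\<in>poly_vecs (dim_col M) k. (\<forall>i<dim_row M. pmul M v i = 0) \<longrightarrow> (\<forall>j<dim_col M. v j = 0)"
      and x: "x \<in> carrier_vec (k * q)" "sylvester d k M *\<^sub>v x = 0\<^sub>v ((k + d) * p)"
    let ?v = "unstack q k x"
    have "stack p (k + d) (pmul M ?v) = 0\<^sub>v ((k + d) * p)"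
      using sylvester_mult_stack[OF M _ q, of ?v k] x by (simp add: stack_unstack)
    then have "\<forall>i<p. pmul M ?v i = 0" using stack_eq_0_iff[OF *[of ?v]] by simp
    then have "\<forall>j<q. ?v j = 0" using r Mc by auto
    then have "stack q k ?v = 0\<^sub>v (k * q)" using stack_eq_0_iff[of ?v q k] by simp
    then show "x = 0\<^sub>v (k * q)" using x by (simp add: stack_unstack)
  qed
qed

lemma rank_sylvester_surj:
  fixes M :: "'a::field poly mat"
  assumes M: "M \<in> poly_mats p q d" and q: "q > 0"
  shows "vec_space.rank ((k + d) * p) (sylvester d k M) = (k + d) * p \<longleftrightarrow> syl_surj d M k"
proof -
  interpret vec_space "TYPE('a)" "(k + d) * p" .
  note Mc = poly_mats_carrier[OF M]
  have *: "pmul M v \<in> poly_vecs p (k + d)" if "v \<in> poly_vecs q k" for v by (rule pmul_poly_vecs[OF M that])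
  show ?thesis
    unfolding rank_eq_dim_row_iff[OF sylvester_carrier[OF Mc]] syl_surj_def
  proof (intro iffI ballI)
    fix w :: "nat \<Rightarrow> 'a poly" assume r: "\<forall>b\<in>carrier_vec ((k + d) * p). \<exists>v\<in>carrier_vec (k * q). sylvester d k M *\<^sub>v v = b"
      and "w \<in> poly_vecs (dim_row M) (k + d)"
    then have w: "w \<in> poly_vecs p (k + d)" using Mc by simp
    from r obtain x where x: "x \<in> carrier_vec (k * q)" "sylvester d k M *\<^sub>v x = stack p (k + d) w"
      using stack_carrier by blast
    let ?v = "unstack q k x"
    have "stack p (k + d) (pmul M ?v) = stack p (k + d) w"
      using sylvester_mult_stack[OF M _ q, of ?v k] x by (simp add: stack_unstack)
    from stack_inject[OF *[of ?v] w this] have "\<forall>i<p. pmul M ?v i = w i" by simp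
    then show "\<exists>v\<in>poly_vecs (dim_col M) k. \<forall>i<dim_row M. pmul M v i = w i"
      using Mc by (intro bexI[of _ ?v]) auto
  next
    fix b :: "'a vec"
    assume r: "\<forall>w\<in>poly_vecs (dim_row M) (k + d). \<exists>v\<in>poly_vecs (dim_col M) k. \<forall>i<dim_row M. pmul M v i = w i"
      and b: "b \<in> carrier_vec ((k + d) * p)"
    have "unstack p (k + d) b \<in> poly_vecs (dim_row M) (k + d)" using Mc by simp
    from bspec[OF r this] obtain v where v: "v \<in> poly_vecs q k" "\<forall>i<p. pmul M v i = unstack p (k + d) b i"
      using Mc by auto
    have m: "c mod p < p" if "c < (k + d) * p" for c using that by (cases p) auto
    have "sylvester d k M *\<^sub>v stack q k v = stack p (k + d) (unstack p (k + d) b)"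
      unfolding sylvester_mult_stack[OF M v(1) q] using v(2) m by (intro eq_vecI) (auto simp: stack_def)
    then show "\<exists>v\<in>carrier_vec (k * q). sylvester d k M *\<^sub>v v = b"
      using b by (intro bexI[of _ "stack q k v"]) (auto simp: stack_unstack)
  qed
qed

lemma pmul_add: "pmul M (\<lambda>j. v j + w j) i = pmul M v i + pmul M w i"
  by (simp add: pmul_def distrib_left sum.distrib)

lemma pmul_diff: "pmul M (\<lambda>j. v j - w j) i = pmul M v i - pmul M (w :: nat \<Rightarrow> 'a::comm_ring poly) i"
  by (simp add: pmul_def right_diff_distrib sum_subtractf)

lemma pmul_mult: "pmul M (\<lambda>j. a * v j) i = a * pmul M v i"
  by (simp add: pmul_def sum_distrib_left mult_ac)

lemma pmul_sum: "pmul M (\<lambda>j. \<Sum>s\<in>S. v s j) i = (\<Sum>s\<in>S. pmul M (v s) i)"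
  unfolding pmul_def sum_distrib_left by (rule sum.swap)

text \<open>Split the right-hand side as constant part plus \<open>x\<close> times the rest.\<close>
lemma syl_surj_Suc:
  fixes M :: "'a::field poly mat"
  assumes s: "syl_surj d M k" and kd: "k + d > 0"
  shows "syl_surj d M (Suc k)"
  unfolding syl_surj_def
proof
  fix w :: "nat \<Rightarrow> 'a poly" assume w: "w \<in> poly_vecs (dim_row M) (Suc k + d)"
  define w0 where "w0 i = [:coeff (w i) 0:]" for i
  define w1 where "w1 i = poly_shift 1 (w i)" for i
  \<comment> \<open>A nonzero constant is an admissible right-hand side only because
    \<open>k + d > 0\<close>.\<close>
  have "w0 \<in> poly_vecs (dim_row M) (k + d)"
    using kd by (auto simp: poly_vecs_def w0_def coeff_pCons split: nat.split)
  then obtain v0 where v0: "v0 \<in> poly_vecs (dim_col M) k" "\<And>i. i < dim_row M \<Longrightarrow> pmul M v0 i = w0 i"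
    using s by (auto simp: syl_surj_def)
  have "w1 \<in> poly_vecs (dim_row M) (k + d)"
    using w by (auto simp: poly_vecs_def w1_def coeff_poly_shift)
  then obtain v1 where v1: "v1 \<in> poly_vecs (dim_col M) k" "\<And>i. i < dim_row M \<Longrightarrow> pmul M v1 i = w1 i"
    using s by (auto simp: syl_surj_def)
  define v where "v j = v0 j + [:0, 1:] * v1 j" for j
  have "v \<in> poly_vecs (dim_col M) (Suc k)"
    using v0(1) v1(1) by (auto simp: poly_vecs_def v_def coeff_pCons split: nat.split)
  moreover have "pmul M v i = w i" if i: "i < dim_row M" for i
  proof -
    have "pmul M v i = w0 i + [:0, 1:] * w1 i"
      unfolding v_def pmul_add pmul_mult using v0(2)[OF i] v1(2)[OF i] by simp
    also have "\<dots> = w i"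
      by (intro poly_eqI) (auto simp: w0_def w1_def coeff_pCons coeff_poly_shift split: nat.split)
    finally show ?thesis .
  qed
  ultimately show "\<exists>v\<in>poly_vecs (dim_col M) (Suc k). \<forall>i<dim_row M. pmul M v i = w i" by blast
qed

lemma syl_surj_mono:
  fixes M :: "'a::field poly mat"
  assumes "syl_surj d M k" "k + d > 0" "k \<le> l"
  shows "syl_surj d M l"
  using assms(3)
proof (induction l rule: dec_induct)
  case (step j)
  have "j + d > 0" using step(1) assms(2) by linarith
  with step(3) show ?case by (rule syl_surj_Suc)
qed (rule assms(1))

lemma poly_vecs_mono: "k \<le> l \<Longrightarrow> poly_vecs q k \<subseteq> poly_vecs q l"
  by (auto simp: poly_vecs_def)

lemma syl_inj_antimono: "syl_inj M l \<Longrightarrow> k \<le> l \<Longrightarrow> syl_inj M k"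
  unfolding syl_inj_def using poly_vecs_mono by blast

text \<open>The matrix has at most as many rows as columns exactly if
  \<open>m * d \<le> n * k\<close>. So the required rank means surjectivity for large
  \<open>k\<close>, injectivity for small \<open>k\<close>, and both for equality.\<close>

lemma full_sylvester_rank_iff:
  fixes M :: "'a::field poly mat"
  assumes M: "M \<in> poly_mats m (m + n) d" and pos: "m + n > 0"
  shows "full_sylvester_rank d M \<longleftrightarrow>
    (\<forall>k\<ge>1. (m * d \<le> n * k \<longrightarrow> syl_surj d M k) \<and> (n * k \<le> m * d \<longrightarrow> syl_inj M k))"
proof -
  note Mc = poly_mats_carrier[OF M]
  have "(vec_space.rank ((k + d) * m) (sylvester d k M) = min ((k + d) * m) (k * (m + n))) \<longleftrightarrow>
    (m * d \<le> n * k \<longrightarrow> syl_surj d M k) \<and> (n * k \<le> m * d \<longrightarrow> syl_inj M k)" for k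
  proof -
    have e: "(k + d) * m \<le> k * (m + n) \<longleftrightarrow> m * d \<le> n * k" "k * (m + n) \<le> (k + d) * m \<longleftrightarrow> n * k \<le> m * d"
      by (auto simp: algebra_simps)
    show ?thesis
      using rank_sylvester_inj[OF M pos, of k] rank_sylvester_surj[OF M pos, of k] e
      by (auto simp: min_def)
  qed
  then show ?thesis using Mc by (simp add: full_sylvester_rank_def)
qed

section \<open>Norms of polynomial vectors and of their products with a matrix\<close>

lemma pnorm_cong: "(\<And>j. j < q \<Longrightarrow> v j = w j) \<Longrightarrow> pnorm q k v = pnorm q k w"
  unfolding pnorm_def by (intro L2_set_cong) auto

lemma pnorm_uminus: "pnorm q k (\<lambda>j. - v j) = pnorm q k v"
  unfolding pnorm_def by (intro L2_set_cong) auto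

lemma pnorm_add: "pnorm q k (\<lambda>j. v j + w j) \<le> pnorm q k v + pnorm q k w"
proof -
  have "pnorm q k (\<lambda>j. v j + w j) \<le>
      L2_set (\<lambda>x. (case x of (l, j) \<Rightarrow> norm (coeff (v j) l)) + (case x of (l, j) \<Rightarrow> norm (coeff (w j) l))) ({..<k} \<times> {..<q})"
    unfolding pnorm_def by (intro L2_set_mono) (auto intro: norm_triangle_ineq)
  also have "\<dots> \<le> pnorm q k v + pnorm q k w" unfolding pnorm_def by (rule L2_set_triangle_ineq)
  finally show ?thesis .
qed

lemma pnorm_zero [simp]: "pnorm q k (\<lambda>_. 0) = 0"
  by (simp add: pnorm_def L2_set_eq_0_iff)

lemma pnorm_sum: "finite S \<Longrightarrow> pnorm q k (\<lambda>j. \<Sum>s\<in>S. f s j) \<le> (\<Sum>s\<in>S. pnorm q k (f s))"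
proof (induction S rule: finite_induct)
  case (insert s S)
  then show ?case using pnorm_add[of q k "f s" "\<lambda>j. \<Sum>s\<in>S. f s j"] by simp
qed simp

text \<open>Multiplying by a power of the variable shifts coefficients, and the cut at
  \<open>K\<close> can only lose terms; \<open>h s\<close> is the squared norm of the coefficient
  vector of degree \<open>s\<close>.\<close>

lemma pnorm_shift:
  assumes u: "u \<in> poly_vecs p D"
  shows "pnorm p K (\<lambda>i. monom 1 l * u i) \<le> pnorm p D u"
proof -
  define h where "h s = (\<Sum>i<p. (norm (coeff (u i) s))\<^sup>2)" for s
  have h0: "h s \<ge> 0" for s by (simp add: h_def sum_nonneg)
  have hD: "h s = 0" if "D \<le> s" for s using that u by (simp add: h_def poly_vecs_def)
  have "(pnorm p K (\<lambda>i. monom 1 l * u i))\<^sup>2 = (\<Sum>s<K. if l \<le> s then h (s - l) else 0)"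
    unfolding pnorm_sq h_def by (intro sum.cong) (auto simp: coeff_monom_mult)
  also have "\<dots> \<le> (\<Sum>s<l + K. if l \<le> s then h (s - l) else 0)"
    using h0 by (intro sum_mono2) auto
  also have "\<dots> = (\<Sum>s\<in>{l..<l + K}. h (s - l))"
    by (intro sum.mono_neutral_cong_right) auto
  also have "\<dots> = (\<Sum>s<K. h s)"
    using sum.shift_bounds_nat_ivl[of "\<lambda>s. h (s - l)" 0 l K] by (simp add: add.commute atLeast0LessThan)
  also have "\<dots> \<le> (\<Sum>s<D + K. h s)" using h0 by (intro sum_mono2) auto
  also have "\<dots> = (\<Sum>s<D. h s)" using hD by (intro sum.mono_neutral_right) auto
  also have "\<dots> = (pnorm p D u)\<^sup>2" by (simp add: pnorm_sq h_def)
  finally show ?thesis by (rule power2_le_imp_le) simp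
qed

text \<open>Split v into its \<open>k\<close> coefficient vectors. Each product with D is controlled
  by S_1(D) and then shifted; adding the \<open>k\<close> norms by Cauchy-Schwarz costs the factor
  sqrt k. The roots in the denominators of \<open>theta1\<close> and \<open>theta2\<close>
  compensate for it.\<close>

lemma pmul_norm_bound:
  fixes D :: "'a::real_or_complex poly mat"
  assumes D: "D \<in> poly_mats p q d" and v: "v \<in> poly_vecs q k" and q: "q > 0"
    and \<delta>: "\<delta> \<ge> 0" "\<And>x. x \<in> carrier_vec q \<Longrightarrow> vnorm (sylvester d 1 D *\<^sub>v x) \<le> \<delta> * vnorm x"
  shows "pnorm p (k + d) (pmul D v) \<le> sqrt (real k) * \<delta> * pnorm q k v"
proof -
  define c where "c l j = [:coeff (v j) l:]" for l j
  have c: "c l \<in> poly_vecs q 1" for l by (auto simp: poly_vecs_def c_def coeff_pCons split: nat.split)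
  have vc: "v j = (\<Sum>l<k. monom 1 l * c l j)" if j: "j < q" for j
  proof (rule poly_eqI)
    fix s
    have m: "coeff (monom 1 l * c l j) s = (if l = s then coeff (v j) s else 0)" for l
      by (auto simp: coeff_monom_mult c_def coeff_pCons split: nat.split)
    have "coeff (\<Sum>l<k. monom 1 l * c l j) s = (\<Sum>l<k. if l = s then coeff (v j) s else 0)"
      by (simp only: coeff_sum m)
    also have "\<dots> = coeff (v j) s" using poly_vecsD[OF v j, of s] by (simp add: sum.delta)
    finally show "coeff (v j) s = coeff (\<Sum>l<k. monom 1 l * c l j) s" by (rule sym)
  qed
  have dc: "dim_col D = q" using poly_mats_carrier[OF D] by simp
  have "pmul D v i = (\<Sum>l<k. monom 1 l * pmul D (c l) i)" for i
  proof -
    have "pmul D v i = pmul D (\<lambda>j. \<Sum>l<k. monom 1 l * c l j) i"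
      unfolding pmul_def using vc dc by (intro sum.cong) auto
    then show ?thesis by (simp only: pmul_sum pmul_mult)
  qed
  then have "pnorm p (k + d) (pmul D v) \<le> (\<Sum>l<k. pnorm p (k + d) (\<lambda>i. monom 1 l * pmul D (c l) i))"
    using pnorm_sum[of "{..<k}" p "k + d" "\<lambda>l i. monom 1 l * pmul D (c l) i"]
      pnorm_cong[of p "pmul D v" "\<lambda>i. \<Sum>l<k. monom 1 l * pmul D (c l) i" "k + d"] by simp
  also have "\<dots> \<le> (\<Sum>l<k. \<delta> * pnorm q 1 (c l))"
  proof (rule sum_mono)
    fix l
    have "pnorm p (k + d) (\<lambda>i. monom 1 l * pmul D (c l) i) \<le> pnorm p (1 + d) (pmul D (c l))"
      by (rule pnorm_shift[OF pmul_poly_vecs[OF D c]])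
    also have "\<dots> = vnorm (sylvester d 1 D *\<^sub>v stack q 1 (c l))"
      by (simp only: sylvester_mult_stack[OF D c q] vnorm_stack)
    also have "\<dots> \<le> \<delta> * pnorm q 1 (c l)"
      using \<delta>(2)[of "stack q 1 (c l)"] stack_carrier[of q 1 "c l"] by (simp add: vnorm_stack)
    finally show "pnorm p (k + d) (\<lambda>i. monom 1 l * pmul D (c l) i) \<le> \<delta> * pnorm q 1 (c l)" .
  qed
  also have "\<dots> = \<delta> * (\<Sum>l<k. \<bar>1\<bar> * \<bar>pnorm q 1 (c l)\<bar>)" by (simp add: sum_distrib_left)
  also have "\<dots> \<le> \<delta> * (L2_set (\<lambda>_. 1) {..<k} * L2_set (\<lambda>l. pnorm q 1 (c l)) {..<k})"
    by (intro mult_left_mono L2_set_mult_ineq \<delta>)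
  also have "L2_set (\<lambda>l. pnorm q 1 (c l)) {..<k} = pnorm q k v"
  proof -
    have "(L2_set (\<lambda>l. pnorm q 1 (c l)) {..<k})\<^sup>2 = (\<Sum>l<k. (pnorm q 1 (c l))\<^sup>2)"
      by (simp add: L2_set_def sum_nonneg)
    also have "\<dots> = (pnorm q k v)\<^sup>2" by (simp add: pnorm_sq c_def)
    finally show ?thesis by (rule power2_eq_imp_eq) simp_all
  qed
  finally show ?thesis by (simp add: L2_set_constant mult_ac)
qed

lemma poly_mats_minus:
  fixes M :: "'a::ab_group_add poly mat"
  assumes "M \<in> poly_mats p q d" "M' \<in> poly_mats p q d"
  shows "M - M' \<in> poly_mats p q d"
  using assms by (auto simp: poly_mats_def intro!: degree_diff_le)

lemma sylvester_minus:
  fixes M :: "'a::ab_group_add poly mat"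
  assumes "M \<in> carrier_mat p q" "M' \<in> carrier_mat p q"
  shows "sylvester d k M - sylvester d k M' = sylvester d k (M - M')"
proof (rule eq_matI)
  fix r c assume "r < dim_row (sylvester d k (M - M'))" "c < dim_col (sylvester d k (M - M'))"
  then have rc: "r < (k + d) * p" "c < k * q" using assms by (auto simp: sylvester_def Let_def)
  then have "p > 0" "q > 0" by (cases p; simp) (use rc in \<open>cases q; simp\<close>)
  then show "(sylvester d k M - sylvester d k M') $$ (r, c) = sylvester d k (M - M') $$ (r, c)"
    using assms rc by (auto simp: sylvester_def Let_def)
qed (use assms in \<open>auto simp: sylvester_def Let_def\<close>)

lemma pmul_minus_mat:
  fixes M :: "'a::comm_ring poly mat"
  assumes "M \<in> carrier_mat p q" "M' \<in> carrier_mat p q" "i < p"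
  shows "pmul (M - M') v i = pmul M v i - pmul M' v i"
  using assms by (simp add: pmul_def left_diff_distrib sum_subtractf)

section \<open>Ranks and kernels of perturbed Sylvester matrices\<close>

locale sylvester_perturbation =
  fixes M M' :: "'a::real_or_complex poly mat" and p q d :: nat
  assumes M: "M \<in> poly_mats p q d" and M': "M' \<in> poly_mats p q d" and p: "p > 0" and q: "q > 0"
begin

definition \<delta> :: real where "\<delta> = spectral_norm (sylvester d 1 M - sylvester d 1 M')"

lemmas Mc = poly_mats_carrier[OF M] and Mc' = poly_mats_carrier[OF M']
lemmas D = poly_mats_minus[OF M M']

lemma \<delta>_nonneg: "0 \<le> \<delta>"
  and \<delta>_bound: "x \<in> carrier_vec q \<Longrightarrow> vnorm (sylvester d 1 (M - M') *\<^sub>v x) \<le> \<delta> * vnorm x"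
proof -
  have S: "sylvester d 1 (M - M') \<in> carrier_mat ((1 + d) * p) q"
    using sylvester_carrier[OF poly_mats_carrier[OF D], of d 1] by simp
  have *: "(1 + d) * p > 0" using p by simp
  show "0 \<le> \<delta>" unfolding \<delta>_def sylvester_minus[OF Mc Mc'] by (rule spectral_norm_bound(1)[OF S * q])
  show "x \<in> carrier_vec q \<Longrightarrow> vnorm (sylvester d 1 (M - M') *\<^sub>v x) \<le> \<delta> * vnorm x"
    unfolding \<delta>_def sylvester_minus[OF Mc Mc'] by (rule spectral_norm_bound(2)[OF S * q])
qed

lemma pmul_diff_bound:
  "v \<in> poly_vecs q k \<Longrightarrow> pnorm p (k + d) (pmul (M - M') v) \<le> sqrt (real k) * \<delta> * pnorm q k v"
  by (rule pmul_norm_bound[OF D _ q \<delta>_nonneg \<delta>_bound])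

lemma sylvester_diff_bound:
  assumes x: "x \<in> carrier_vec (k * q)"
  shows "vnorm ((sylvester d k M - sylvester d k M') *\<^sub>v x) \<le> sqrt (real k) * \<delta> * vnorm x"
proof -
  let ?v = "unstack q k x"
  have "vnorm ((sylvester d k M - sylvester d k M') *\<^sub>v x) = vnorm (sylvester d k (M - M') *\<^sub>v stack q k ?v)"
    using x by (simp add: sylvester_minus[OF Mc Mc'] stack_unstack)
  also have "\<dots> = pnorm p (k + d) (pmul (M - M') ?v)"
    by (simp add: sylvester_mult_stack[OF D _ q] vnorm_stack)
  also have "\<dots> \<le> sqrt (real k) * \<delta> * pnorm q k ?v" by (rule pmul_diff_bound) simp
  also have "pnorm q k ?v = vnorm x" using x by (simp add: stack_unstack flip: vnorm_stack)
  finally show ?thesis .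
qed

lemma sd_nonneg: "0 \<le> sqrt (real k) * \<delta>"
  using \<delta>_nonneg by simp

text \<open>A perturbation of norm at most sqrt k * \<delta> cannot use up the last singular value,
  so |S_k(M') x| stays bounded below by a positive multiple of |x|.\<close>

lemma tall_inj:
  assumes "k > 0" "k * q \<le> (k + d) * p" "sqrt (real k) * \<delta> < \<sigma> (k * q) (sylvester d k M)"
  shows "syl_inj M' k"
proof -
  interpret vec_space "TYPE('a)" "(k + d) * p" .
  note S = sylvester_carrier[OF Mc, of d k] and S' = sylvester_carrier[OF Mc', of d k]
  have kq: "k * q > 0" using assms(1) q by simp
  have "x = 0\<^sub>v (k * q)" if x: "x \<in> carrier_vec (k * q)" and 0: "sylvester d k M' *\<^sub>v x = 0\<^sub>v ((k + d) * p)" for x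
  proof -
    have "(\<sigma> (k * q) (sylvester d k M) - sqrt (real k) * \<delta>) * vnorm x \<le> 0"
      using \<sigma>_perturb_tall[OF S S' assms(2) kq sylvester_diff_bound x] 0 by simp
    then have "vnorm x \<le> 0" using assms(3) by (simp add: mult_le_0_iff)
    then have "vnorm x = 0" using vnorm_nonneg[of x] by linarith
    then show ?thesis using x by (simp add: vnorm_eq_0)
  qed
  then have "rank (sylvester d k M') = k * q" unfolding rank_eq_dim_col_iff[OF S'] by blast
  then show ?thesis using rank_sylvester_inj[OF M' q] by simp
qed

context
  fixes k :: nat
  assumes k: "k > 0" and wide: "(k + d) * p \<le> k * q"
    and s: "sqrt (real k) * \<delta> < \<sigma> ((k + d) * p) (sylvester d k M)"
begin

lemma wide_solve:
  assumes "b \<in> carrier_vec ((k + d) * p)"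
  shows "\<exists>z\<in>carrier_vec (k * q). sylvester d k M' *\<^sub>v z = b \<and>
    (\<sigma> ((k + d) * p) (sylvester d k M) - sqrt (real k) * \<delta>) * vnorm z \<le> vnorm b"
proof (rule right_inverse_bound[OF sylvester_carrier[OF Mc'] _ assms])
  have "(k + d) * p > 0" using k p by simp
  then show "(\<sigma> ((k + d) * p) (sylvester d k M) - sqrt (real k) * \<delta>) * vnorm y
      \<le> vnorm (mat_adjoint (sylvester d k M') *\<^sub>v y)" if "y \<in> carrier_vec ((k + d) * p)" for y
    by (rule \<sigma>_perturb_wide[OF sylvester_carrier[OF Mc] sylvester_carrier[OF Mc'] wide _ sd_nonneg
          sylvester_diff_bound that])
qed (use s in simp)

lemma wide_surj: "syl_surj d M' k"
proof -
  interpret vec_space "TYPE('a)" "(k + d) * p" .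
  have "rank (sylvester d k M') = (k + d) * p"
    unfolding rank_eq_dim_row_iff[OF sylvester_carrier[OF Mc']] using wide_solve by blast
  then show ?thesis using rank_sylvester_surj[OF M' q] by simp
qed

text \<open>The correction is small because M v = 0 turns the right-hand side M' v into -(M - M') v,
  whose norm is at most sqrt k * \<delta> * |v|.\<close>

lemma wide_project:
  assumes v: "v \<in> poly_vecs q k" and ker: "\<And>i. i < p \<Longrightarrow> pmul M v i = 0"
  shows "\<exists>v'\<in>poly_vecs q k. (\<forall>i<p. pmul M' v' i = 0) \<and>
    (\<sigma> ((k + d) * p) (sylvester d k M) - sqrt (real k) * \<delta>) * pnorm q k (\<lambda>j. v j - v' j)
      \<le> sqrt (real k) * \<delta> * pnorm q k v"
proof -
  let ?b = "sylvester d k M' *\<^sub>v stack q k v"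
  have b: "?b = stack p (k + d) (pmul M' v)" by (rule sylvester_mult_stack[OF M' v q])
  obtain z where z: "z \<in> carrier_vec (k * q)" "sylvester d k M' *\<^sub>v z = ?b"
    "(\<sigma> ((k + d) * p) (sylvester d k M) - sqrt (real k) * \<delta>) * vnorm z \<le> vnorm ?b"
    using wide_solve[of ?b] unfolding b by auto
  let ?u = "unstack q k z"
  define v' where "v' j = v j - ?u j" for j
  have v': "v' \<in> poly_vecs q k" using v unstack_poly_vecs[of q k z] by (simp add: poly_vecs_def v'_def)
  have "stack p (k + d) (pmul M' ?u) = stack p (k + d) (pmul M' v)"
    using z(2) sylvester_mult_stack[OF M' _ q, of ?u k] z(1) by (simp add: stack_unstack b)
  from stack_inject[OF pmul_poly_vecs[OF M'] pmul_poly_vecs[OF M' v] this]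
  have ker': "\<forall>i<p. pmul M' v' i = 0" by (simp add: v'_def[abs_def] pmul_diff)
  have "vnorm ?b = pnorm p (k + d) (pmul M' v)" by (simp add: b vnorm_stack)
  also have "\<dots> = pnorm p (k + d) (\<lambda>i. - pmul (M - M') v i)"
    using ker by (intro pnorm_cong) (simp add: pmul_minus_mat[OF Mc Mc'])
  also have "\<dots> \<le> sqrt (real k) * \<delta> * pnorm q k v"
    using pmul_diff_bound[OF v] by (simp add: pnorm_uminus)
  finally have "vnorm ?b \<le> sqrt (real k) * \<delta> * pnorm q k v" .
  moreover have "vnorm z = pnorm q k (\<lambda>j. v j - v' j)"
    using z(1) by (simp add: v'_def stack_unstack flip: vnorm_stack)
  ultimately show ?thesis using v' ker' z(3) by (intro bexI[of _ v']) auto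
qed

end

end

section \<open>Independence over the rational functions\<close>

lemma common_denominator:
  fixes c :: "'i \<Rightarrow> 'a::idom fract"
  assumes "finite I"
  shows "\<exists>b a. b \<noteq> 0 \<and> (\<forall>i\<in>I. to_fract b * c i = to_fract (a i))"
  using assms
proof (induction I rule: finite_induct)
  case empty
  show ?case by (intro exI[of _ 1]) simp
next
  case (insert k I)
  then obtain b a where ba: "b \<noteq> 0" "\<forall>i\<in>I. to_fract b * c i = to_fract (a i)" by blast
  obtain x y where xy: "c k = Fract x y" "y \<noteq> 0" by (cases "c k") auto
  have "to_fract (b * y) * c i = to_fract ((\<lambda>i. if i = k then b * x else a i * y) i)" if "i \<in> insert k I" for i
  proof (cases "i = k")
    case True
    then show ?thesis using xy by (simp add: Fract_conv_to_fract)
  next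
    case False
    then have "to_fract b * c i = to_fract (a i)" using that ba by simp
    then show ?thesis using False by (simp add: mult_ac)
  qed
  then show ?case using ba(1) xy(2) by (intro exI[of _ "b * y"] exI[of _ "\<lambda>i. if i = k then b * x else a i * y"]) auto
qed

definition fract_indep :: "'i set \<Rightarrow> nat \<Rightarrow> ('i \<Rightarrow> nat \<Rightarrow> 'a::field poly) \<Rightarrow> bool" where
  "fract_indep I q P \<longleftrightarrow> indep I {..<q} (\<lambda>i j. to_fract (P i j))"

text \<open>Clearing denominators turns a rational relation into a polynomial one.\<close>

lemma fract_indep_iff:
  assumes fin: "finite I"
  shows "fract_indep I q P \<longleftrightarrow> (\<forall>a. (\<forall>j<q. (\<Sum>i\<in>I. a i * P i j) = 0) \<longrightarrow> (\<forall>i\<in>I. a i = 0))"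
proof
  assume L: "fract_indep I q P"
  show "\<forall>a. (\<forall>j<q. (\<Sum>i\<in>I. a i * P i j) = 0) \<longrightarrow> (\<forall>i\<in>I. a i = 0)"
  proof (intro allI impI ballI)
    fix a i assume a: "\<forall>j<q. (\<Sum>i\<in>I. a i * P i j) = 0" and i: "i \<in> I"
    have "(\<Sum>i\<in>I. to_fract (a i) * to_fract (P i j)) = 0" if "j \<in> {..<q}" for j
      using a that by (metis (no_types, lifting) to_fract_sum to_fract_mult to_fract_0 sum.cong lessThan_iff)
    from indepD[OF L[unfolded fract_indep_def] this i] show "a i = 0" by simp
  qed
next
  assume R: "\<forall>a. (\<forall>j<q. (\<Sum>i\<in>I. a i * P i j) = 0) \<longrightarrow> (\<forall>i\<in>I. a i = 0)"
  show "fract_indep I q P"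
    unfolding fract_indep_def
  proof (rule indepI)
    fix c i assume c: "\<And>j. j \<in> {..<q} \<Longrightarrow> (\<Sum>i\<in>I. c i * to_fract (P i j)) = 0" and i: "i \<in> I"
    obtain b a where ba: "b \<noteq> 0" "\<And>i. i \<in> I \<Longrightarrow> to_fract b * c i = to_fract (a i)"
      using common_denominator[OF fin, of c] by blast
    have "(\<Sum>i\<in>I. a i * P i j) = 0" if j: "j < q" for j
    proof -
      have "to_fract (\<Sum>i\<in>I. a i * P i j) = (\<Sum>i\<in>I. to_fract (a i) * to_fract (P i j))" by simp
      also have "\<dots> = (\<Sum>i\<in>I. to_fract b * c i * to_fract (P i j))"
        using ba(2) by (intro sum.cong) simp_all
      also have "\<dots> = to_fract b * (\<Sum>i\<in>I. c i * to_fract (P i j))"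
        by (simp add: sum_distrib_left mult.assoc)
      also have "\<dots> = 0" using c j by simp
      finally show ?thesis by (simp only: to_fract_eq_0_iff)
    qed
    with R i have "a i = 0" by blast
    with ba(2)[OF i] ba(1) show "c i = 0" by simp
  qed
qed

text \<open>Degree at most \<open>D - e\<close> of a nonzero \<open>a\<close> and at most
  \<open>e\<close> of \<open>P\<close> leave a single term of the convolution.\<close>

lemma coeff_mult_top:
  fixes a P :: "'a::comm_semiring_0 poly"
  assumes "\<And>l. l > e \<Longrightarrow> coeff P l = 0" and "a \<noteq> 0 \<Longrightarrow> degree a + e \<le> D"
  shows "coeff (a * P) D = (if e \<le> D then coeff a (D - e) else 0) * coeff P e"
proof (cases "a = 0")
  case False
  then have D: "degree a + e \<le> D" using assms(2) by simp
  have "coeff (a * P) D = (\<Sum>l\<in>{D - e}. coeff a l * coeff P (D - l))"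
    unfolding coeff_mult
  proof (rule sum.mono_neutral_right)
    show "\<forall>l\<in>{..D} - {D - e}. coeff a l * coeff P (D - l) = 0"
    proof
      fix l assume l: "l \<in> {..D} - {D - e}"
      then have "l < D - e \<or> D - e < l" by auto
      then show "coeff a l * coeff P (D - l) = 0"
      proof
        assume "l < D - e"
        then show ?thesis using assms(1)[of "D - l"] by simp
      next
        assume "D - e < l"
        then show ?thesis using D by (simp add: coeff_eq_0)
      qed
    qed
  qed auto
  then show ?thesis using D by simp
qed simp

text \<open>The highest degree \<open>D\<close> in a vanishing polynomial combination gives a vanishing constant
  combination of the leading coefficient vectors (predictable degree property).\<close>
lemma fract_indep_leading:
  fixes P :: "'i \<Rightarrow> nat \<Rightarrow> 'a::field poly"
  assumes fin: "finite I"
    and deg: "\<And>i j l. i \<in> I \<Longrightarrow> j < q \<Longrightarrow> e i < l \<Longrightarrow> coeff (P i j) l = 0"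
    and lead: "indep I {..<q} (\<lambda>i j. coeff (P i j) (e i))"
  shows "fract_indep I q P"
  unfolding fract_indep_iff[OF fin]
proof (rule ccontr)
  assume "\<not> (\<forall>a. (\<forall>j<q. (\<Sum>i\<in>I. a i * P i j) = 0) \<longrightarrow> (\<forall>i\<in>I. a i = 0))"
  then obtain a i1 where a: "\<And>j. j < q \<Longrightarrow> (\<Sum>i\<in>I. a i * P i j) = 0" and i1: "i1 \<in> I" "a i1 \<noteq> 0" by blast
  define S where "S = (\<lambda>i. degree (a i) + e i) ` {i \<in> I. a i \<noteq> 0}"
  define D where "D = Max S"
  have S: "finite S" "S \<noteq> {}" using fin i1 by (auto simp: S_def)
  have le: "degree (a i) + e i \<le> D" if "i \<in> I" "a i \<noteq> 0" for i
    unfolding D_def using S(1) that by (intro Max_ge) (auto simp: S_def)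
  have "D \<in> S" unfolding D_def by (rule Max_in[OF S])
  then obtain i0 where i0: "i0 \<in> I" "a i0 \<noteq> 0" "D = degree (a i0) + e i0" by (auto simp: S_def)
  define c where "c i = (if e i \<le> D then coeff (a i) (D - e i) else 0)" for i
  have "(\<Sum>i\<in>I. c i * coeff (P i j) (e i)) = 0" if j: "j \<in> {..<q}" for j
  proof -
    have "(\<Sum>i\<in>I. c i * coeff (P i j) (e i)) = (\<Sum>i\<in>I. coeff (a i * P i j) D)"
      unfolding c_def using deg j le by (intro sum.cong refl coeff_mult_top[symmetric]) auto
    also have "\<dots> = coeff (\<Sum>i\<in>I. a i * P i j) D" by (simp add: coeff_sum)
    finally show ?thesis using a j by simp
  qed
  from indepD[OF lead this i0(1)] have "coeff (a i0) (degree (a i0)) = 0" using i0(3) by (simp add: c_def)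
  with i0(2) show False by simp
qed

text \<open>Independence of the stacked vectors is independence over the constants, a weaker
  condition than \<open>fract_indep\<close>.\<close>

lemma indep_stack_iff:
  fixes P :: "'i \<Rightarrow> nat \<Rightarrow> 'a::field poly"
  assumes P: "\<And>i. i \<in> I \<Longrightarrow> P i \<in> poly_vecs q k"
  shows "indep I {..<k * q} (\<lambda>i c. stack q k (P i) $ c) \<longleftrightarrow>
    (\<forall>c. (\<forall>j<q. (\<Sum>i\<in>I. [:c i:] * P i j) = 0) \<longrightarrow> (\<forall>i\<in>I. c i = 0))"
proof -
  have "(\<forall>x\<in>{..<k * q}. (\<Sum>i\<in>I. c i * stack q k (P i) $ x) = 0) \<longleftrightarrow> (\<forall>j<q. (\<Sum>i\<in>I. [:c i:] * P i j) = 0)" for c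
  proof -
    define u where "u j = (\<Sum>i\<in>I. [:c i:] * P i j)" for j
    have u: "u \<in> poly_vecs q k" using P by (auto simp: poly_vecs_def u_def coeff_sum)
    have "(\<Sum>i\<in>I. c i * stack q k (P i) $ x) = stack q k u $ x" if "x < k * q" for x
      using that by (simp add: stack_def u_def coeff_sum)
    then have "(\<forall>x\<in>{..<k * q}. (\<Sum>i\<in>I. c i * stack q k (P i) $ x) = 0) \<longleftrightarrow> stack q k u = 0\<^sub>v (k * q)"
      by (auto simp: vec_eq_iff stack_def)
    then show ?thesis unfolding stack_eq_0_iff[OF u] by (simp add: u_def)
  qed
  then show ?thesis unfolding indep_def by simp
qed

lemma fract_indep_imp_stack:
  assumes "finite I" "\<And>i. i \<in> I \<Longrightarrow> P i \<in> poly_vecs q k" "fract_indep I q P"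
  shows "indep I {..<k * q} (\<lambda>i c. stack q k (P i) $ c)"
proof -
  have "\<forall>c. (\<forall>j<q. (\<Sum>i\<in>I. [:c i:] * P i j) = 0) \<longrightarrow> (\<forall>i\<in>I. c i = 0)"
  proof (intro allI impI ballI)
    fix c i assume c: "\<forall>j<q. (\<Sum>i\<in>I. [:c i:] * P i j) = 0" and i: "i \<in> I"
    have "(\<forall>j<q. (\<Sum>i\<in>I. [:c i:] * P i j) = 0) \<longrightarrow> (\<forall>i\<in>I. [:c i:] = 0)"
      using assms(3) unfolding fract_indep_iff[OF assms(1)] by (rule spec)
    from bspec[OF mp[OF this c] i] have "[:c i:] = 0" .
    then show "c i = 0" by simp
  qed
  then show ?thesis by (rule iffD2[OF indep_stack_iff[of I P q k], rotated]) (rule assms(2))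
qed

text \<open>Surjectivity bounds the nullity from above. Independence is over the constants, so a
  vector and its multiples by powers of the variable all count.\<close>

lemma sylvester_kernel_card:
  fixes M :: "'a::field poly mat"
  assumes M: "M \<in> poly_mats p q d" and q: "q > 0" and s: "syl_surj d M k"
    and finI: "finite I" and P: "\<And>i. i \<in> I \<Longrightarrow> P i \<in> poly_vecs q k"
    and ker: "\<And>i r. i \<in> I \<Longrightarrow> r < p \<Longrightarrow> pmul M (P i) r = 0"
    and ind: "indep I {..<k * q} (\<lambda>i c. stack q k (P i) $ c)"
  shows "card I + (k + d) * p \<le> k * q"
proof -
  let ?S = "sylvester d k M"
  note Sc = sylvester_carrier[OF poly_mats_carrier[OF M], of d k]
  interpret vec_space "TYPE('a)" "(k + d) * p" .
  have prod: "(\<Sum>c<k * q. x $ c * ?S $$ (r, c)) = (?S *\<^sub>v x) $ r" if "r < (k + d) * p" "x \<in> carrier_vec (k * q)" for r x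
    using that Sc by (simp add: scalar_prod_def atLeast0LessThan mult.commute)
  have "card I + card {..<(k + d) * p} \<le> card {..<k * q}"
  proof (rule kernel_card[OF _ _ finI ind, where a = "\<lambda>c r. ?S $$ (r, c)"])
    fix i r assume i: "i \<in> I" and r: "r \<in> {..<(k + d) * p}"
    have "?S *\<^sub>v stack q k (P i) = 0\<^sub>v ((k + d) * p)"
      unfolding sylvester_mult_stack[OF M P[OF i] q] stack_eq_0_iff[OF pmul_poly_vecs[OF M P[OF i]]]
      using ker[OF i] by simp
    then show "(\<Sum>c<k * q. stack q k (P i) $ c * ?S $$ (r, c)) = 0" using prod r by simp
  next
    fix r assume r: "r \<in> {..<(k + d) * p}"
    have "rank ?S = (k + d) * p" using rank_sylvester_surj[OF M q] s by simp
    then obtain x where x: "x \<in> carrier_vec (k * q)" "?S *\<^sub>v x = unit_vec ((k + d) * p) r"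
      unfolding rank_eq_dim_row_iff[OF Sc] using unit_vec_carrier by blast
    then show "\<exists>x. \<forall>l\<in>{..<(k + d) * p}. (\<Sum>c<k * q. x c * ?S $$ (l, c)) = (if l = r then 1 else 0)"
      using prod r by (intro exI[of _ "\<lambda>c. x $ c"]) auto
  qed simp_all
  then show ?thesis by simp
qed

text \<open>Unknowns against equations: a vector of degree below \<open>k\<close> has
  \<open>k * q\<close> coefficients, and its product with row \<open>i\<close> of \<open>L\<close>
  has degree below \<open>k + e i\<close>.\<close>

lemma poly_kernel_exists:
  fixes L :: "nat \<Rightarrow> nat \<Rightarrow> 'a::field poly" and k q p :: nat and e :: "nat \<Rightarrow> nat"
  assumes q: "q > 0" and deg: "\<And>i j l. i < p \<Longrightarrow> j < q \<Longrightarrow> e i < l \<Longrightarrow> coeff (L i j) l = 0"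
  defines "s \<equiv> k * q - (\<Sum>i<p. k + e i)"
  shows "\<exists>B. (\<forall>b<s. B b \<in> poly_vecs q k \<and> (\<forall>i<p. (\<Sum>j<q. L i j * B b j) = 0)) \<and>
    indep {..<s} {..<k * q} (\<lambda>b c. stack q k (B b) $ c)"
proof -
  let ?J = "SIGMA i:{..<p}. {..<k + e i}"
  \<comment> \<open>The index \<open>c\<close> stands for a monomial vector; equation
    \<open>(i, l)\<close> says that the coefficient \<open>l\<close> of row \<open>i\<close> of the
    product vanishes.\<close>
  define a where "a c = (\<lambda>(i, l). coeff (L i (c mod q) * monom 1 (c div q)) l)" for c
  have "card {..<k * q} - card ?J = s" by (simp add: s_def)
  with solutions_exist[of "{..<k * q}" ?J a] obtain X where
    X: "indep {..<s} {..<k * q} X"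
      "\<And>b i l. b < s \<Longrightarrow> i < p \<Longrightarrow> l < k + e i \<Longrightarrow> (\<Sum>c<k * q. X b c * a c (i, l)) = 0"
    by auto
  define B where "B b = unstack q k (vec (k * q) (X b))" for b
  have st: "stack q k (B b) = vec (k * q) (X b)" for b by (simp add: B_def stack_unstack)
  have "(\<Sum>j<q. L i j * B b j) = 0" if b: "b < s" and i: "i < p" for b i
  proof (rule poly_eqI)
    fix l
    have "(\<Sum>j<q. L i j * B b j) = (\<Sum>j<q. \<Sum>m<k. L i j * monom (X b (m * q + j)) m)"
      unfolding B_def unstack_def sum_distrib_left by (intro sum.cong refl) (simp add: block_index)
    also have "\<dots> = (\<Sum>m<k. \<Sum>j<q. L i j * monom (X b (m * q + j)) m)" by (rule sum.swap)
    also have "\<dots> = (\<Sum>c<k * q. L i (c mod q) * monom (X b c) (c div q))"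
      using sum_div_mod[OF q, of "\<lambda>m j. L i j * monom (X b (m * q + j)) m" k] by simp
    finally have eq: "coeff (\<Sum>j<q. L i j * B b j) l = (\<Sum>c<k * q. coeff (L i (c mod q) * monom (X b c) (c div q)) l)"
      by (simp add: coeff_sum)
    have mono: "L i j * monom x m = Polynomial.smult x (L i j * monom 1 m)" for j m x
      by (simp add: mult_smult_right[symmetric] smult_monom del: mult_smult_right)
    show "coeff (\<Sum>j<q. L i j * B b j) l = coeff 0 l"
    proof (cases "l < k + e i")
      case True
      have "(\<Sum>c<k * q. coeff (L i (c mod q) * monom (X b c) (c div q)) l) = (\<Sum>c<k * q. X b c * a c (i, l))"
        by (subst mono) (simp add: a_def)
      then show ?thesis unfolding eq using X(2)[OF b i True] by simp
    next
      case False
      have "coeff (L i (c mod q) * monom (X b c) (c div q)) l = 0" if c: "c < k * q" for c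
      proof -
        have "c div q < k" using c by (simp add: less_mult_imp_div_less)
        then have "e i < l - c div q" "c div q \<le> l" using False by auto
        then show ?thesis using deg[OF i, of "c mod q" "l - c div q"] q
          by (subst mult.commute) (simp add: coeff_monom_mult)
      qed
      then show ?thesis unfolding eq by simp
    qed
  qed
  moreover have "indep {..<s} {..<k * q} (\<lambda>b c. stack q k (B b) $ c)"
    using X(1) by (subst indep_cong[of _ _ _ X]) (simp_all add: st)
  moreover have "B b \<in> poly_vecs q k" for b by (simp add: B_def)
  ultimately show ?thesis by (intro exI[of _ B]) simp
qed

text \<open>Surjectivity at one \<open>k\<close> gives polynomial solutions of M u = e_r for the
  constant unit vectors e_r. So M has full row rank over the rational functions, its null space has
  dimension at most \<open>n\<close>, and \<open>n\<close> independent kernel vectors span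
  it.\<close>

lemma fract_kernel_span:
  fixes M :: "'a::field poly mat"
  assumes M: "M \<in> poly_mats m (m + n) d" and s: "syl_surj d M k" and kd: "k + d > 0"
    and P: "indep {..<n} {..<m + n} p"
    and kerP: "\<And>i r. i < n \<Longrightarrow> r < m \<Longrightarrow> (\<Sum>j<m + n. p i j * to_fract (M $$ (r, j))) = 0"
    and kerv: "\<And>r. r < m \<Longrightarrow> (\<Sum>j<m + n. v j * to_fract (M $$ (r, j))) = 0"
  shows "\<exists>c. \<forall>j<m + n. v j = (\<Sum>i<n. c i * p i j)"
proof -
  have "\<exists>c. \<forall>j\<in>{..<m + n}. v j = (\<Sum>i\<in>{..<n}. c i * p i j)"
  proof (rule indep_insert_or_span[OF _ P])
    fix w :: "nat option \<Rightarrow> nat \<Rightarrow> 'a poly fract"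
    assume w: "indep (insert None (Some ` {..<n})) {..<m + n} w" "w None = v"
      "\<And>i. i \<in> {..<n} \<Longrightarrow> w (Some i) = p i"
    have "card (insert None (Some ` {..<n})) + card {..<m} \<le> card {..<m + n}"
    proof (rule kernel_card[OF _ _ _ w(1), where a = "\<lambda>j r. to_fract (M $$ (r, j))"])
      show "(\<Sum>j<m + n. w k j * to_fract (M $$ (r, j))) = 0"
        if "k \<in> insert None (Some ` {..<n})" "r \<in> {..<m}" for k r
        using that w kerP kerv by auto
    next
      fix r assume r: "r \<in> {..<m}"
      have Mc: "dim_row M = m" "dim_col M = m + n" using poly_mats_carrier[OF M] by auto
      have "(\<lambda>i. if i = r then 1 else 0 :: 'a poly) \<in> poly_vecs (dim_row M) (k + d)"
        using kd by (auto simp: poly_vecs_def)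
      from bspec[OF s[unfolded syl_surj_def] this]
      obtain u where u: "\<And>i. i < m \<Longrightarrow> pmul M u i = (if i = r then 1 else 0)"
        using Mc by auto
      have "(\<Sum>j<m + n. to_fract (u j) * to_fract (M $$ (l, j))) = (if l = r then 1 else 0)" if "l < m" for l
        using arg_cong[OF u[OF that], of to_fract] Mc by (simp add: pmul_def mult.commute)
      then show "\<exists>x. \<forall>l\<in>{..<m}. (\<Sum>j<m + n. x j * to_fract (M $$ (l, j))) = (if l = r then 1 else 0)"
        by (intro exI[of _ "\<lambda>j. to_fract (u j)"]) auto
    qed auto
    then show False by (simp add: card_image)
  qed simp
  then show ?thesis by auto
qed

section \<open>Independence and span of lists of vectors in coordinates\<close>

context vec_space
begin

lemma list_lin_indpt_iff:
  assumes ws: "set ws \<subseteq> carrier_vec n"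
  shows "distinct ws \<and> lin_indpt (set ws) \<longleftrightarrow> indep {..<length ws} {..<n} (\<lambda>i j. ws ! i $ j)"
proof -
  let ?A = "mat_of_cols n ws" and ?l = "length ws"
  have A: "?A \<in> carrier_mat n ?l" by simp
  have mv: "(?A *\<^sub>v x) $ j = (\<Sum>i<?l. x $ i * ws ! i $ j)" if "x \<in> carrier_vec ?l" "j < n" for x j
    using that by (simp add: scalar_prod_def atLeast0LessThan mat_of_cols_index mult.commute)
  have "distinct ws \<and> lin_indpt (set ws) \<longleftrightarrow> (\<forall>x\<in>carrier_vec ?l. ?A *\<^sub>v x = 0\<^sub>v n \<longrightarrow> x = 0\<^sub>v ?l)"
    using distinct_lin_indpt_cols_iff[OF A] cols_mat_of_cols[OF ws] by simp
  also have "\<dots> \<longleftrightarrow> indep {..<?l} {..<n} (\<lambda>i j. ws ! i $ j)"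
  proof
    assume L: "\<forall>x\<in>carrier_vec ?l. ?A *\<^sub>v x = 0\<^sub>v n \<longrightarrow> x = 0\<^sub>v ?l"
    show "indep {..<?l} {..<n} (\<lambda>i j. ws ! i $ j)"
    proof (rule indepI)
      fix c i assume c: "\<And>j. j \<in> {..<n} \<Longrightarrow> (\<Sum>i<?l. c i * ws ! i $ j) = 0" and i: "i \<in> {..<?l}"
      have "?A *\<^sub>v vec ?l c = 0\<^sub>v n"
        using c by (intro eq_vecI) (simp_all add: mv del: index_mult_mat_vec)
      with L have "vec ?l c = 0\<^sub>v ?l" by simp
      then have "vec ?l c $ i = 0\<^sub>v ?l $ i" by simp
      then show "c i = 0" using i by simp
    qed
  next
    assume R: "indep {..<?l} {..<n} (\<lambda>i j. ws ! i $ j)"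
    show "\<forall>x\<in>carrier_vec ?l. ?A *\<^sub>v x = 0\<^sub>v n \<longrightarrow> x = 0\<^sub>v ?l"
    proof (intro ballI impI)
      fix x assume x: "x \<in> carrier_vec ?l" "?A *\<^sub>v x = 0\<^sub>v n"
      have "(\<Sum>i<?l. x $ i * ws ! i $ j) = 0" if "j \<in> {..<n}" for j
        using mv[OF x(1), of j] x(2) that by simp
      from indepD[OF R this] show "x = 0\<^sub>v ?l" using x(1) by (intro eq_vecI) auto
    qed
  qed
  finally show ?thesis .
qed

lemma in_list_span_iff:
  assumes ws: "set ws \<subseteq> carrier_vec n"
  shows "v \<in> span (set ws) \<longleftrightarrow> v \<in> carrier_vec n \<and> (\<exists>c. \<forall>j<n. v $ j = (\<Sum>i<length ws. c i * ws ! i $ j))"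
proof -
  let ?A = "mat_of_cols n ws" and ?l = "length ws"
  have A: "?A \<in> carrier_mat n ?l" by simp
  have mv: "(?A *\<^sub>v x) $ j = (\<Sum>i<?l. x $ i * ws ! i $ j)" if "x \<in> carrier_vec ?l" "j < n" for x j
    using that by (simp add: scalar_prod_def atLeast0LessThan mat_of_cols_index mult.commute)
  have "span (set ws) = {y \<in> carrier_vec n. \<exists>x\<in>carrier_vec ?l. ?A *\<^sub>v x = y}"
    using span_cols_eq[OF A] cols_mat_of_cols[OF ws] by simp
  moreover have "(\<exists>x\<in>carrier_vec ?l. ?A *\<^sub>v x = v) \<longleftrightarrow> (\<exists>c. \<forall>j<n. v $ j = (\<Sum>i<?l. c i * ws ! i $ j))"
    if v: "v \<in> carrier_vec n"
  proof
    assume "\<exists>x\<in>carrier_vec ?l. ?A *\<^sub>v x = v"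
    then show "\<exists>c. \<forall>j<n. v $ j = (\<Sum>i<?l. c i * ws ! i $ j)" using mv by metis
  next
    assume "\<exists>c. \<forall>j<n. v $ j = (\<Sum>i<?l. c i * ws ! i $ j)"
    then obtain c where c: "\<forall>j<n. v $ j = (\<Sum>i<?l. c i * ws ! i $ j)" by blast
    have "?A *\<^sub>v vec ?l c = v"
      using c v by (intro eq_vecI) (simp_all add: mv del: index_mult_mat_vec)
    then show "\<exists>x\<in>carrier_vec ?l. ?A *\<^sub>v x = v" by (intro bexI[of _ "vec ?l c"]) auto
  qed
  ultimately show ?thesis by auto
qed

end

section \<open>Degree sums of minimal bases\<close>

lemma fract_indep_nonzero:
  assumes "finite I" "fract_indep I q P" "i \<in> I"
  shows "\<exists>j<q. P i j \<noteq> 0"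
proof (rule ccontr)
  assume "\<not> ?thesis"
  then have "(\<Sum>k\<in>I. (if k = i then 1 else 0) * to_fract (P k j)) = 0" if "j \<in> {..<q}" for j
    using that assms(1) by (intro sum.neutral) auto
  from indepD[OF assms(2)[unfolded fract_indep_def] this assms(3)] show False by simp
qed

lemma fract_indep_subset: "finite I \<Longrightarrow> I' \<subseteq> I \<Longrightarrow> fract_indep I q P \<Longrightarrow> fract_indep I' q P"
  unfolding fract_indep_def by (rule indep_subset)

text \<open>Injectivity at \<open>k\<close> forces \<open>e i \<ge> k\<close> for every member. The
  members with \<open>e i = k\<close> lie in the kernel of S_(k+1), so there are at most
  \<open>n * Suc k - m * d\<close> of them; the others contribute at least \<open>Suc k\<close>
  each.\<close>

lemma kernel_degree_sum:
  fixes M :: "'a::field poly mat"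
  assumes M: "M \<in> poly_mats m (m + n) d" and q: "m + n > 0"
    and s: "syl_surj d M (Suc k)" and inj: "syl_inj M k"
    and P: "fract_indep {..<n} (m + n) P"
    and ker: "\<And>i r. i < n \<Longrightarrow> r < m \<Longrightarrow> pmul M (P i) r = 0"
    and deg: "\<And>i j l. i < n \<Longrightarrow> j < m + n \<Longrightarrow> e i < l \<Longrightarrow> coeff (P i j) l = 0"
  shows "m * d \<le> (\<Sum>i<n. e i)"
proof -
  define Low where "Low = {i \<in> {..<n}. e i < Suc k}"
  have "card Low + (Suc k + d) * m \<le> Suc k * (m + n)"
  proof (rule sylvester_kernel_card[OF M q s])
    show *: "P i \<in> poly_vecs (m + n) (Suc k)" if "i \<in> Low" for i
      using that deg by (auto simp: Low_def poly_vecs_def)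
    show "indep Low {..<Suc k * (m + n)} (\<lambda>i c. stack (m + n) (Suc k) (P i) $ c)"
      by (rule fract_indep_imp_stack[OF _ * fract_indep_subset[OF _ _ P]]) (auto simp: Low_def)
  qed (use ker in \<open>auto simp: Low_def\<close>)
  then have low: "card Low + d * m \<le> n * Suc k" by (simp add: algebra_simps)
  have "Suc k \<le> e i + (if i \<in> Low then 1 else 0)" if i: "i < n" for i
  proof -
    have "k \<le> e i"
    proof (rule ccontr)
      assume "\<not> k \<le> e i"
      then have "P i \<in> poly_vecs (m + n) k" using deg[OF i] by (auto simp: poly_vecs_def)
      then have "\<forall>j<m + n. P i j = 0" using inj ker[OF i] poly_mats_carrier[OF M] by (auto simp: syl_inj_def)
      then show False using fract_indep_nonzero[OF _ P, of i] i by auto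
    qed
    then show ?thesis using i by (auto simp: Low_def)
  qed
  then have "(\<Sum>i<n. Suc k) \<le> (\<Sum>i<n. e i + (if i \<in> Low then 1 else 0))" by (intro sum_mono) simp
  also have "\<dots> = (\<Sum>i<n. e i) + card Low"
    unfolding sum.distrib by (simp add: Low_def sum.If_cases Int_def)
  finally show ?thesis using low by (simp add: mult.commute)
qed

text \<open>With a smaller degree sum, more than \<open>k * n - m * d\<close> independent vectors of
  degree below \<open>k\<close> would be annihilated by \<open>L\<close>. By \<open>ker\<close> all
  of them lie in the kernel of S_k(M), whose dimension is at most that number.\<close>

lemma row_degree_sum:
  fixes M :: "'a::field poly mat"
  assumes M: "M \<in> poly_mats m (m + n) d" and q: "m + n > 0"
    and s: "syl_surj d M k" and k: "m * d \<le> n * k"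
    and deg: "\<And>i j l. i < m \<Longrightarrow> j < m + n \<Longrightarrow> e i < l \<Longrightarrow> coeff (L i j) l = 0"
    and ker: "\<And>v r. (\<And>i. i < m \<Longrightarrow> (\<Sum>j<m + n. L i j * v j) = 0) \<Longrightarrow> r < m \<Longrightarrow> pmul M v r = 0"
  shows "m * d \<le> (\<Sum>i<m. e i)"
proof (rule ccontr)
  assume "\<not> ?thesis"
  then have lt: "(\<Sum>i<m. e i) < m * d" by simp
  define s' where "s' = k * (m + n) - (\<Sum>i<m. k + e i)"
  have "\<exists>B. (\<forall>b<s'. B b \<in> poly_vecs (m + n) k \<and> (\<forall>i<m. (\<Sum>j<m + n. L i j * B b j) = 0)) \<and>
      indep {..<s'} {..<k * (m + n)} (\<lambda>b c. stack (m + n) k (B b) $ c)"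
    unfolding s'_def by (rule poly_kernel_exists[where L = L and e = e, OF q deg])
  then obtain B where B0: "\<forall>b<s'. B b \<in> poly_vecs (m + n) k \<and> (\<forall>i<m. (\<Sum>j<m + n. L i j * B b j) = 0)"
    and Bs: "indep {..<s'} {..<k * (m + n)} (\<lambda>b c. stack (m + n) k (B b) $ c)"
    by (elim exE conjE)
  note B = B0[rule_format, THEN conjunct1] B0[rule_format, THEN conjunct2, rule_format] Bs
  have "card {..<s'} + (k + d) * m \<le> k * (m + n)"
    by (rule sylvester_kernel_card[OF M q s _ _ _ B(3)]) (use B(1,2) ker in auto)
  then have "s' + d * m \<le> k * n" by (simp add: algebra_simps)
  moreover have "s' = k * n - (\<Sum>i<m. e i)" by (simp add: s'_def sum.distrib algebra_simps)
  ultimately show False using lt k by (simp add: mult.commute)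
qed

lemma kernel_span_zero:
  fixes M :: "'a::field poly mat"
  assumes M: "M \<in> carrier_mat m q" and r: "r < m"
    and ker: "\<And>i. i \<in> I \<Longrightarrow> pmul M (P i) r = 0"
    and v: "\<And>j. j < q \<Longrightarrow> v j = (\<Sum>i\<in>I. c i * to_fract (P i j))"
  shows "(\<Sum>j<q. v j * to_fract (M $$ (r, j))) = 0"
proof -
  have "(\<Sum>j<q. v j * to_fract (M $$ (r, j))) = (\<Sum>j<q. \<Sum>i\<in>I. c i * (to_fract (M $$ (r, j)) * to_fract (P i j)))"
    using v by (intro sum.cong) (simp_all add: sum_distrib_left sum_distrib_right mult_ac)
  also have "\<dots> = (\<Sum>i\<in>I. c i * (\<Sum>j<q. to_fract (M $$ (r, j)) * to_fract (P i j)))"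
    by (subst sum.swap) (simp add: sum_distrib_left)
  also have "\<dots> = (\<Sum>i\<in>I. c i * to_fract (pmul M (P i) r))"
    using M by (simp add: pmul_def)
  finally show ?thesis using ker by simp
qed

lemma fract_kernel_iff:
  fixes M :: "'a::field poly mat"
  assumes M: "M \<in> carrier_mat m q"
  shows "(\<Sum>j<q. to_fract (v j) * to_fract (M $$ (r, j))) = 0 \<longleftrightarrow> pmul M v r = 0"
proof -
  have "(\<Sum>j<q. to_fract (v j) * to_fract (M $$ (r, j))) = to_fract (pmul M v r)"
    using M by (simp add: pmul_def mult.commute)
  then show ?thesis by (simp only: to_fract_eq_0_iff)
qed

text \<open>If fewer than \<open>n * Suc k - m * d\<close> members of the family had degree at most \<open>k\<close>, one of the others
  could be exchanged for a kernel vector of degree at most \<open>k\<close>.\<close>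
lemma minimal_kernel_degree_sum:
  fixes M :: "'a::field poly mat"
  assumes M: "M \<in> poly_mats m (m + n) d" and q: "m + n > 0"
    and s: "syl_surj d M (Suc k)" and inj: "syl_inj M k" and k: "m * d \<le> n * Suc k"
    and P: "fract_indep {..<n} (m + n) P"
    and ker: "\<And>i r. i < n \<Longrightarrow> r < m \<Longrightarrow> pmul M (P i) r = 0"
    and le: "\<And>i. i < n \<Longrightarrow> e i \<le> Suc k"
    and min: "\<And>Q f. fract_indep {..<n} (m + n) Q \<Longrightarrow>
        (\<And>i r. i < n \<Longrightarrow> r < m \<Longrightarrow> pmul M (Q i) r = 0) \<Longrightarrow>
        (\<And>i j l. i < n \<Longrightarrow> j < m + n \<Longrightarrow> f i < l \<Longrightarrow> coeff (Q i j) l = 0) \<Longrightarrow> (\<Sum>i<n. e i) \<le> (\<Sum>i<n. f i)"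
    and deg: "\<And>i j l. i < n \<Longrightarrow> j < m + n \<Longrightarrow> e i < l \<Longrightarrow> coeff (P i j) l = 0"
  shows "(\<Sum>i<n. e i) \<le> m * d"
proof -
  note Mc = poly_mats_carrier[OF M]
  define t where "t = n * Suc k - m * d"
  have t: "t = Suc k * (m + n) - (\<Sum>i<m. Suc k + d)"
    using k by (simp add: t_def algebra_simps)
  have degM: "coeff (M $$ (i, j)) l = 0" if "i < m" "j < m + n" "d < l" for i j l
    by (rule poly_mats_coeff[OF M that])
  have "\<exists>V. (\<forall>b<t. V b \<in> poly_vecs (m + n) (Suc k) \<and> (\<forall>i<m. (\<Sum>j<m + n. M $$ (i, j) * V b j) = 0)) \<and>
      indep {..<t} {..<Suc k * (m + n)} (\<lambda>b c. stack (m + n) (Suc k) (V b) $ c)"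
    unfolding t by (rule poly_kernel_exists[where e = "\<lambda>_. d" and L = "\<lambda>i j. M $$ (i, j)", OF q degM])
  then obtain V where V0: "\<forall>b<t. V b \<in> poly_vecs (m + n) (Suc k) \<and> (\<forall>i<m. (\<Sum>j<m + n. M $$ (i, j) * V b j) = 0)"
    and Vs: "indep {..<t} {..<Suc k * (m + n)} (\<lambda>b c. stack (m + n) (Suc k) (V b) $ c)"
    by (elim exE conjE)
  note V = V0[rule_format, THEN conjunct1] V0[rule_format, THEN conjunct2, rule_format] Vs
  have kerV: "pmul M (V b) i = 0" if "b < t" "i < m" for b i
    using V(2)[OF that] Mc by (simp add: pmul_def)
  \<comment> \<open>A relation among the coefficient vectors at degree \<open>k\<close> yields a
    kernel vector of degree below \<open>k\<close>, which is zero by \<open>inj\<close>. As the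
    \<open>V b\<close> are independent over the constants, the relation is trivial.\<close>
  have Vind: "fract_indep {..<t} (m + n) V"
  proof (rule fract_indep_leading[where e = "\<lambda>_. k"])
    show "coeff (V b j) l = 0" if "b \<in> {..<t}" "j < m + n" "k < l" for b j l
      using V(1)[of b] that by (auto simp: poly_vecs_def)
    show "indep {..<t} {..<m + n} (\<lambda>b j. coeff (V b j) k)"
    proof (rule indepI)
      fix c b assume c: "\<And>j. j \<in> {..<m + n} \<Longrightarrow> (\<Sum>b<t. c b * coeff (V b j) k) = 0" and b: "b \<in> {..<t}"
      define u where "u j = (\<Sum>b<t. [:c b:] * V b j)" for j
      have "u \<in> poly_vecs (m + n) k"
        unfolding poly_vecs_def
      proof (intro CollectI allI impI)
        fix j l assume j: "j < m + n" and l: "k \<le> l"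
        have "coeff (u j) l = (\<Sum>b<t. c b * coeff (V b j) l)" by (simp add: u_def coeff_sum)
        also have "\<dots> = 0"
        proof (cases "l = k")
          case False
          then show ?thesis using poly_vecsD[OF V(1) j, of _ l] l by (intro sum.neutral) auto
        qed (use c j in simp)
        finally show "coeff (u j) l = 0" .
      qed
      moreover have "pmul M u i = 0" if "i < m" for i
        unfolding u_def pmul_sum pmul_mult using kerV that by simp
      ultimately have u0: "\<forall>j<m + n. u j = 0" using inj Mc by (auto simp: syl_inj_def)
      have "\<forall>c. (\<forall>j<m + n. (\<Sum>i\<in>{..<t}. [:c i:] * V i j) = 0) \<longrightarrow> (\<forall>i\<in>{..<t}. c i = 0)"
        by (rule iffD1[OF indep_stack_iff[of "{..<t}" V "m + n" "Suc k"] V(3)]) (use V(1) in simp)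
      from mp[OF spec[OF this, of c] u0[unfolded u_def]] b show "c b = 0" by (rule bspec)
    qed
  qed simp
  define Low where "Low = {i \<in> {..<n}. e i < Suc k}"
  have "t \<le> card Low"
  proof (rule ccontr)
    assume less: "\<not> t \<le> card Low"
    have "\<exists>c. \<forall>j<m + n. to_fract (V b j) = (\<Sum>i<n. c i * to_fract (P i j))" if b: "b < t" for b
      by (rule fract_kernel_span[OF M s])
         (use P ker kerV[OF b] in \<open>simp_all add: fract_kernel_iff[OF Mc] fract_indep_def\<close>)
    then obtain C where C: "\<And>b j. b < t \<Longrightarrow> j < m + n \<Longrightarrow> to_fract (V b j) = (\<Sum>i<n. C b i * to_fract (P i j))"
      by metis
    \<comment> \<open>Otherwise the \<open>t\<close> independent vectors \<open>V b\<close> would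
      lie in the span of the fewer members in \<open>Low\<close>.\<close>
    have "\<exists>b<t. \<exists>i<n. i \<notin> Low \<and> C b i \<noteq> 0"
    proof (rule ccontr)
      assume none: "\<not> ?thesis"
      have "card {..<t} \<le> card Low"
      proof (rule span_card[OF _ _ Vind[unfolded fract_indep_def]])
        fix b assume b: "b \<in> {..<t}"
        have "to_fract (V b j) = (\<Sum>i\<in>Low. C b i * to_fract (P i j))" if "j < m + n" for j
          unfolding C[OF b[simplified] that] using none b
          by (intro sum.mono_neutral_right) (auto simp: Low_def)
        then show "\<exists>c. \<forall>j\<in>{..<m + n}. to_fract (V b j) = (\<Sum>i\<in>Low. c i * to_fract (P i j))" by auto
      qed (auto simp: Low_def)
      with less show False by simp
    qed
    then obtain b i0 where b: "b < t" and i0: "i0 < n" "i0 \<notin> Low" "C b i0 \<noteq> 0" by blast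
    define Q where "Q = P(i0 := V b)"
    \<comment> \<open>Outside \<open>Low\<close> the bound \<open>e i0\<close> is at least
      \<open>Suc k\<close>, so the exchange lowers the degree sum.\<close>
    define f where "f = e(i0 := k)"
    have "indep {..<n} {..<m + n} ((\<lambda>i j. to_fract (P i j))(i0 := (\<lambda>j. to_fract (V b j))))"
      by (rule indep_exchange[OF _ P[unfolded fract_indep_def], where c = "C b"]) (use i0 C[OF b] in auto)
    also have "(\<lambda>i j. to_fract (P i j))(i0 := (\<lambda>j. to_fract (V b j))) = (\<lambda>i j. to_fract (Q i j))"
      by (auto simp: Q_def fun_eq_iff)
    finally have "fract_indep {..<n} (m + n) Q" by (simp add: fract_indep_def)
    moreover have "pmul M (Q i) r = 0" if "i < n" "r < m" for i r
      using ker[OF that] kerV[OF b that(2)] by (simp add: Q_def)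
    moreover have "coeff (Q i j) l = 0" if "i < n" "j < m + n" "f i < l" for i j l
      using that deg poly_vecsD[OF V(1)[OF b], of j l] by (cases "i = i0") (auto simp: Q_def f_def)
    ultimately have "(\<Sum>i<n. e i) \<le> (\<Sum>i<n. f i)" by (rule min)
    moreover have "(\<Sum>i<n. f i) < (\<Sum>i<n. e i)"
      using i0 by (intro sum_strict_mono_ex1) (auto simp: f_def Low_def)
    ultimately show False by simp
  qed
  \<comment> \<open>Members of \<open>Low\<close> contribute at most \<open>k\<close>, the others at
    most \<open>Suc k\<close>.\<close>
  have "(\<Sum>i<n. e i) + card Low = (\<Sum>i<n. e i + (if i \<in> Low then 1 else 0))"
    unfolding sum.distrib by (simp add: Low_def sum.If_cases Int_def)
  also have "\<dots> \<le> (\<Sum>i<n. Suc k)" using le by (intro sum_mono) (auto simp: Low_def)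
  finally show ?thesis using \<open>t \<le> card Low\<close> k by (simp add: t_def algebra_simps)
qed

section \<open>Polynomial bases of rational subspaces\<close>

lemma map_vec_to_fract_inj: "inj (map_vec to_fract :: 'a::idom vec \<Rightarrow> 'a fract vec)"
proof (rule injI)
  fix v w :: "'a vec" assume e: "map_vec to_fract v = map_vec to_fract w"
  then have d: "dim_vec v = dim_vec w" by (metis index_map_vec(2))
  show "v = w"
  proof (rule eq_vecI)
    fix i assume i: "i < dim_vec w"
    have "map_vec to_fract v $ i = map_vec to_fract w $ i" using e by simp
    then show "v $ i = w $ i" using i d by simp
  qed (rule d)
qed

lemma basis_indep_iff:
  fixes bs :: "'a::field poly vec list"
  assumes bs: "set bs \<subseteq> carrier_vec q"
  shows "distinct bs \<and> rat_indpt q bs \<longleftrightarrow> fract_indep {..<length bs} q (\<lambda>i j. bs ! i $ j)"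
proof -
  interpret vec_space "TYPE('a poly fract)" q .
  let ?ws = "map (map_vec to_fract) bs"
  have ws: "set ?ws \<subseteq> carrier_vec q" using bs by auto
  have "distinct ?ws \<longleftrightarrow> distinct bs"
    using map_vec_to_fract_inj by (auto simp: distinct_map inj_on_def inj_def)
  moreover have "indep {..<length bs} {..<q} (\<lambda>i j. ?ws ! i $ j) \<longleftrightarrow> fract_indep {..<length bs} q (\<lambda>i j. bs ! i $ j)"
    unfolding fract_indep_def
  proof (rule indep_cong)
    fix i j assume ij: "i \<in> {..<length bs}" "j \<in> {..<q}"
    then have "bs ! i \<in> set bs" by simp
    then have "dim_vec (bs ! i) = q" using bs by auto
    then show "?ws ! i $ j = to_fract (bs ! i $ j)" using ij by simp
  qed
  ultimately show ?thesis using list_lin_indpt_iff[OF ws] by simp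
qed

lemma in_rat_span_iff:
  fixes bs :: "'a::field poly vec list"
  assumes bs: "set bs \<subseteq> carrier_vec q"
  shows "v \<in> rat_span q bs \<longleftrightarrow> v \<in> carrier_vec q \<and>
    (\<exists>c. \<forall>j<q. v $ j = (\<Sum>i<length bs. c i * to_fract (bs ! i $ j)))"
proof -
  interpret vec_space "TYPE('a poly fract)" q .
  let ?ws = "map (map_vec to_fract) bs"
  have ws: "set ?ws \<subseteq> carrier_vec q" using bs by auto
  have "?ws ! i $ j = to_fract (bs ! i $ j)" if "i < length bs" "j < q" for i j
  proof -
    have "dim_vec (bs ! i) = q" using bs nth_mem[OF that(1)] by auto
    then show ?thesis using that by simp
  qed
  then have "(\<Sum>i<length ?ws. c i * ?ws ! i $ j) = (\<Sum>i<length bs. c i * to_fract (bs ! i $ j))" if "j < q" for c j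
    using that by (intro sum.cong) auto
  then show ?thesis using in_list_span_iff[OF ws, of v] by simp
qed

lemma basis_member_in_span:
  fixes bs :: "'a::field poly vec list"
  assumes bs: "set bs \<subseteq> carrier_vec q" and i: "i < length bs"
  shows "map_vec to_fract (bs ! i) \<in> rat_span q bs"
proof -
  have d: "dim_vec (bs ! i) = q" using bs nth_mem[OF i] by auto
  have *: "(\<Sum>k<length bs. (if k = i then 1 else 0) * to_fract (bs ! k $ j)) = to_fract (bs ! i $ j)" for j
    using i by (simp add: if_distrib[of "\<lambda>x. x * _"] cong: if_cong)
  have "\<forall>j<q. map_vec to_fract (bs ! i) $ j = (\<Sum>k<length bs. (if k = i then 1 else 0) * to_fract (bs ! k $ j))"
    unfolding * using d by simp
  then have ex: "\<exists>c. \<forall>j<q. map_vec to_fract (bs ! i) $ j = (\<Sum>k<length bs. c k * to_fract (bs ! k $ j))"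
    by (rule exI[where x = "\<lambda>k. if k = i then 1 else 0"])
  have "map_vec to_fract (bs ! i) \<in> carrier_vec q" using d by (intro carrier_vecI) simp
  from iffD2[OF in_rat_span_iff[OF bs] conjI[OF this ex]] show ?thesis .
qed

lemma polynomial_basis_iff:
  "polynomial_basis q V bs \<longleftrightarrow> set bs \<subseteq> carrier_vec q \<and>
     fract_indep {..<length bs} q (\<lambda>i j. bs ! i $ j) \<and> rat_span q bs = V"
proof (cases "set bs \<subseteq> carrier_vec q")
  case True
  show ?thesis unfolding polynomial_basis_def using True basis_indep_iff[OF True] by blast
qed (simp add: polynomial_basis_def)

lemma same_span_coeffs:
  fixes bs cs :: "'a::field poly vec list"
  assumes bs: "set bs \<subseteq> carrier_vec q" and cs: "set cs \<subseteq> carrier_vec q"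
    and eq: "rat_span q bs = rat_span q cs" and i: "i < length bs"
  shows "\<exists>c. \<forall>j<q. to_fract (bs ! i $ j) = (\<Sum>k<length cs. c k * to_fract (cs ! k $ j))"
proof -
  have "dim_vec (bs ! i) = q" using bs nth_mem[OF i] by auto
  then show ?thesis
    using basis_member_in_span[OF bs i] unfolding eq in_rat_span_iff[OF cs] by auto
qed

lemma basis_length:
  fixes bs cs :: "'a::field poly vec list"
  assumes bs: "polynomial_basis q V bs" and cs: "polynomial_basis q V cs"
  shows "length bs = length cs"
proof -
  have "length bs \<le> length cs" if "polynomial_basis q V bs" "polynomial_basis q V cs" for bs cs :: "'a poly vec list"
  proof -
    have bs: "set bs \<subseteq> carrier_vec q" "fract_indep {..<length bs} q (\<lambda>i j. bs ! i $ j)"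
      and cs: "set cs \<subseteq> carrier_vec q" and eq: "rat_span q bs = rat_span q cs"
      using that unfolding polynomial_basis_iff by simp_all
    have "card {..<length bs} \<le> card {..<length cs}"
    proof (rule span_card[OF _ _ bs(2)[unfolded fract_indep_def]])
      fix i assume i: "i \<in> {..<length bs}"
      show "\<exists>c. \<forall>j\<in>{..<q}. to_fract (bs ! i $ j) = (\<Sum>k\<in>{..<length cs}. c k * to_fract (cs ! k $ j))"
        unfolding Ball_def lessThan_iff by (rule same_span_coeffs[OF bs(1) cs eq i[simplified]])
    qed simp_all
    then show ?thesis by simp
  qed
  from this[OF bs cs] this[OF cs bs] show ?thesis by simp
qed

lemma vec_degree_le_iff:
  assumes "v \<in> carrier_vec q" "q > 0"
  shows "vec_degree v \<le> e \<longleftrightarrow> (\<forall>j<q. degree (v $ j) \<le> e)"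
proof -
  have ne: "(\<lambda>j. degree (v $ j)) ` {..<q} \<noteq> {}" using assms(2) by auto
  show ?thesis
    unfolding vec_degree_def carrier_vecD[OF assms(1)] by (subst Max_le_iff[OF _ ne]) auto
qed

lemma coeff_vec_degree:
  assumes "v \<in> carrier_vec q" "j < q" "vec_degree v < l"
  shows "coeff (v $ j) l = 0"
  using assms vec_degree_le_iff[of v q "vec_degree v"] by (intro coeff_eq_0) (auto intro: le_less_trans)

lemma sum_vec_degree: "(\<Sum>b\<leftarrow>bs. vec_degree b) = (\<Sum>i<length bs. vec_degree (bs ! i))"
  by (simp add: sum_list_sum_nth atLeast0LessThan)

lemma rows_props:
  assumes "P \<in> carrier_mat p q"
  shows "set (rows P) \<subseteq> carrier_vec q" "length (rows P) = p"
    "i < p \<Longrightarrow> j < q \<Longrightarrow> rows P ! i $ j = P $$ (i, j)" "i < p \<Longrightarrow> rows P ! i = row P i"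
  using assms by (auto simp: rows_def)

lemma fract_indep_rows:
  assumes "P \<in> carrier_mat p q"
  shows "fract_indep {..<length (rows P)} q (\<lambda>i j. rows P ! i $ j) \<longleftrightarrow> fract_indep {..<p} q (\<lambda>i j. P $$ (i, j))"
  unfolding fract_indep_def rows_props(2)[OF assms] by (rule indep_cong) (use assms in auto)

text \<open>Competing bases have the same length, so only \<open>p\<close> vectors need comparison.
  Equality of spans enters as two inclusions: minimality of M uses that \<open>cs\<close> spans the
  rows, minimality of its dual that the rows span \<open>cs\<close>.\<close>

lemma minimal_basisI:
  fixes P :: "'a::field poly mat"
  assumes P: "P \<in> carrier_mat p q" and pq: "p < q" and ind: "fract_indep {..<p} q (\<lambda>i j. P $$ (i, j))"
    and min: "\<And>cs. set cs \<subseteq> carrier_vec q \<Longrightarrow> length cs = p \<Longrightarrow> fract_indep {..<p} q (\<lambda>i j. cs ! i $ j) \<Longrightarrow>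
      (\<And>i. i < p \<Longrightarrow> \<exists>c. \<forall>j<q. to_fract (P $$ (i, j)) = (\<Sum>k<p. c k * to_fract (cs ! k $ j))) \<Longrightarrow>
      (\<And>i. i < p \<Longrightarrow> \<exists>c. \<forall>j<q. to_fract (cs ! i $ j) = (\<Sum>k<p. c k * to_fract (P $$ (k, j)))) \<Longrightarrow>
      (\<Sum>i<p. vec_degree (row P i)) \<le> (\<Sum>i<p. vec_degree (cs ! i))"
  shows "minimal_basis P"
  unfolding minimal_basis_def minimal_basis_of_def
proof (intro conjI allI impI)
  note rp = rows_props[OF P]
  have dc: "dim_col P = q" "dim_row P = p" using P by auto
  show "dim_row P < dim_col P" using P pq by simp
  show pb: "polynomial_basis (dim_col P) (rat_span (dim_col P) (rows P)) (rows P)"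
    unfolding polynomial_basis_iff dc using rp(1) ind fract_indep_rows[OF P] by simp
  fix cs assume cs: "polynomial_basis (dim_col P) (rat_span (dim_col P) (rows P)) cs"
  have len: "length cs = p" using basis_length[OF cs pb] rp(2) by simp
  have c: "set cs \<subseteq> carrier_vec q" "fract_indep {..<p} q (\<lambda>i j. cs ! i $ j)" "rat_span q cs = rat_span q (rows P)"
    using cs len unfolding polynomial_basis_iff dc by auto
  have "(\<Sum>i<p. vec_degree (row P i)) \<le> (\<Sum>i<p. vec_degree (cs ! i))"
  proof (rule min[OF c(1) len c(2)])
    fix i assume i: "i < p"
    show "\<exists>c. \<forall>j<q. to_fract (P $$ (i, j)) = (\<Sum>k<p. c k * to_fract (cs ! k $ j))"
      using same_span_coeffs[OF rp(1) c(1) c(3)[symmetric], of i] i rp(2,3) len by auto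
    show "\<exists>c. \<forall>j<q. to_fract (cs ! i $ j) = (\<Sum>k<p. c k * to_fract (P $$ (k, j)))"
      using same_span_coeffs[OF c(1) rp(1) c(3), of i] i rp(2,3) len by auto
  qed
  then show "(\<Sum>b\<leftarrow>rows P. vec_degree b) \<le> (\<Sum>c\<leftarrow>cs. vec_degree c)"
    using len rp by (simp add: sum_vec_degree del: length_rows)
qed

section \<open>The perturbation theorem\<close>

text \<open>Solve M v = x^(k+d) e_r with v of degree at most k and compare top coefficients: M_d v_k
  = e_r. So M_d has a right inverse.\<close>

lemma leading_rows_indep:
  fixes M :: "'a::field poly mat"
  assumes M: "M \<in> poly_mats m q d" and s: "syl_surj d M (Suc k)"
  shows "indep {..<m} {..<q} (\<lambda>i j. coeff (M $$ (i, j)) d)"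
proof (rule indepI)
  fix y r assume y: "\<And>j. j \<in> {..<q} \<Longrightarrow> (\<Sum>i<m. y i * coeff (M $$ (i, j)) d) = 0" and r: "r \<in> {..<m}"
  have Mc: "dim_row M = m" "dim_col M = q" using poly_mats_carrier[OF M] by auto
  have "(\<lambda>i. monom (if i = r then 1 else 0) (k + d)) \<in> poly_vecs (dim_row M) (Suc k + d)"
    by (simp add: poly_vecs_def)
  from bspec[OF s[unfolded syl_surj_def] this]
  obtain v where v: "v \<in> poly_vecs q (Suc k)" "\<And>i. i < m \<Longrightarrow> pmul M v i = monom (if i = r then 1 else 0) (k + d)"
    using Mc by auto
  have top: "(\<Sum>j<q. coeff (v j) k * coeff (M $$ (i, j)) d) = (if i = r then 1 else 0)" if i: "i < m" for i
  proof -
    have "coeff (v j * M $$ (i, j)) (k + d) = coeff (v j) k * coeff (M $$ (i, j)) d" if j: "j < q" for j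
    proof -
      have "degree (v j) \<le> k" using poly_vecsD[OF v(1) j] by (intro degree_le) auto
      then show ?thesis
        using coeff_mult_top[of d "M $$ (i, j)" "v j" "k + d"] poly_mats_coeff[OF M i j] by simp
    qed
    then have "(\<Sum>j<q. coeff (v j) k * coeff (M $$ (i, j)) d) = coeff (pmul M v i) (k + d)"
      by (simp add: pmul_def coeff_sum Mc mult.commute)
    then show ?thesis using v(2)[OF i] by simp
  qed
  have "y r = (\<Sum>i<m. y i * (\<Sum>j<q. coeff (v j) k * coeff (M $$ (i, j)) d))"
    using r by (simp add: top if_distrib cong: if_cong)
  also have "\<dots> = (\<Sum>i<m. \<Sum>j<q. coeff (v j) k * (y i * coeff (M $$ (i, j)) d))"
    by (simp add: sum_distrib_left mult_ac)
  also have "\<dots> = (\<Sum>j<q. coeff (v j) k * (\<Sum>i<m. y i * coeff (M $$ (i, j)) d))"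
    by (subst sum.swap) (simp add: sum_distrib_left)
  also have "\<dots> = 0" using y by simp
  finally show "y r = 0" .
qed

text \<open>The row degrees of M add up to at most \<open>m * d\<close>. Any competitor spans the
  rows of M, so its kernel lies in that of M, and \<open>row_degree_sum\<close> bounds its degree
  sum from below by \<open>m * d\<close>.\<close>

lemma minimal_basis_of_surj:
  fixes M :: "'a::field poly mat"
  assumes M: "M \<in> poly_mats m (m + n) d" and n: "n > 0"
    and s: "syl_surj d M (Suc k)" and k: "m * d \<le> n * Suc k"
  shows "minimal_basis M"
proof (rule minimal_basisI)
  note Mc = poly_mats_carrier[OF M]
  show "M \<in> carrier_mat m (m + n)" by (rule Mc)
  show "m < m + n" using n by simp
  show "fract_indep {..<m} (m + n) (\<lambda>i j. M $$ (i, j))"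
    by (rule fract_indep_leading[where e = "\<lambda>_. d"])
       (use poly_mats_coeff[OF M] leading_rows_indep[OF M s] in auto)
  fix cs :: "'a poly vec list"
  assume cs: "set cs \<subseteq> carrier_vec (m + n)" "length cs = m"
    and sp: "\<And>i. i < m \<Longrightarrow> \<exists>c. \<forall>j<m + n. to_fract (M $$ (i, j)) = (\<Sum>k<m. c k * to_fract (cs ! k $ j))"
  have carr: "cs ! i \<in> carrier_vec (m + n)" if "i < m" for i using cs that nth_mem[of i cs] by auto
  have "(\<Sum>i<m. vec_degree (row M i)) \<le> (\<Sum>i<m. d)"
  proof (rule sum_mono)
    fix i assume "i \<in> {..<m}"
    then show "vec_degree (row M i) \<le> d"
      using vec_degree_le_iff[of "row M i" "m + n" d] M Mc n by (auto simp: poly_mats_def)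
  qed
  also have "\<dots> = m * d" by simp
  also have "\<dots> \<le> (\<Sum>i<m. vec_degree (cs ! i))"
  proof (rule row_degree_sum[OF M _ s k, where L = "\<lambda>i j. cs ! i $ j"])
    show "coeff (cs ! i $ j) l = 0" if "i < m" "j < m + n" "vec_degree (cs ! i) < l" for i j l
      using coeff_vec_degree[OF carr] that by blast
    fix v r assume v: "\<And>i. i < m \<Longrightarrow> (\<Sum>j<m + n. cs ! i $ j * v j) = 0" and r: "r < m"
    obtain c where c: "\<And>j. j < m + n \<Longrightarrow> to_fract (M $$ (r, j)) = (\<Sum>k<m. c k * to_fract (cs ! k $ j))"
      using sp[OF r] by blast
    have "to_fract (pmul M v r) = (\<Sum>j<m + n. to_fract (M $$ (r, j)) * to_fract (v j))"
      using Mc by (simp add: pmul_def)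
    also have "\<dots> = (\<Sum>j<m + n. \<Sum>k<m. c k * to_fract (cs ! k $ j * v j))"
      using c by (intro sum.cong) (auto simp: sum_distrib_right mult.assoc)
    also have "\<dots> = (\<Sum>k<m. c k * to_fract (\<Sum>j<m + n. cs ! k $ j * v j))"
      by (subst sum.swap) (simp add: sum_distrib_left)
    also have "\<dots> = 0"
      by (intro sum.neutral ballI) (simp only: v lessThan_iff to_fract_0 mult_zero_right)
    finally show "pmul M v r = 0" by (simp only: to_fract_eq_0_iff)
  qed (use n in simp)
  finally show "(\<Sum>i<m. vec_degree (row M i)) \<le> (\<Sum>i<m. vec_degree (cs ! i))" .
qed

text \<open>A competitor lies in the span of the rows of N and is therefore annihilated by M, so
  \<open>kernel_degree_sum\<close> applies to it.\<close>

lemma minimal_basis_dual: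
  fixes M N :: "'a::field poly mat"
  assumes M: "M \<in> poly_mats m (m + n) d" and m: "m > 0"
    and s: "syl_surj d M (Suc k)" and inj: "syl_inj M k"
    and N: "N \<in> carrier_mat n (m + n)" and ind: "fract_indep {..<n} (m + n) (\<lambda>i j. N $$ (i, j))"
    and ker: "\<And>i r. i < n \<Longrightarrow> r < m \<Longrightarrow> pmul M (\<lambda>j. N $$ (i, j)) r = 0"
    and deg: "(\<Sum>i<n. vec_degree (row N i)) \<le> m * d"
  shows "minimal_basis N"
proof (rule minimal_basisI[OF N _ ind])
  note Mc = poly_mats_carrier[OF M]
  show "n < m + n" using m by simp
  fix cs :: "'a poly vec list"
  assume cs: "set cs \<subseteq> carrier_vec (m + n)" "length cs = n"
    and ci: "fract_indep {..<n} (m + n) (\<lambda>i j. cs ! i $ j)"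
    and sp: "\<And>i. i < n \<Longrightarrow> \<exists>c. \<forall>j<m + n. to_fract (cs ! i $ j) = (\<Sum>k<n. c k * to_fract (N $$ (k, j)))"
  have carr: "cs ! i \<in> carrier_vec (m + n)" if "i < n" for i using cs that nth_mem[of i cs] by auto
  have "m * d \<le> (\<Sum>i<n. vec_degree (cs ! i))"
  proof (rule kernel_degree_sum[OF M _ s inj ci])
    show "coeff (cs ! i $ j) l = 0" if "i < n" "j < m + n" "vec_degree (cs ! i) < l" for i j l
      using coeff_vec_degree[OF carr] that by blast
    fix i r assume i: "i < n" and r: "r < m"
    obtain c where c: "\<And>j. j < m + n \<Longrightarrow> to_fract (cs ! i $ j) = (\<Sum>k<n. c k * to_fract (N $$ (k, j)))"
      using sp[OF i] by blast
    have "(\<Sum>j<m + n. to_fract (cs ! i $ j) * to_fract (M $$ (r, j))) = 0"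
      by (rule kernel_span_zero[OF Mc r _ c]) (use ker r in auto)
    then show "pmul M (\<lambda>j. cs ! i $ j) r = 0" by (simp only: fract_kernel_iff[OF Mc])
  qed (use m in simp)
  with deg show "(\<Sum>i<n. vec_degree (row N i)) \<le> (\<Sum>i<n. vec_degree (cs ! i))" by simp
qed

text \<open>The span does not depend on the family: any \<open>n\<close> independent polynomial
  kernel vectors are a basis of the whole rational null space and so compete with each other for the
  least degree sum.\<close>

lemma rat_span_kernel:
  fixes M :: "'a::field poly mat"
  assumes M: "M \<in> poly_mats m (m + n) d" and s: "syl_surj d M (Suc k)"
    and bs: "set bs \<subseteq> carrier_vec (m + n)" "length bs = n" "fract_indep {..<n} (m + n) (\<lambda>i j. bs ! i $ j)"
    and ker: "\<And>i r. i < n \<Longrightarrow> r < m \<Longrightarrow> pmul M (\<lambda>j. bs ! i $ j) r = 0"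
  shows "rat_span (m + n) bs =
    {v \<in> carrier_vec (m + n). \<forall>r<m. (\<Sum>j<m + n. v $ j * to_fract (M $$ (r, j))) = 0}" (is "_ = ?K")
proof -
  note Mc = poly_mats_carrier[OF M]
  have "v \<in> rat_span (m + n) bs \<longleftrightarrow> v \<in> ?K" for v
  proof
    assume "v \<in> rat_span (m + n) bs"
    then obtain c where v: "v \<in> carrier_vec (m + n)"
      and c: "\<And>j. j < m + n \<Longrightarrow> v $ j = (\<Sum>i<n. c i * to_fract (bs ! i $ j))"
      unfolding in_rat_span_iff[OF bs(1)] bs(2) by blast
    have "(\<Sum>j<m + n. v $ j * to_fract (M $$ (r, j))) = 0" if r: "r < m" for r
      by (rule kernel_span_zero[OF Mc r _ c]) (use ker r in auto)
    with v show "v \<in> ?K" by simp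
  next
    assume "v \<in> ?K"
    then have v: "v \<in> carrier_vec (m + n)"
      and k: "\<And>r. r < m \<Longrightarrow> (\<Sum>j<m + n. v $ j * to_fract (M $$ (r, j))) = 0" by auto
    have "\<exists>c. \<forall>j<m + n. v $ j = (\<Sum>i<n. c i * to_fract (bs ! i $ j))"
      by (rule fract_kernel_span[OF M s _ bs(3)[unfolded fract_indep_def] _ k])
         (simp_all add: fract_kernel_iff[OF Mc] ker)
    with v show "v \<in> rat_span (m + n) bs" unfolding in_rat_span_iff[OF bs(1)] bs(2) by (rule conjI)
  qed
  then show ?thesis by blast
qed

text \<open>Any independent kernel family \<open>Q\<close> is a polynomial basis of the row space of
  N, since both span the null space of M. Minimality of N thus supplies the hypothesis
  \<open>min\<close> of \<open>minimal_kernel_degree_sum\<close>.\<close>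

lemma dual_row_degree_sum:
  fixes M N :: "'a::field poly mat"
  assumes M: "M \<in> poly_mats m (m + n) d" and m: "m > 0"
    and s: "syl_surj d M (Suc k)" and inj: "syl_inj M k" and k: "m * d \<le> n * Suc k"
    and N: "N \<in> carrier_mat n (m + n)" and minN: "minimal_basis N"
    and ker: "\<And>i r. i < n \<Longrightarrow> r < m \<Longrightarrow> pmul M (\<lambda>j. N $$ (i, j)) r = 0"
    and le: "\<And>i. i < n \<Longrightarrow> vec_degree (row N i) \<le> Suc k"
  shows "(\<Sum>i<n. vec_degree (row N i)) \<le> m * d"
proof -
  note rp = rows_props[OF N]
  have q: "m + n > 0" using m by simp
  have ind: "fract_indep {..<n} (m + n) (\<lambda>i j. N $$ (i, j))"
    using minN N fract_indep_rows[OF N] by (auto simp: minimal_basis_def minimal_basis_of_def polynomial_basis_iff)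
  have rN: "rows N ! i $ j = N $$ (i, j)" if "i < n" "j < m + n" for i j using rp(3)[OF that] .
  have spanN: "rat_span (m + n) (rows N) =
      {v \<in> carrier_vec (m + n). \<forall>r<m. (\<Sum>j<m + n. v $ j * to_fract (M $$ (r, j))) = 0}"
  proof (rule rat_span_kernel[OF M s rp(1,2)])
    show "fract_indep {..<n} (m + n) (\<lambda>i j. rows N ! i $ j)"
      using ind fract_indep_rows[OF N] unfolding rp(2) by simp
    show "pmul M (\<lambda>j. rows N ! i $ j) r = 0" if "i < n" "r < m" for i r
    proof -
      have "pmul M (\<lambda>j. rows N ! i $ j) r = pmul M (\<lambda>j. N $$ (i, j)) r"
        unfolding pmul_def using rN[OF that(1)] poly_mats_carrier[OF M] by (intro sum.cong) auto
      then show ?thesis using ker[OF that] by simp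
    qed
  qed
  show ?thesis
  proof (rule minimal_kernel_degree_sum[OF M q s inj k ind ker le])
    show "coeff (N $$ (i, j)) l = 0" if "i < n" "j < m + n" "vec_degree (row N i) < l" for i j l
      using coeff_vec_degree[of "row N i" "m + n" j l] that N by auto
    fix Q :: "nat \<Rightarrow> nat \<Rightarrow> 'a poly" and f
    assume Q: "fract_indep {..<n} (m + n) Q" "\<And>i r. i < n \<Longrightarrow> r < m \<Longrightarrow> pmul M (Q i) r = 0"
      "\<And>i j l. i < n \<Longrightarrow> j < m + n \<Longrightarrow> f i < l \<Longrightarrow> coeff (Q i j) l = 0"
    define cs where "cs = map (\<lambda>i. vec (m + n) (Q i)) [0..<n]"
    have cs: "set cs \<subseteq> carrier_vec (m + n)" "length cs = n" by (auto simp: cs_def)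
    have csn: "cs ! i = vec (m + n) (Q i)" if "i < n" for i using that by (simp add: cs_def)
    have ci: "fract_indep {..<n} (m + n) (\<lambda>i j. cs ! i $ j)"
      using Q(1) unfolding fract_indep_def by (subst indep_cong[of _ _ _ "\<lambda>i j. to_fract (Q i j)"]) (simp_all add: csn)
    have "rat_span (m + n) cs = rat_span (m + n) (rows N)"
      unfolding spanN
    proof (rule rat_span_kernel[OF M s cs ci])
      fix i r assume i: "i < n" and r: "r < m"
      have "pmul M (\<lambda>j. cs ! i $ j) r = pmul M (Q i) r"
        unfolding pmul_def using csn[OF i] poly_mats_carrier[OF M] by (intro sum.cong) auto
      then show "pmul M (\<lambda>j. cs ! i $ j) r = 0" using Q(2)[OF i r] by simp
    qed
    then have "polynomial_basis (m + n) (rat_span (m + n) (rows N)) cs"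
      unfolding polynomial_basis_iff using cs ci by simp
    then have "(\<Sum>b\<leftarrow>rows N. vec_degree b) \<le> (\<Sum>c\<leftarrow>cs. vec_degree c)"
      using minN N by (auto simp: minimal_basis_def minimal_basis_of_def)
    then have "(\<Sum>i<n. vec_degree (row N i)) \<le> (\<Sum>i<n. vec_degree (cs ! i))"
      using rp(2,4) cs(2) by (simp add: sum_vec_degree)
    also have "\<dots> \<le> (\<Sum>i<n. f i)"
    proof (rule sum_mono)
      fix i assume "i \<in> {..<n}"
      then have i: "i < n" by simp
      have "degree (Q i j) \<le> f i" if "j < m + n" for j
        using Q(3)[OF i that] by (intro degree_le) blast
      then show "vec_degree (cs ! i) \<le> f i"
        unfolding csn[OF i] using vec_degree_le_iff[of "vec (m + n) (Q i)" "m + n" "f i"] q by simp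
    qed
    finally show "(\<Sum>i<n. vec_degree (row N i)) \<le> (\<Sum>i<n. f i)" .
  qed
qed

section \<open>Perturbed leading coefficients, Frobenius norms and the constants\<close>

lemma \<sigma>_nonneg:
  fixes A :: "'a::real_or_complex mat"
  assumes A: "A \<in> carrier_mat r c" and i: "1 \<le> i" "i \<le> min r c"
  shows "0 \<le> \<sigma> i A"
proof -
  let ?C = "to_complex_mat A"
  have C: "?C \<in> carrier_mat r c" using A by simp
  have "mat_adjoint ?C * ?C \<in> carrier_mat c c" using C by auto
  note l = sqnorms_complex(1)[OF this]
  have less: "i - Suc 0 < min r c" using i by auto
  have "\<sigma> i ?C = sqnorms (mat_adjoint ?C * ?C) ! (i - 1)"
    using C less by (simp add: \<sigma>_def singular_values_eq)
  also have "\<dots> \<ge> 0" using l i by (intro sqnorms_nonneg[of _ "mat_adjoint ?C * ?C"] nth_mem) auto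
  finally show ?thesis unfolding \<sigma>_to_complex[of i A] .
qed

text \<open>If a row vector c satisfies c B = 0, then |c A| = |c (A - B)| \<le> \<eta> |c|, whereas
  |c A| \<ge> \<sigma>_n(A) |c|; so c = 0.\<close>

lemma indep_perturb:
  fixes A B :: "'a::real_or_complex mat"
  assumes A: "A \<in> carrier_mat n q" and nq: "n \<le> q" "n > 0"
    and \<eta>: "\<eta> \<ge> 0" "(\<Sum>i<n. \<Sum>j<q. (norm (A $$ (i, j) - B $$ (i, j)))\<^sup>2) \<le> \<eta>\<^sup>2" "\<eta> < \<sigma> n A"
  shows "indep {..<n} {..<q} (\<lambda>i j. B $$ (i, j))"
proof (rule indepI)
  fix c i assume c: "\<And>j. j \<in> {..<q} \<Longrightarrow> (\<Sum>i<n. c i * B $$ (i, j)) = 0" and i: "i \<in> {..<n}"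
  \<comment> \<open>The adjoint conjugates the entries of \<open>A\<close>; conjugating
    \<open>c\<close> too makes entry \<open>j\<close> of A^* y the conjugate of that of c A.\<close>
  define y where "y = vec n (\<lambda>i. conjugate (c i))"
  have y: "y \<in> carrier_vec n" by (simp add: y_def)
  have vy: "vnorm y = L2_set (\<lambda>i. norm (c i)) {..<n}"
    unfolding vnorm_def y_def by (intro L2_set_cong) auto
  have comp: "(norm ((mat_adjoint A *\<^sub>v y) $ j))\<^sup>2 \<le> (\<Sum>i<n. (norm (A $$ (i, j) - B $$ (i, j)))\<^sup>2) * (vnorm y)\<^sup>2"
    if j: "j < q" for j
  proof -
    have "(mat_adjoint A *\<^sub>v y) $ j = (\<Sum>i<n. conjugate (A $$ (i, j)) * conjugate (c i))"
      using A j by (auto simp: scalar_prod_def atLeast0LessThan index_mat_adjoint y_def intro!: sum.cong)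
    also have "\<dots> = conjugate (\<Sum>i<n. c i * A $$ (i, j))"
      by (simp add: sum_conjugate conjugate_dist_mul mult.commute)
    finally have "norm ((mat_adjoint A *\<^sub>v y) $ j) = norm ((\<Sum>i<n. c i * A $$ (i, j)) - (\<Sum>i<n. c i * B $$ (i, j)))"
      using c j by simp
    also have "\<dots> = norm (\<Sum>i<n. c i * (A $$ (i, j) - B $$ (i, j)))"
      by (simp add: right_diff_distrib sum_subtractf)
    also have "\<dots> \<le> (\<Sum>i<n. \<bar>norm (A $$ (i, j) - B $$ (i, j))\<bar> * \<bar>norm (c i)\<bar>)"
      by (rule order_trans[OF norm_sum]) (simp add: norm_mult mult.commute)
    also have "\<dots> \<le> L2_set (\<lambda>i. norm (A $$ (i, j) - B $$ (i, j))) {..<n} * vnorm y"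
      unfolding vy by (rule L2_set_mult_ineq)
    finally have "(norm ((mat_adjoint A *\<^sub>v y) $ j))\<^sup>2 \<le> (L2_set (\<lambda>i. norm (A $$ (i, j) - B $$ (i, j))) {..<n} * vnorm y)\<^sup>2"
      by (rule power_mono) simp
    also have "\<dots> = (\<Sum>i<n. (norm (A $$ (i, j) - B $$ (i, j)))\<^sup>2) * (vnorm y)\<^sup>2"
      by (simp add: power_mult_distrib L2_set_def sum_nonneg)
    finally show ?thesis .
  qed
  have "(vnorm (mat_adjoint A *\<^sub>v y))\<^sup>2 = (\<Sum>j<q. (norm ((mat_adjoint A *\<^sub>v y) $ j))\<^sup>2)"
    using A by (simp add: vnorm_sq del: index_mult_mat_vec)
  also have "\<dots> \<le> (\<Sum>j<q. (\<Sum>i<n. (norm (A $$ (i, j) - B $$ (i, j)))\<^sup>2) * (vnorm y)\<^sup>2)"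
    using comp by (intro sum_mono) simp
  also have "\<dots> = (\<Sum>i<n. \<Sum>j<q. (norm (A $$ (i, j) - B $$ (i, j)))\<^sup>2) * (vnorm y)\<^sup>2"
    by (subst sum.swap) (simp add: sum_distrib_right)
  also have "\<dots> \<le> \<eta>\<^sup>2 * (vnorm y)\<^sup>2" using \<eta>(2) by (intro mult_right_mono) auto
  finally have "(vnorm (mat_adjoint A *\<^sub>v y))\<^sup>2 \<le> (\<eta> * vnorm y)\<^sup>2" by (simp add: power_mult_distrib)
  then have "vnorm (mat_adjoint A *\<^sub>v y) \<le> \<eta> * vnorm y" by (rule power2_le_imp_le) (simp add: \<eta>(1))
  with \<sigma>_last_wide[OF A nq y] have "\<sigma> n A * vnorm y \<le> \<eta> * vnorm y" by linarith
  then have "vnorm y = 0" using \<eta>(3) vnorm_nonneg[of y] by (simp add: mult_le_cancel_right)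
  then have "c i = 0" using i unfolding vy by (simp add: L2_set_eq_0_iff)
  then show "c i = 0" .
qed

text \<open>The sum is grouped by the rows of \<open>P\<close>, so that estimates for single rows of
  N can be added.\<close>

lemma frobenius_sylvester:
  fixes P :: "'a::real_normed_field poly mat"
  assumes P: "P \<in> carrier_mat p q" and p: "p > 0"
  shows "(frobenius_norm (sylvester g 1 P))\<^sup>2 = (\<Sum>i<p. (pnorm q (Suc g) (\<lambda>j. P $$ (i, j)))\<^sup>2)"
proof -
  have "(frobenius_norm (sylvester g 1 P))\<^sup>2 =
      (\<Sum>r<Suc g * p. \<Sum>c<q. (norm (coeff (P $$ (r mod p, c)) (r div p)))\<^sup>2)"
  proof -
    have "r div p \<le> g" if "r < Suc g * p" for r
      using that less_mult_imp_div_less[of r "Suc g" p] by simp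
    then have "(frobenius_norm (sylvester g 1 P))\<^sup>2 =
        (\<Sum>i<dim_row (sylvester g 1 P). \<Sum>j<dim_col (sylvester g 1 P). (norm (sylvester g 1 P $$ (i, j)))\<^sup>2)"
      by (simp add: frobenius_norm_def sum_nonneg)
    also have "\<dots> = (\<Sum>r<Suc g * p. \<Sum>c<q. (norm (coeff (P $$ (r mod p, c)) (r div p)))\<^sup>2)"
      using P \<open>\<And>r. r < Suc g * p \<Longrightarrow> r div p \<le> g\<close> by (intro sum.cong) (auto simp: sylvester_def Let_def)
    finally show ?thesis .
  qed
  also have "\<dots> = (\<Sum>l<Suc g. \<Sum>i<p. \<Sum>c<q. (norm (coeff (P $$ (i, c)) l))\<^sup>2)"
    by (rule sum_div_mod[OF p])
  also have "\<dots> = (\<Sum>i<p. \<Sum>l<Suc g. \<Sum>c<q. (norm (coeff (P $$ (i, c)) l))\<^sup>2)"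
    by (rule sum.swap)
  finally show ?thesis by (simp only: pnorm_sq)
qed

lemma frobenius_norm_nonneg [simp]: "0 \<le> frobenius_norm A"
  by (simp add: frobenius_norm_def sum_nonneg)

lemma pnorm_extend:
  assumes "v \<in> poly_vecs q k" "k \<le> l"
  shows "pnorm q l v = pnorm q k v"
proof -
  have "(pnorm q l v)\<^sup>2 = (pnorm q k v)\<^sup>2"
    unfolding pnorm_sq using assms by (intro sum.mono_neutral_right) (auto simp: poly_vecs_def)
  then show ?thesis by (rule power2_eq_imp_eq) simp_all
qed

text \<open>At least half of \<theta> sqrt k remains after sqrt k * \<delta> is subtracted from the
  singular value. Then sqrt k cancels, and the half becomes the 2 in 2 / \<theta>.\<close>

lemma (in sylvester_perturbation) wide_project_theta:
  assumes k: "k > 0" and wide: "(k + d) * p \<le> k * q"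
    and \<theta>: "\<theta> \<le> \<sigma> ((k + d) * p) (sylvester d k M) / sqrt (real k)" and \<delta>\<theta>: "\<delta> < \<theta> / 2"
    and v: "v \<in> poly_vecs q k" "\<And>i. i < p \<Longrightarrow> pmul M v i = 0"
  shows "\<exists>v'\<in>poly_vecs q k. (\<forall>i<p. pmul M' v' i = 0) \<and>
    pnorm q k (\<lambda>j. v j - v' j) \<le> 2 / \<theta> * \<delta> * pnorm q k v"
proof -
  let ?s = "\<sigma> ((k + d) * p) (sylvester d k M)" and ?r = "sqrt (real k)"
  have r: "?r > 0" using k by simp
  have \<theta>0: "\<theta> > 0" using \<delta>_nonneg \<delta>\<theta> by simp
  have s: "\<theta> * ?r \<le> ?s" using \<theta> r by (simp add: field_simps)
  have \<delta>r: "?r * \<delta> < \<theta> * ?r / 2" using \<delta>\<theta> r by (simp add: field_simps)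
  have "?r * \<delta> < ?s" using s \<delta>r mult_pos_pos[OF \<theta>0 r] by linarith
  from wide_project[OF k wide this v] obtain v' where v': "v' \<in> poly_vecs q k" "\<forall>i<p. pmul M' v' i = 0"
    "(?s - ?r * \<delta>) * pnorm q k (\<lambda>j. v j - v' j) \<le> ?r * \<delta> * pnorm q k v" by blast
  have "\<theta> * ?r / 2 * pnorm q k (\<lambda>j. v j - v' j) \<le> (?s - ?r * \<delta>) * pnorm q k (\<lambda>j. v j - v' j)"
    using s \<delta>r by (intro mult_right_mono) simp_all
  also note v'(3)
  finally have "?r * (\<theta> * pnorm q k (\<lambda>j. v j - v' j)) \<le> ?r * (2 * \<delta> * pnorm q k v)" by (simp add: mult_ac)
  then have "\<theta> * pnorm q k (\<lambda>j. v j - v' j) \<le> 2 * \<delta> * pnorm q k v" using r by simp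
  then have "pnorm q k (\<lambda>j. v j - v' j) \<le> 2 / \<theta> * \<delta> * pnorm q k v" using \<theta>0 by (simp add: field_simps)
  with v'(1,2) show ?thesis by blast
qed

text \<open>These inequalities are all that the proof uses about \<open>theta1\<close> and
  \<open>theta2\<close>; they hide the case distinctions. For \<open>k = 1\<close> the explicit
  indices 1 and 2 are \<open>k\<close> and \<open>Suc k\<close>.\<close>

lemma theta_bounds:
  assumes "k > 0"
  shows "theta1 m n d k t M \<le> theta2 m n d k t M"
    and "theta1 m n d k t M \<le> \<sigma> ((k + d) * m) (sylvester d k M) / sqrt (real k)"
    and "theta2 m n d k t M \<le> \<sigma> ((Suc k + d) * m) (sylvester d (Suc k) M) / sqrt (real (Suc k))"
    and "t > 0 \<Longrightarrow> theta2 m n d k t M \<le> \<sigma> ((k + d) * m) (sylvester d k M) / sqrt (real k)"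
    and "t > 0 \<Longrightarrow> k > 1 \<Longrightarrow>
      theta1 m n d k t M \<le> \<sigma> ((k - 1) * (m + n)) (sylvester d (k - 1) M) / sqrt (real (k - 1))"
proof -
  have "k = 1 \<or> k > 1" using assms by auto
  moreover have "d + 1 = Suc d" "d + 2 = Suc (Suc d)" "Suc 1 = 2" by simp_all
  ultimately show "theta1 m n d k t M \<le> theta2 m n d k t M"
    and "theta1 m n d k t M \<le> \<sigma> ((k + d) * m) (sylvester d k M) / sqrt (real k)"
    and "theta2 m n d k t M \<le> \<sigma> ((Suc k + d) * m) (sylvester d (Suc k) M) / sqrt (real (Suc k))"
    and "t > 0 \<Longrightarrow> theta2 m n d k t M \<le> \<sigma> ((k + d) * m) (sylvester d k M) / sqrt (real k)"
    and "t > 0 \<Longrightarrow> k > 1 \<Longrightarrow>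
      theta1 m n d k t M \<le> \<sigma> ((k - 1) * (m + n)) (sylvester d (k - 1) M) / sqrt (real (k - 1))"
    by (auto simp: theta1_def theta2_def numeral_2_eq_2)
qed

theorem theorem7p1:
  fixes m n d k' t :: nat
    and M N M' :: "'a::real_or_complex poly mat"
  assumes "m > 0" and "n > 0" and "d > 0"
    and "M \<in> poly_mats m (m + n) d"
    and "full_sylvester_rank d M"
    and "k' = nat \<lceil>real (m * d) / real n\<rceil>"
    and "t = n * k' - m * d"
    and "N \<in> poly_mats n (m + n) k'"
    and "dual_minimal_bases M N"
    and "M' \<in> poly_mats m (m + n) d"
    and "spectral_norm (sylvester d 1 M - sylvester d 1 M') <
           1 / 2 * theta1 m n d k' t M *
           (\<sigma> n (highest_row_degree_coeff N) / frobenius_norm (sylvester k' 1 N))"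
  shows "full_sylvester_rank d M' \<and>
    (\<exists>N' \<in> poly_mats n (m + n) k'.
       dual_minimal_bases M' N' \<and>
       frobenius_norm (sylvester k' 1 N - sylvester k' 1 N') / frobenius_norm (sylvester k' 1 N)
         \<le> 2 / theta2 m n d k' t M * spectral_norm (sylvester d 1 M - sylvester d 1 M') \<and>
       (t = 0 \<longrightarrow> (\<forall>i<n. row_degree N' i = k' \<and> row_degree N i = k')))"
proof -
  note m = assms(1) and n = assms(2) and d = assms(3) and M = assms(4) and t = assms(7)
    and N = assms(8) and M' = assms(10)
  let ?q = "m + n"
  have q: "?q > 0" using m by simp
  interpret sylvester_perturbation M M' m ?q d
    using m M M' q by unfold_locales
  note Nc = poly_mats_carrier[OF N]

  have frac: "real (m * d) / real n > 0" using m n d by simp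
  then have k0: "k' > 0" using assms(6) by simp
  then obtain k where k: "k' = Suc k" by (cases k') auto
  have "real (m * d) / real n \<le> real k'"
    using real_nat_ceiling_ge[of "real (m * d) / real n"] assms(6) by simp
  then have "real (m * d) \<le> real (n * k')" using n by (simp add: field_simps)
  then have mdle: "m * d \<le> n * k'" by (simp only: of_nat_le_iff)
  have "real k < real (m * d) / real n"
  proof -
    have "int k' = \<lceil>real (m * d) / real n\<rceil>" using assms(6) k0 by simp
    then show ?thesis using k by linarith
  qed
  then have "real (n * k) < real (m * d)" using n by (simp add: field_simps)
  then have ndlt: "n * k < m * d" by (simp only: of_nat_less_iff)
  have wide: "(l + d) * m \<le> l * ?q" if "k' \<le> l" for l
  proof -
    have "m * d \<le> n * l" using mdle that by (meson le_trans mult_le_mono2)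
    then show ?thesis by (simp add: algebra_simps)
  qed

  have rank: "\<And>l. 1 \<le> l \<Longrightarrow> m * d \<le> n * l \<Longrightarrow> syl_surj d M l"
      "\<And>l. 1 \<le> l \<Longrightarrow> n * l \<le> m * d \<Longrightarrow> syl_inj M l"
    using assms(5) unfolding full_sylvester_rank_iff[OF M q] by blast+
  \<comment> \<open>For \<open>k' = 1\<close> the index \<open>k\<close> is 0, about which
    full-Sylvester-rank says nothing.\<close>
  have inj0: "syl_inj A 0" for A :: "'a poly mat"
    by (auto simp: syl_inj_def poly_vecs_def intro: poly_eqI)
  have surjM: "syl_surj d M (Suc k)" using rank(1)[of k'] mdle k by simp
  have injM: "syl_inj M k" using rank(2)[of k] ndlt inj0 by (cases k) auto
  \<comment> \<open>For \<open>t = 0\<close> the matrix S_k'(M) is square, hence injective as well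
    as surjective, and no row of N can have degree below \<open>k'\<close>.\<close>
  have t0: "m * d = n * k'" if "t = 0" using that t mdle by simp
  have injM0: "syl_inj M k'" if "t = 0" using rank(2)[of k'] t0[OF that] k0 by simp

  have minN: "minimal_basis N" and MN: "M * transpose_mat N = 0\<^sub>m m n"
    using assms(9) Mc Nc by (auto simp: dual_minimal_bases_def)
  have kerN: "pmul M (\<lambda>j. N $$ (i, j)) r = 0" if i: "i < n" and r: "r < m" for i r
  proof -
    have "(M * transpose_mat N) $$ (r, i) = pmul M (\<lambda>j. N $$ (i, j)) r"
      using Mc Nc i r by (simp add: pmul_def scalar_prod_def atLeast0LessThan)
    then show ?thesis using MN i r by simp
  qed
  have indN: "fract_indep {..<n} ?q (\<lambda>i j. N $$ (i, j))"
    using minN Nc fract_indep_rows[OF Nc] by (auto simp: minimal_basis_def minimal_basis_of_def polynomial_basis_iff)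
  define rd where "rd = row_degree N"
  have rd: "rd i = vec_degree (row N i)" for i by (simp add: rd_def row_degree_def)
  have rowN: "row N i \<in> carrier_vec ?q" if "i < n" for i using Nc that by auto
  have coefN: "coeff (N $$ (i, j)) l = 0" if "i < n" "j < ?q" "rd i < l" for i j l
    using coeff_vec_degree[OF rowN[OF that(1)] that(2), of l] that Nc by (simp add: rd)
  have Nvec: "(\<lambda>j. N $$ (i, j)) \<in> poly_vecs ?q l" if "i < n" "rd i < l" for i l
    using coefN that by (auto simp: poly_vecs_def)
  have rd_le: "rd i \<le> k'" if i: "i < n" for i
    using vec_degree_le_iff[OF rowN[OF i] q] N Nc i by (auto simp: rd poly_mats_def)
  \<comment> \<open>A row of degree below \<open>l\<close> would be a nonzero vector in the kernel
    of the injective S_l(M).\<close>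
  have not_low: "l \<le> rd i" if "i < n" "syl_inj M l" for i l
  proof (rule ccontr)
    assume "\<not> l \<le> rd i"
    then have "(\<lambda>j. N $$ (i, j)) \<in> poly_vecs ?q l" using Nvec[OF that(1)] by simp
    then have "\<forall>j<?q. N $$ (i, j) = 0" using that kerN Mc by (auto simp: syl_inj_def)
    then show False using fract_indep_nonzero[OF _ indN, of i] that(1) by auto
  qed
  have rd_ge: "k \<le> rd i" if "i < n" for i by (rule not_low[OF that injM])
  have rd0: "rd i = k'" if "i < n" "t = 0" for i
    using not_low[OF that(1) injM0[OF that(2)]] rd_le[OF that(1)] by simp
  have sum_rd: "(\<Sum>i<n. rd i) \<le> m * d"
    unfolding rd using dual_row_degree_sum[OF M m surjM injM _ Nc minN kerN] mdle rd_le by (simp add: k rd)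

  define F where "F = frobenius_norm (sylvester k' 1 N)"
  define \<theta>1 where "\<theta>1 = theta1 m n d k' t M"
  define \<theta>2 where "\<theta>2 = theta2 m n d k' t M"
  let ?H = "highest_row_degree_coeff N"
  have H: "?H \<in> carrier_mat n ?q" using Nc by (auto simp: highest_row_degree_coeff_def)
  have Hc: "?H $$ (i, j) = coeff (N $$ (i, j)) (rd i)" if "i < n" "j < ?q" for i j
    using that Nc by (simp add: highest_row_degree_coeff_def rd_def)
  define \<rho> where "\<rho> = \<sigma> n ?H"
  have \<rho>0: "\<rho> \<ge> 0" unfolding \<rho>_def using n by (intro \<sigma>_nonneg[OF H]) auto
  have F0: "F \<ge> 0" by (simp add: F_def)
  have hyp: "\<delta> < 1 / 2 * \<theta>1 * (\<rho> / F)"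
    using assms(11) by (simp add: \<delta>_def F_def \<rho>_def \<theta>1_def)

  have lead_le: "(\<Sum>j<?q. (norm (coeff (v j) l))\<^sup>2) \<le> (pnorm ?q (Suc k') v)\<^sup>2" if "l \<le> k'" for v :: "nat \<Rightarrow> 'a poly" and l
  proof -
    have "(\<Sum>s\<in>{l}. \<Sum>j<?q. (norm (coeff (v j) s))\<^sup>2) \<le> (\<Sum>s<Suc k'. \<Sum>j<?q. (norm (coeff (v j) s))\<^sup>2)"
      using that by (intro sum_mono2) (auto intro: sum_nonneg)
    then show ?thesis by (simp add: pnorm_sq)
  qed
  have F2: "F\<^sup>2 = (\<Sum>i<n. (pnorm ?q (Suc k') (\<lambda>j. N $$ (i, j)))\<^sup>2)"
    unfolding F_def by (rule frobenius_sylvester[OF Nc n])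
  text \<open>Otherwise the zero matrix would be a small perturbation of the leading coefficient matrix.\<close>
  have \<rho>F: "\<rho> \<le> F"
  proof (rule ccontr)
    assume "\<not> \<rho> \<le> F"
    have "indep {..<n} {..<?q} (\<lambda>i j. (0\<^sub>m n ?q :: 'a mat) $$ (i, j))"
    proof (rule indep_perturb[OF H _ n F0])
      have "(\<Sum>i<n. \<Sum>j<?q. (norm (?H $$ (i, j) - (0\<^sub>m n ?q :: 'a mat) $$ (i, j)))\<^sup>2) =
          (\<Sum>i<n. \<Sum>j<?q. (norm (coeff (N $$ (i, j)) (rd i)))\<^sup>2)"
        by (intro sum.cong refl) (simp add: Hc)
      also have "\<dots> \<le> F\<^sup>2" unfolding F2 using lead_le rd_le by (intro sum_mono) simp
      finally show "(\<Sum>i<n. \<Sum>j<?q. (norm (?H $$ (i, j) - (0\<^sub>m n ?q :: 'a mat) $$ (i, j)))\<^sup>2) \<le> F\<^sup>2" .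
    qed (use \<open>\<not> \<rho> \<le> F\<close> in \<open>simp_all add: \<rho>_def\<close>)
    then have "(1::'a) = 0"
      by (rule indepD[where i = 0 and c = "\<lambda>_. 1"]) (use n in auto)
    then show False by simp
  qed
  \<comment> \<open>As \<delta> is nonnegative, \<open>w\<close> is positive, and so are both of its
    factors; as \<rho> / F is at most 1, \<open>w\<close> is at most
    \<open>\<theta>1\<close>.\<close>
  define w where "w = \<theta>1 * (\<rho> / F)"
  have w: "\<delta> < w / 2" using hyp by (simp add: w_def)
  then have "w > 0" using \<delta>_nonneg by linarith
  then have "\<theta>1 > 0 \<and> \<rho> / F > 0" using \<rho>0 F0 by (simp add: w_def zero_less_mult_iff divide_less_0_iff zero_less_divide_iff)
  then have \<theta>1: "\<theta>1 > 0" and Fpos: "F > 0" using F0 by (auto simp: zero_less_divide_iff)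
  have "w \<le> \<theta>1 * 1" unfolding w_def using \<rho>F Fpos \<theta>1 by (intro mult_left_mono) auto
  then have \<delta>1: "\<delta> < \<theta>1 / 2" using w by linarith
  note tb = theta_bounds[OF k0, where m = m and n = n and d = d and t = t and M = M, folded \<theta>1_def \<theta>2_def]
  have \<theta>2: "\<theta>2 > 0" "\<delta> < \<theta>2 / 2" using tb(1) \<theta>1 \<delta>1 by simp_all
  have small: "sqrt (real l) * \<delta> < s" if "\<theta>1 \<le> s / sqrt (real l)" "l > 0" for s l
  proof -
    have "\<delta> < s / sqrt (real l)" using that(1) \<delta>1 \<theta>1 by linarith
    then show ?thesis using that(2) by (simp add: field_simps)
  qed

  have surj': "syl_surj d M' k'"
    by (rule wide_surj[OF k0 wide small[OF tb(2) k0]]) simp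
  \<comment> \<open>The matrix is square, so the singular value that gives surjectivity gives
    injectivity too.\<close>
  have injt0: "syl_inj M' k'" if "t = 0"
  proof (rule tall_inj[OF k0])
    have eq: "k' * ?q = (k' + d) * m" using t0[OF that] by (simp add: algebra_simps)
    then show "k' * ?q \<le> (k' + d) * m" by simp
    show "sqrt (real k') * \<delta> < \<sigma> (k' * ?q) (sylvester d k' M)" unfolding eq by (rule small[OF tb(2) k0])
  qed
  have injt: "syl_inj M' k"
  proof (cases "t = 0")
    case True
    then show ?thesis using syl_inj_antimono[OF injt0] k by simp
  next
    case False
    show ?thesis
    proof (cases "k = 0")
      case True
      then show ?thesis using inj0 by simp
    next
      case k1: False
      show ?thesis
      proof (rule tall_inj)
        show "k * ?q \<le> (k + d) * m" using ndlt by (simp add: algebra_simps)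
        \<comment> \<open>This is the use of the term of \<open>theta1\<close> that belongs to
          \<open>k' - 1\<close>.\<close>
        show "sqrt (real k) * \<delta> < \<sigma> (k * ?q) (sylvester d k M)"
          using small[of _ k] tb(5) False k1 k by simp
      qed (use k1 in simp)
    qed
  qed
  \<comment> \<open>Surjectivity passes from \<open>k'\<close> upwards and injectivity from
    \<open>k\<close> downwards. Injectivity at \<open>k'\<close> itself is required just if
    \<open>t = 0\<close>.\<close>
  have full: "full_sylvester_rank d M'"
    unfolding full_sylvester_rank_iff[OF M' q]
  proof (intro allI impI conjI)
    fix l assume "1 \<le> l" and le: "m * d \<le> n * l"
    have "n * k < n * l" using ndlt le by (rule less_le_trans)
    then have "k' \<le> l" using k by simp
    then show "syl_surj d M' l" using syl_surj_mono[OF surj'] k0 by simp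
  next
    fix l assume "1 \<le> l" and le: "n * l \<le> m * d"
    have "n * l \<le> n * k'" using le mdle by (rule le_trans)
    then have l: "l \<le> k'" using n by simp
    show "syl_inj M' l"
    proof (cases "l = k'")
      case True
      then have "t = 0" using le t by simp
      then show ?thesis using injt0 True by simp
    next
      case False
      then show ?thesis using syl_inj_antimono[OF injt, of l] l k by simp
    qed
  qed

  \<comment> \<open>The Sylvester index of row \<open>i\<close> is \<open>rd i + 1\<close>, which is
    \<open>k'\<close> or \<open>k' + 1\<close>, and always \<open>k' + 1\<close> if
    \<open>t = 0\<close>. Exactly these indices occur in \<open>theta2\<close>.\<close>
  have ex: "\<exists>v'\<in>poly_vecs ?q (Suc (rd i)). (\<forall>r<m. pmul M' v' r = 0) \<and>
      pnorm ?q (Suc (rd i)) (\<lambda>j. N $$ (i, j) - v' j) \<le> 2 / \<theta>2 * \<delta> * pnorm ?q (Suc (rd i)) (\<lambda>j. N $$ (i, j))"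
    if i: "i < n" for i
  proof (rule wide_project_theta[OF _ wide _ \<theta>2(2) Nvec[OF i]])
    show "k' \<le> Suc (rd i)" using rd_ge[OF i] k by simp
    show "\<theta>2 \<le> \<sigma> ((Suc (rd i) + d) * m) (sylvester d (Suc (rd i)) M) / sqrt (real (Suc (rd i)))"
    proof (cases "rd i = k'")
      case True
      then show ?thesis using tb(3) by simp
    next
      case False
      then have "t > 0" "Suc (rd i) = k'" using rd0[OF i] rd_le[OF i] rd_ge[OF i] k by auto
      then show ?thesis using tb(4) by simp
    qed
  qed (use kerN[OF i] in simp_all)
  define X where "X i = (SOME v'. v' \<in> poly_vecs ?q (Suc (rd i)) \<and> (\<forall>r<m. pmul M' v' r = 0) \<and>
      pnorm ?q (Suc (rd i)) (\<lambda>j. N $$ (i, j) - v' j) \<le> 2 / \<theta>2 * \<delta> * pnorm ?q (Suc (rd i)) (\<lambda>j. N $$ (i, j)))"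
    for i
  have X0: "X i \<in> poly_vecs ?q (Suc (rd i)) \<and> (\<forall>r<m. pmul M' (X i) r = 0) \<and>
      pnorm ?q (Suc (rd i)) (\<lambda>j. N $$ (i, j) - X i j) \<le> 2 / \<theta>2 * \<delta> * pnorm ?q (Suc (rd i)) (\<lambda>j. N $$ (i, j))"
    if "i < n" for i
    using ex[OF that] unfolding X_def Bex_def by (rule someI_ex)
  note X = X0[THEN conjunct1] X0[THEN conjunct2, THEN conjunct1, rule_format] X0[THEN conjunct2, THEN conjunct2]
  define N' where "N' = mat n ?q (\<lambda>(i, j). X i j)"
  have N'c: "N' \<in> carrier_mat n ?q" by (simp add: N'_def)
  have N'X: "N' $$ (i, j) = X i j" if "i < n" "j < ?q" for i j using that by (simp add: N'_def)
  \<comment> \<open>No row gains degree by the correction, so the degree sum stays at most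
    \<open>m * d\<close>.\<close>
  have degX: "degree (X i j) \<le> rd i" if "i < n" "j < ?q" for i j
    using poly_vecsD[OF X(1) that(2)] that(1) by (intro degree_le) auto
  have N': "N' \<in> poly_mats n ?q k'"
    using N'c N'X le_trans[OF degX rd_le] by (simp add: poly_mats_def)
  have rowN': "row N' i \<in> carrier_vec ?q" if "i < n" for i using N'c that by auto
  have rd'_le: "vec_degree (row N' i) \<le> rd i" if "i < n" for i
    using vec_degree_le_iff[OF rowN'[OF that] q] degX N'X N'c that by auto
  have ker': "pmul M' (\<lambda>j. N' $$ (i, j)) r = 0" if "i < n" "r < m" for i r
  proof -
    have "pmul M' (\<lambda>j. N' $$ (i, j)) r = pmul M' (X i) r"
      unfolding pmul_def using N'X[OF that(1)] Mc' by (intro sum.cong) auto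
    then show ?thesis using X(2)[OF that] by simp
  qed

  let ?E = "frobenius_norm (sylvester k' 1 N - sylvester k' 1 N')"
  have E2: "?E\<^sup>2 = (\<Sum>i<n. (pnorm ?q (Suc k') (\<lambda>j. N $$ (i, j) - X i j))\<^sup>2)"
  proof -
    have "?E\<^sup>2 = (\<Sum>i<n. (pnorm ?q (Suc k') (\<lambda>j. (N - N') $$ (i, j)))\<^sup>2)"
      unfolding sylvester_minus[OF Nc N'c] by (rule frobenius_sylvester[OF minus_carrier_mat[OF N'c] n])
    also have "\<dots> = (\<Sum>i<n. (pnorm ?q (Suc k') (\<lambda>j. N $$ (i, j) - X i j))\<^sup>2)"
      using Nc N'c N'X by (intro sum.cong refl arg_cong[of _ _ "\<lambda>x. x\<^sup>2"] pnorm_cong) simp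
    finally show ?thesis .
  qed
  have E: "?E \<le> 2 / \<theta>2 * \<delta> * F"
  proof (rule power2_le_imp_le)
    have "?E\<^sup>2 \<le> (\<Sum>i<n. (2 / \<theta>2 * \<delta> * pnorm ?q (Suc k') (\<lambda>j. N $$ (i, j)))\<^sup>2)"
      unfolding E2
    proof (intro sum_mono power_mono)
      fix i assume "i \<in> {..<n}"
      then have i: "i < n" by simp
      have "(\<lambda>j. N $$ (i, j) - X i j) \<in> poly_vecs ?q (Suc (rd i))"
        using Nvec[OF i, of "Suc (rd i)"] X(1)[OF i] by (simp add: poly_vecs_def)
      from pnorm_extend[OF this, of "Suc k'"] pnorm_extend[OF Nvec[OF i], of "Suc (rd i)" "Suc k'"]
      show "pnorm ?q (Suc k') (\<lambda>j. N $$ (i, j) - X i j) \<le> 2 / \<theta>2 * \<delta> * pnorm ?q (Suc k') (\<lambda>j. N $$ (i, j))"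
        using X(3)[OF i] rd_le[OF i] by simp
    qed simp
    also have "\<dots> = (2 / \<theta>2 * \<delta> * F)\<^sup>2"
      unfolding power_mult_distrib F2 by (simp add: sum_distrib_left)
    finally show "?E\<^sup>2 \<le> (2 / \<theta>2 * \<delta> * F)\<^sup>2" .
    show "0 \<le> 2 / \<theta>2 * \<delta> * F" using \<theta>2 \<delta>_nonneg F0 by simp
  qed
  \<comment> \<open>Since \<open>\<theta>1 \<le> \<theta>2\<close>, the error is at most 2 \<delta>
    F / \<open>\<theta>1\<close>, and the hypothesis says that this is less than \<rho>.\<close>
  have E\<rho>: "?E < \<rho>"
  proof -
    have "2 / \<theta>2 * \<delta> * F \<le> 2 / \<theta>1 * \<delta> * F"
      using tb(1) \<theta>1 \<delta>_nonneg F0 by (intro mult_right_mono) (auto intro: divide_left_mono)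
    also have "\<dots> < \<rho>" using hyp \<theta>1 Fpos by (simp add: field_simps)
    finally show ?thesis using E by simp
  qed

  \<comment> \<open>The coefficients are taken at the row degrees of N, since a row of
    \<open>N'\<close> might have lost degree. Its distance to \<open>?H\<close> is at most
    \<open>?E\<close>, because each row of the difference is a coefficient vector of N - N'.\<close>
  define B where "B = mat n ?q (\<lambda>(i, j). coeff (X i j) (rd i))"
  have "indep {..<n} {..<?q} (\<lambda>i j. B $$ (i, j))"
  proof (rule indep_perturb[OF H _ n])
    have "(\<Sum>i<n. \<Sum>j<?q. (norm (?H $$ (i, j) - B $$ (i, j)))\<^sup>2) =
        (\<Sum>i<n. \<Sum>j<?q. (norm (coeff (N $$ (i, j) - X i j) (rd i)))\<^sup>2)"
      by (intro sum.cong refl) (simp add: Hc B_def)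
    also have "\<dots> \<le> ?E\<^sup>2"
      unfolding E2 using lead_le[OF rd_le, of _ "\<lambda>j. N $$ (_, j) - X _ j"] by (intro sum_mono) (simp add: lead_le rd_le)
    finally show "(\<Sum>i<n. \<Sum>j<?q. (norm (?H $$ (i, j) - B $$ (i, j)))\<^sup>2) \<le> ?E\<^sup>2" .
  qed (use E\<rho> in \<open>simp_all add: \<rho>_def\<close>)
  then have "indep {..<n} {..<?q} (\<lambda>i j. coeff (N' $$ (i, j)) (rd i))"
    by (subst indep_cong[of _ _ _ "\<lambda>i j. B $$ (i, j)"]) (simp_all add: B_def N'X)
  then have ind': "fract_indep {..<n} ?q (\<lambda>i j. N' $$ (i, j))"
    using poly_vecsD[OF X(1)] by (intro fract_indep_leading[where e = rd]) (auto simp: N'X)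
  have sum': "(\<Sum>i<n. vec_degree (row N' i)) \<le> m * d"
    using sum_rd rd'_le by (meson sum_mono le_trans lessThan_iff)
  have minN': "minimal_basis N'"
    by (rule minimal_basis_dual[OF M' m surj'[unfolded k] injt N'c ind' ker' sum'])
  have minM': "minimal_basis M'"
    by (rule minimal_basis_of_surj[OF M' n surj'[unfolded k]]) (use mdle k in simp)
  have "M' * transpose_mat N' = 0\<^sub>m m n"
  proof (rule eq_matI)
    fix r i assume "r < dim_row (0\<^sub>m m n :: 'a poly mat)" "i < dim_col (0\<^sub>m m n :: 'a poly mat)"
    then have ri: "r < m" "i < n" by simp_all
    have "(M' * transpose_mat N') $$ (r, i) = pmul M' (\<lambda>j. N' $$ (i, j)) r"
      using Mc' N'c ri by (simp add: pmul_def scalar_prod_def atLeast0LessThan)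
    then show "(M' * transpose_mat N') $$ (r, i) = 0\<^sub>m m n $$ (r, i)" using ker' ri by simp
  qed (use Mc' N'c in simp_all)
  then have dual: "dual_minimal_bases M' N'"
    using Mc' N'c minM' minN' by (simp add: dual_minimal_bases_def)
  have "?E / F \<le> 2 / \<theta>2 * \<delta>" using E Fpos by (simp add: pos_divide_le_eq)
  moreover have "row_degree N' i = k' \<and> row_degree N i = k'" if "t = 0" "i < n" for i
  proof
    show "row_degree N i = k'" using rd0[OF that(2,1)] by (simp add: rd_def)
    \<comment> \<open>A row of smaller degree would be a nonzero kernel vector of the injective
      S_k'(M').\<close>
    have "\<not> vec_degree (row N' i) < k'"
    proof
      assume less: "vec_degree (row N' i) < k'"
      have "(\<lambda>j. N' $$ (i, j)) \<in> poly_vecs ?q k'"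
        using coeff_vec_degree[OF rowN'[OF that(2)]] less N'c that(2) by (auto simp: poly_vecs_def)
      then have "\<forall>j<?q. N' $$ (i, j) = 0" using injt0[OF that(1)] ker' that(2) Mc' by (auto simp: syl_inj_def)
      then show False using fract_indep_nonzero[OF _ ind', of i] that(2) by auto
    qed
    then show "row_degree N' i = k'" using rd'_le[OF that(2)] rd_le[OF that(2)] by (simp add: row_degree_def)
  qed
  ultimately show ?thesis
    using full N' dual unfolding F_def \<theta>2_def \<delta>_def by blast
qed

end
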